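(* Let $U\subset\mathbb{R}^n$, $V\subset\mathbb{R}^m$ be open, let $X\subset U$, $Y\subset V$ be closed in $U$, $V$ respectively, and let $\varphi:V\to U$ be a $\mathcal{C}^p$ mapping with $\varphi(Y)\subset X$. Then: (1) For every $b\in Y$ and $\eta\in\tau^p_b(Y)$ one has $\varphi_{*b}(\eta)\in\tau^p_{\varphi(b)}(X)$, and the map $\varphi_*:\tau^p(Y)\to\tau^p(X)$, $(b,\eta)\mapsto(\varphi(b),\varphi_{*b}(\eta))$, is a bundle morphism (continuous, and linear on each fibre). Moreover, let $f:X\to\mathbb{R}$, set $g=f\circ\varphi:Y\to\mathbb{R}$, and suppose $\nabla^pf:\tau^p(X)\to\mathbb{R}$. Then: (2) $\nabla^pg:\tau^p(Y)\to\mathbb{R}$, and for $b\in Y$, $\eta\in\tau^p_b(Y)$: $\nabla^pg(\eta)=\nabla^pf(\varphi_{*b}\eta)$. (3) Let $b\in Y$, $a=\varphi(b)$, and choose $P\in\mathcal{P}_p(\mathbb{R}^n)$ such that $\xi(P)=\nabla^pf(\xi)$ for all $\xi\in\tau^p_a(X)$. Then $\nabla^pg(\eta)=\eta(\varphi^*_b(P))$ for all $\eta\in\tau^p_b(Y)$.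
   Context: For $d\in\{n,m\}$ and a closed subset $Z$ of an open set in $\mathbb{R}^d$: $\mathcal{P}_p=\mathcal{P}_p(\mathbb{R}^d)$ is the space of real polynomials of degree $\le p$, $\mathcal{P}_p^*$ its dual, $r=\dim\mathcal{P}_p$; for $\zeta\in\mathcal{P}_p^*$, $c\in\mathbb{R}^d$, $|\gamma|\le p$: $\zeta_\gamma(c):=\zeta(\tfrac1{\gamma!}(x-c)^\gamma)$; $\delta_a(P)=P(a)$. A bundle over $Z$ with fibres in $W$ is a subset of $Z\times W$ with linear-subspace fibres. For a bundle $E\subset Z\times\mathcal{P}_p^*$: $\Delta E=\{(a,b,\xi+\eta):a,b\in Z,\xi\in E_a,\eta\in E_b,|a-b|^{p-|\gamma|}|\eta_\gamma(b)|\le1\ \forall|\gamma|\le p\}$, $E'=\{(a,\xi):(a,a,\xi)\in\overline{\Delta E}\}$, $\rho(E)=\{(a,\xi):\xi\in\operatorname{Span}E'_a\}$; $\tau^p(Z):=\rho^{2r}(E_0)$ with $E_0=\{(a,\lambda\delta_a)\}$ (iterates constant from $2r$ on). For $h:Z\to\mathbb{R}$ and bundles $\Phi\subset Z\times(\mathcal{P}_p^*\times\mathbb{R})$: $\Delta\Phi=\{(a,b,\xi+\eta,\lambda+\mu):(\xi,\lambda)\in\Phi_a,(\eta,\mu)\in\Phi_b,|a-b|^{p-|\gamma|}|\eta_\gamma(b)|\le1\ \forall|\gamma|\le p\}$, $\Phi'=\{(a,\xi,\lambda):(a,a,\xi,\lambda)\in\overline{\Delta\Phi}\}$, $\rho(\Phi)$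 fibrewise span of $\Phi'$; $\nabla^ph:=\rho^{2(r+1)}(\Phi_0)$ with $\Phi_0=\{(a,\lambda\delta_a,\lambda h(a))\}$. "$\nabla^ph:\tau^p(Z)\to\mathbb{R}$" means each $\xi\in\tau^p_a(Z)$ has exactly one $\lambda$ with $(a,\xi,\lambda)\in\nabla^ph$, denoted $\nabla^ph(\xi)$. For $b\in V$: $\varphi^*_b:\mathcal{P}_p(\mathbb{R}^n)\to\mathcal{P}_p(\mathbb{R}^m)$, $\varphi^*_b(P)=T^p_b(P\circ\varphi)$ (Taylor polynomial of order $p$ at $b$); $\varphi_{*b}$ is its dual map $\mathcal{P}_p(\mathbb{R}^m)^*\to\mathcal{P}_p(\mathbb{R}^n)^*$. *)

theory Defs
  imports "HOL-Analysis.Analysis"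
begin

section \<open>Polynomials of degree at most p on R^d and their duals\<close>

text \<open>Multi-indices on the coordinate type 'd are functions 'd => nat.
A polynomial of degree at most p is represented by its coefficient function
(coefficient of x^gamma); an element zeta of the dual space is represented by
its values on the monomial basis, zeta(x^gamma).  Both are functions
('d => nat) => real vanishing outside the multi-indices of degree at most p.\<close>

definition mi_deg :: "('d::finite \<Rightarrow> nat) \<Rightarrow> nat" where
  "mi_deg \<gamma> = (\<Sum>i\<in>UNIV. \<gamma> i)"

definition mons :: "nat \<Rightarrow> ('d::finite \<Rightarrow> nat) set" where
  "mons p = {\<gamma>. mi_deg \<gamma> \<le> p}"

definition mi_fact :: "('d::finite \<Rightarrow> nat) \<Rightarrow> real" where
  "mi_fact \<gamma> = (\<Prod>i\<in>UNIV. fact (\<gamma> i))"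

text \<open>r = dim P_p(R^d)\<close>
definition dimP :: "nat \<Rightarrow> 'd::finite itself \<Rightarrow> nat" where
  "dimP p (_::'d itself) = card (mons p :: ('d \<Rightarrow> nat) set)"

text \<open>The space P_p(R^d) (and, with the same shape, its dual).\<close>
definition Pp :: "nat \<Rightarrow> (('d::finite \<Rightarrow> nat) \<Rightarrow> real) set" where
  "Pp p = {P. \<forall>\<gamma>. \<gamma> \<notin> mons p \<longrightarrow> P \<gamma> = 0}"

definition poly_eval :: "nat \<Rightarrow> (('d::finite \<Rightarrow> nat) \<Rightarrow> real) \<Rightarrow> real^'d \<Rightarrow> real" where
  "poly_eval p P x = (\<Sum>\<gamma>\<in>mons p. P \<gamma> * (\<Prod>i\<in>UNIV. (x $ i) ^ (\<gamma> i)))"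

text \<open>the monomial x^gamma\<close>
definition monomial_mi :: "('d::finite \<Rightarrow> nat) \<Rightarrow> (('d \<Rightarrow> nat) \<Rightarrow> real)" where
  "monomial_mi \<gamma> = (\<lambda>\<alpha>. if \<alpha> = \<gamma> then 1 else 0)"

text \<open>Coefficients of the polynomial (1/gamma!) (x - c)^gamma (binomial expansion).\<close>
definition shmon :: "real^'d \<Rightarrow> ('d::finite \<Rightarrow> nat) \<Rightarrow> (('d \<Rightarrow> nat) \<Rightarrow> real)" where
  "shmon c \<gamma> = (\<lambda>\<alpha>. if (\<forall>i. \<alpha> i \<le> \<gamma> i)
       then (\<Prod>i\<in>UNIV. real (\<gamma> i choose \<alpha> i) * (- (c $ i)) ^ (\<gamma> i - \<alpha> i)) / mi_fact \<gamma>
       else 0)"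

text \<open>zeta(P) for zeta in the dual and P in P_p\<close>
definition dual_apply :: "nat \<Rightarrow> (('d::finite \<Rightarrow> nat) \<Rightarrow> real) \<Rightarrow> (('d \<Rightarrow> nat) \<Rightarrow> real) \<Rightarrow> real" where
  "dual_apply p \<zeta> P = (\<Sum>\<gamma>\<in>mons p. \<zeta> \<gamma> * P \<gamma>)"

text \<open>zeta_gamma(c) = zeta((x-c)^gamma / gamma!)\<close>
definition dcomp :: "nat \<Rightarrow> (('d::finite \<Rightarrow> nat) \<Rightarrow> real) \<Rightarrow> ('d \<Rightarrow> nat) \<Rightarrow> real^'d \<Rightarrow> real" where
  "dcomp p \<zeta> \<gamma> c = dual_apply p \<zeta> (shmon c \<gamma>)"

text \<open>delta_a(P) = P(a)\<close>
definition delta :: "nat \<Rightarrow> real^'d \<Rightarrow> (('d::finite \<Rightarrow> nat) \<Rightarrow> real)" where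
  "delta p a = (\<lambda>\<gamma>. if \<gamma> \<in> mons p then (\<Prod>i\<in>UNIV. (a $ i) ^ (\<gamma> i)) else 0)"

text \<open>Linear span in the function space (finite linear combinations).\<close>
definition fspan :: "('b \<Rightarrow> real) set \<Rightarrow> ('b \<Rightarrow> real) set" where
  "fspan S = {\<xi>. \<exists>F c. finite F \<and> F \<subseteq> S \<and> \<xi> = (\<lambda>\<gamma>. \<Sum>v\<in>F. c v * v \<gamma>)}"

definition fspan2 :: "(('b \<Rightarrow> real) \<times> real) set \<Rightarrow> (('b \<Rightarrow> real) \<times> real) set" where
  "fspan2 S = {(\<xi>, l). \<exists>F c. finite F \<and> F \<subseteq> S \<and> \<xi> = (\<lambda>\<gamma>. \<Sum>v\<in>F. c v * fst v \<gamma>)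
                                   \<and> l = (\<Sum>v\<in>F. c v * snd v)}"

section \<open>The paratangent bundle tau^p(Z)\<close>

definition Wcond :: "nat \<Rightarrow> real^'d \<Rightarrow> real^'d \<Rightarrow> (('d::finite \<Rightarrow> nat) \<Rightarrow> real) \<Rightarrow> bool" where
  "Wcond p a b \<eta> = (\<forall>\<gamma>\<in>mons p. norm (a - b) ^ (p - mi_deg \<gamma>) * \<bar>dcomp p \<eta> \<gamma> b\<bar> \<le> 1)"

definition E0 :: "nat \<Rightarrow> (real^'d) set \<Rightarrow> ((real^'d) \<times> (('d::finite \<Rightarrow> nat) \<Rightarrow> real)) set" where
  "E0 p Z = {(a, (\<lambda>\<gamma>. l * delta p a \<gamma>)) | a l. a \<in> Z}"

definition DeltaE :: "nat \<Rightarrow> ((real^'d) \<times> (('d::finite \<Rightarrow> nat) \<Rightarrow> real)) set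
      \<Rightarrow> ((real^'d) \<times> (real^'d) \<times> (('d \<Rightarrow> nat) \<Rightarrow> real)) set" where
  "DeltaE p E = {(a, b, (\<lambda>\<gamma>. \<xi> \<gamma> + \<eta> \<gamma>)) | a b \<xi> \<eta>.
       (a, \<xi>) \<in> E \<and> (b, \<eta>) \<in> E \<and> Wcond p a b \<eta>}"

definition primeE :: "nat \<Rightarrow> ((real^'d) \<times> (('d::finite \<Rightarrow> nat) \<Rightarrow> real)) set
      \<Rightarrow> ((real^'d) \<times> (('d \<Rightarrow> nat) \<Rightarrow> real)) set" where
  "primeE p E = {(a, \<xi>). (a, a, \<xi>) \<in> closure (DeltaE p E)}"

definition rhoE :: "nat \<Rightarrow> (real^'d) set \<Rightarrow> ((real^'d) \<times> (('d::finite \<Rightarrow> nat) \<Rightarrow> real)) set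
      \<Rightarrow> ((real^'d) \<times> (('d \<Rightarrow> nat) \<Rightarrow> real)) set" where
  "rhoE p Z E = {(a, \<xi>). a \<in> Z \<and> \<xi> \<in> fspan {\<xi>'. (a, \<xi>') \<in> primeE p E}}"

definition tau :: "nat \<Rightarrow> (real^'d) set \<Rightarrow> ((real^'d) \<times> (('d::finite \<Rightarrow> nat) \<Rightarrow> real)) set" where
  "tau p Z = (rhoE p Z ^^ (2 * dimP p TYPE('d))) (E0 p Z)"

section \<open>The bundle nabla^p h\<close>

definition Phi0 :: "nat \<Rightarrow> (real^'d) set \<Rightarrow> (real^'d \<Rightarrow> real)
      \<Rightarrow> ((real^'d) \<times> (('d::finite \<Rightarrow> nat) \<Rightarrow> real) \<times> real) set" where
  "Phi0 p Z h = {(a, (\<lambda>\<gamma>. l * delta p a \<gamma>), l * h a) | a l. a \<in> Z}"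

definition DeltaPhi :: "nat \<Rightarrow> ((real^'d) \<times> (('d::finite \<Rightarrow> nat) \<Rightarrow> real) \<times> real) set
      \<Rightarrow> ((real^'d) \<times> (real^'d) \<times> (('d \<Rightarrow> nat) \<Rightarrow> real) \<times> real) set" where
  "DeltaPhi p \<Phi> = {(a, b, (\<lambda>\<gamma>. \<xi> \<gamma> + \<eta> \<gamma>), l + m) | a b \<xi> \<eta> l m.
       (a, \<xi>, l) \<in> \<Phi> \<and> (b, \<eta>, m) \<in> \<Phi> \<and> Wcond p a b \<eta>}"

definition primePhi :: "nat \<Rightarrow> ((real^'d) \<times> (('d::finite \<Rightarrow> nat) \<Rightarrow> real) \<times> real) set
      \<Rightarrow> ((real^'d) \<times> (('d \<Rightarrow> nat) \<Rightarrow> real) \<times> real) set" where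
  "primePhi p \<Phi> = {(a, \<xi>, l). (a, a, \<xi>, l) \<in> closure (DeltaPhi p \<Phi>)}"

definition rhoPhi :: "nat \<Rightarrow> (real^'d) set \<Rightarrow> ((real^'d) \<times> (('d::finite \<Rightarrow> nat) \<Rightarrow> real) \<times> real) set
      \<Rightarrow> ((real^'d) \<times> (('d \<Rightarrow> nat) \<Rightarrow> real) \<times> real) set" where
  "rhoPhi p Z \<Phi> = {(a, \<xi>, l). a \<in> Z \<and> (\<xi>, l) \<in> fspan2 {v. (a, v) \<in> primePhi p \<Phi>}}"

definition nabla :: "nat \<Rightarrow> (real^'d) set \<Rightarrow> (real^'d \<Rightarrow> real)
      \<Rightarrow> ((real^'d) \<times> (('d::finite \<Rightarrow> nat) \<Rightarrow> real) \<times> real) set" where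
  "nabla p Z h = (rhoPhi p Z ^^ (2 * (dimP p TYPE('d) + 1))) (Phi0 p Z h)"

text \<open>"nabla^p h : tau^p(Z) -> R"\<close>
definition nabla_is_fun :: "nat \<Rightarrow> (real^'d::finite) set \<Rightarrow> (real^'d \<Rightarrow> real) \<Rightarrow> bool" where
  "nabla_is_fun p Z h = (\<forall>a \<xi>. (a, \<xi>) \<in> tau p Z \<longrightarrow> (\<exists>!l. (a, \<xi>, l) \<in> nabla p Z h))"

text \<open>the value nabla^p h(xi) for xi in tau^p_a(Z)\<close>
definition nabla_val :: "nat \<Rightarrow> (real^'d::finite) set \<Rightarrow> (real^'d \<Rightarrow> real) \<Rightarrow> real^'d
      \<Rightarrow> (('d \<Rightarrow> nat) \<Rightarrow> real) \<Rightarrow> real" where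
  "nabla_val p Z h a \<xi> = (THE l. (a, \<xi>, l) \<in> nabla p Z h)"

section \<open>C^p mappings and Taylor polynomials\<close>

definition partial :: "'m \<Rightarrow> (real^'m::finite \<Rightarrow> real) \<Rightarrow> real^'m \<Rightarrow> real" where
  "partial i h x = deriv (\<lambda>t. h (x + t *\<^sub>R axis i 1)) 0"

fun Cp :: "nat \<Rightarrow> (real^'m::finite \<Rightarrow> real) \<Rightarrow> (real^'m) set \<Rightarrow> bool" where
  "Cp 0 h V = continuous_on V h"
| "Cp (Suc k) h V = (continuous_on V h \<and>
      (\<forall>i. \<forall>x\<in>V. (\<lambda>t. h (x + t *\<^sub>R axis i 1)) differentiable (at 0)) \<and>
      (\<forall>i. Cp k (partial i h) V))"

text \<open>vector-valued C^p maps: all components C^p (all partial derivatives of order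
  at most p exist and are continuous on V)\<close>
definition Cp_map :: "nat \<Rightarrow> (real^'m::finite \<Rightarrow> real^'n::finite) \<Rightarrow> (real^'m) set \<Rightarrow> bool" where
  "Cp_map p \<phi> V = (\<forall>j. Cp p (\<lambda>y. \<phi> y $ j) V)"

fun partials :: "'m list \<Rightarrow> (real^'m::finite \<Rightarrow> real) \<Rightarrow> real^'m \<Rightarrow> real" where
  "partials [] h = h"
| "partials (i # is) h = partial i (partials is h)"

text \<open>higher partial derivative of multi-index beta\<close>
definition hpartial :: "('m::finite \<Rightarrow> nat) \<Rightarrow> (real^'m \<Rightarrow> real) \<Rightarrow> real^'m \<Rightarrow> real" where
  "hpartial \<beta> h = partials (SOME L. \<forall>i. count_list L i = \<beta> i) h"

text \<open>Taylor polynomial T^p_b(h), as coefficient function of a polynomial in x: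
  sum over |beta| <= p of d^beta h(b) (x-b)^beta / beta!\<close>
definition taylor :: "nat \<Rightarrow> (real^'m::finite \<Rightarrow> real) \<Rightarrow> real^'m \<Rightarrow> (('m \<Rightarrow> nat) \<Rightarrow> real)" where
  "taylor p h b = (\<lambda>\<alpha>. \<Sum>\<beta>\<in>mons p. hpartial \<beta> h b * shmon b \<beta> \<alpha>)"

text \<open>phi^*_b(P) = T^p_b(P o phi)\<close>
definition pullback :: "nat \<Rightarrow> (real^'m::finite \<Rightarrow> real^'n::finite) \<Rightarrow> real^'m
      \<Rightarrow> (('n \<Rightarrow> nat) \<Rightarrow> real) \<Rightarrow> (('m \<Rightarrow> nat) \<Rightarrow> real)" where
  "pullback p \<phi> b P = taylor p (\<lambda>y. poly_eval p P (\<phi> y)) b"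

text \<open>phi_{*b}, the dual map of phi^*_b\<close>
definition pushfwd :: "nat \<Rightarrow> (real^'m::finite \<Rightarrow> real^'n::finite) \<Rightarrow> real^'m
      \<Rightarrow> (('m \<Rightarrow> nat) \<Rightarrow> real) \<Rightarrow> (('n \<Rightarrow> nat) \<Rightarrow> real)" where
  "pushfwd p \<phi> b \<eta> = (\<lambda>\<gamma>. if \<gamma> \<in> mons p then dual_apply p \<eta> (pullback p \<phi> b (monomial_mi \<gamma>)) else 0)"

end

theory Submission
  imports Defs "HOL-Library.Multiset"
begin

text \<open>
  The bundle \<open>\<tau>\<^sup>p(Z)\<close> is \<open>\<nabla>\<^sup>p 0\<close> with the zero second component dropped, so only the bundles
  \<open>\<Phi>\<^sub>k = \<rho>\<^sup>k(\<Phi>\<^sub>0)\<close> matter.  Three facts give the theorem.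

  \<^item> Pushing forward maps \<open>\<Phi>\<^sub>k\<close> of \<open>f \<circ> \<phi>\<close> on \<open>Y\<close> into \<open>\<Phi>\<^sub>k\<close> of \<open>f\<close> on \<open>X\<close>, for every \<open>k\<close>.  If
    \<open>\<xi>\<^sub>i + \<eta>\<^sub>i\<close> (over \<open>b\<^sub>i, c\<^sub>i \<rightarrow> b\<close>) tends to \<open>\<zeta>\<close>, the sum of the pushforwards differs from the pushforward
    of \<open>\<xi>\<^sub>i + \<eta>\<^sub>i\<close> at \<open>b\<^sub>i\<close> by \<open>\<eta>\<^sub>i\<close> applied to a difference of Taylor polynomials at \<open>c\<^sub>i\<close> and \<open>b\<^sub>i\<close>.  Its
    coefficients at \<open>c\<^sub>i\<close> are Taylor remainders \<open>o(|b\<^sub>i - c\<^sub>i|\<^bsup>p - |\<gamma>|\<^esup>)\<close>, exactly what the growth condition on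
    \<open>\<eta>\<^sub>i\<close> compensates.  The growth condition itself survives up to a constant factor because the pullback
    of \<open>(x - \<phi>(c))\<^sup>\<gamma>\<close> vanishes to order \<open>|\<gamma>|\<close> at \<open>c\<close> and \<open>\<phi>\<close> is locally Lipschitz; fibres are linear, so a
    constant is harmless.

  \<^item> The numbers of iterations used for \<open>X\<close> and for \<open>Y\<close> differ, so the stabilization of \<open>\<Phi>\<^sub>k\<close> after
    twice the fibre dimension is needed (Glaeser's semicontinuity argument).

  \<^item> Every element of \<open>\<tau>\<^sup>p(Y)\<close> lifts to \<open>\<nabla>\<^sup>p(f \<circ> \<phi>)\<close>: in an approximating sequence the real components
    stay bounded along a subsequence, since otherwise rescaling would put \<open>(0, 1)\<close> into a fibre of the
    single-valued \<open>\<nabla>\<^sup>p f\<close>.  Uniqueness and the formulas follow by pushing forward.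
\<close>

section \<open>Stabilization of increasing sequences of fibrewise subspaces\<close>

definition fun_subspace :: "('b \<Rightarrow> real) set \<Rightarrow> bool" where
  "fun_subspace S \<longleftrightarrow> (\<lambda>_. 0) \<in> S \<and> (\<forall>c. \<forall>\<xi>\<in>S. \<forall>\<eta>\<in>S. (\<lambda>\<gamma>. c * \<xi> \<gamma> + \<eta> \<gamma>) \<in> S)"

text \<open>The injection \<open>to_nat\<close> merely supplies a well-order of the countable index
  set, so that every nonzero vector has a first nonzero coordinate, as in a row echelon
  form.\<close>

definition leads :: "('b::countable \<Rightarrow> real) \<Rightarrow> 'b \<Rightarrow> bool" where
  "leads \<xi> \<gamma> \<longleftrightarrow> \<xi> \<gamma> \<noteq> 0 \<and> (\<forall>\<delta>. to_nat \<delta> < to_nat \<gamma> \<longrightarrow> \<xi> \<delta> = 0)"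

text \<open>Leading positions of the elements of a subspace; for finite support their number is the dimension.\<close>

definition pivots :: "('b::countable \<Rightarrow> real) set \<Rightarrow> 'b set" where
  "pivots S = {\<gamma>. \<exists>\<xi>\<in>S. leads \<xi> \<gamma>}"

lemma fun_subspace_zero: "fun_subspace S \<Longrightarrow> (\<lambda>_. 0) \<in> S"
  by (simp add: fun_subspace_def)

lemma fun_subspace_comb: "fun_subspace S \<Longrightarrow> \<xi> \<in> S \<Longrightarrow> \<eta> \<in> S \<Longrightarrow> (\<lambda>\<gamma>. c * \<xi> \<gamma> + \<eta> \<gamma>) \<in> S"
  by (simp add: fun_subspace_def)

lemma fun_subspace_scale: "fun_subspace S \<Longrightarrow> \<xi> \<in> S \<Longrightarrow> (\<lambda>\<gamma>. c * \<xi> \<gamma>) \<in> S"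
  using fun_subspace_comb[of S \<xi> "\<lambda>_. 0" c] by (simp add: fun_subspace_zero)

lemma leads_exists:
  fixes \<xi> :: "'b::countable \<Rightarrow> real"
  assumes "\<xi> \<noteq> (\<lambda>_. 0)"
  shows "\<exists>\<gamma>. leads \<xi> \<gamma>"
proof -
  from assms obtain \<gamma> where "\<xi> \<gamma> \<noteq> 0" by auto
  then obtain \<delta> where "\<xi> \<delta> \<noteq> 0" "\<forall>y. \<xi> y \<noteq> 0 \<longrightarrow> to_nat \<delta> \<le> to_nat y"
    using ex_has_least_nat[of "\<lambda>\<gamma>. \<xi> \<gamma> \<noteq> 0" \<gamma> to_nat] by blast
  then show ?thesis unfolding leads_def by (meson leD)
qed

lemma pivots_mono: "S \<subseteq> T \<Longrightarrow> pivots S \<subseteq> pivots T"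
  by (auto simp: pivots_def)

lemma pivots_support:
  assumes "\<And>\<xi> \<gamma>. \<xi> \<in> S \<Longrightarrow> \<gamma> \<notin> M \<Longrightarrow> \<xi> \<gamma> = 0"
  shows "pivots S \<subseteq> M"
  using assms by (auto simp: pivots_def leads_def)

text \<open>Gaussian elimination: whenever a vector of \<open>T\<close> leads at some position, a
  vector of \<open>S\<close> leads there too, and subtracting a multiple of it pushes the leading
  position further back until the finite support \<open>M\<close> is exhausted.\<close>

lemma fun_subspace_eqI_pivots:
  fixes S T :: "('b::countable \<Rightarrow> real) set"
  assumes S: "fun_subspace S" and T: "fun_subspace T" and ST: "S \<subseteq> T" and P: "pivots T \<subseteq> pivots S"
    and M: "finite M" and supp: "\<And>\<xi> \<gamma>. \<xi> \<in> T \<Longrightarrow> \<gamma> \<notin> M \<Longrightarrow> \<xi> \<gamma> = 0"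
  shows "S = T"
proof -
  \<comment> \<open>\<open>N\<close> exceeds every code of an element of \<open>M\<close>; the
    inserted 0 keeps \<open>Max\<close> meaningful when \<open>M\<close> is empty.\<close>
  define N where "N = Suc (Max (insert 0 (to_nat ` M)))"
  have N: "to_nat \<gamma> < N" if "\<gamma> \<in> M" for \<gamma>
    using M that by (auto simp: N_def less_Suc_eq_le)
  \<comment> \<open>Induction on \<open>m\<close>, the number of codes below \<open>N\<close> that
    remain to be cleared; the positions with code below \<open>n\<close> are already zero.\<close>
  have main: "\<xi> \<in> S" if "\<xi> \<in> T" "\<And>\<delta>. to_nat \<delta> < n \<Longrightarrow> \<xi> \<delta> = 0" "m = N - n" for \<xi> n m
    using that
  proof (induction m arbitrary: n \<xi>)
    case 0
    have "\<xi> \<gamma> = 0" for \<gamma>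
      using 0 supp[of \<xi> \<gamma>] N[of \<gamma>] by (cases "\<gamma> \<in> M") auto
    then have "\<xi> = (\<lambda>_. 0)" by auto
    then show ?case using fun_subspace_zero[OF S] by simp
  next
    case (Suc m)
    show ?case
    proof (cases "\<exists>\<gamma>. to_nat \<gamma> = n \<and> \<xi> \<gamma> \<noteq> 0")
      case True
      then obtain \<gamma> where \<gamma>: "to_nat \<gamma> = n" "\<xi> \<gamma> \<noteq> 0" by auto
      then have "leads \<xi> \<gamma>" using Suc.prems(2) by (auto simp: leads_def)
      then have "\<gamma> \<in> pivots S" using P Suc.prems(1) by (auto simp: pivots_def)
      then obtain s where s: "s \<in> S" "leads s \<gamma>" by (auto simp: pivots_def)
      define c where "c = \<xi> \<gamma> / s \<gamma>"
      have "(\<lambda>\<gamma>. (- c) * s \<gamma> + \<xi> \<gamma>) \<in> S"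
      proof (rule Suc.IH)
        show "(\<lambda>\<gamma>. (- c) * s \<gamma> + \<xi> \<gamma>) \<in> T"
          using T s ST Suc.prems(1) fun_subspace_comb by blast
        show "(- c) * s \<delta> + \<xi> \<delta> = 0" if "to_nat \<delta> < Suc n" for \<delta>
        proof (cases "to_nat \<delta> < n")
          case True
          then show ?thesis using Suc.prems(2) s(2) \<gamma> by (auto simp: leads_def)
        next
          case False
          then have "to_nat \<delta> = to_nat \<gamma>" using that \<gamma> by simp
          then have "\<delta> = \<gamma>" by simp
          then show ?thesis using s(2) by (simp add: c_def leads_def)
        qed
        show "m = N - Suc n" using Suc.prems(3) by simp
      qed
      from fun_subspace_comb[OF S s(1) this, of c] show ?thesis by simp
    next
      case False
      then show ?thesis using Suc.IH[of \<xi> "Suc n"] Suc.prems less_Suc_eq by fastforce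
    qed
  qed
  show ?thesis using ST main[of _ 0] by auto
qed

lemma fun_subspace_vanish: "fun_subspace T \<Longrightarrow> fun_subspace {\<xi>\<in>T. \<forall>\<gamma>\<in>F. \<xi> \<gamma> = 0}"
  by (auto simp: fun_subspace_def)

text \<open>One linear equation costs at most one pivot. Among the vectors violating it, let
  \<open>t\<close> have the last leading position \<open>\<pi>\<close>. A violating vector that
  leads elsewhere leads strictly earlier, so a multiple of \<open>t\<close> corrects it without
  disturbing its leading term.\<close>

lemma pivots_vanish_coord:
  fixes T :: "('b::countable \<Rightarrow> real) set"
  assumes T: "fun_subspace T" and fin: "finite (pivots T)"
  shows "\<exists>\<pi>. pivots T - {\<pi>} \<subseteq> pivots {\<xi>\<in>T. \<xi> \<gamma> = 0}"
proof -
  define A where "A = {\<pi>. \<exists>t\<in>T. leads t \<pi> \<and> t \<gamma> \<noteq> 0}"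
  show ?thesis
  proof (cases "A = {}")
    case True
    then show ?thesis by (auto simp: A_def pivots_def)
  next
    case False
    have finA: "finite A" by (rule finite_subset[OF _ fin]) (auto simp: A_def pivots_def)
    have "Max (to_nat ` A) \<in> to_nat ` A" using finA False by simp
    then obtain \<pi> where \<pi>: "\<pi> \<in> A" "Max (to_nat ` A) = to_nat \<pi>" by auto
    have \<pi>max: "to_nat \<delta> \<le> to_nat \<pi>" if "\<delta> \<in> A" for \<delta>
      using finA that \<pi>(2)[symmetric] by simp
    obtain t where t: "t \<in> T" "leads t \<pi>" "t \<gamma> \<noteq> 0" using \<pi> by (auto simp: A_def)
    have "\<pi>' \<in> pivots {\<xi>\<in>T. \<xi> \<gamma> = 0}" if \<pi>': "\<pi>' \<in> pivots T" "\<pi>' \<noteq> \<pi>" for \<pi>'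
    proof -
      obtain t' where t': "t' \<in> T" "leads t' \<pi>'" using \<pi>' by (auto simp: pivots_def)
      show ?thesis
      proof (cases "t' \<gamma> = 0")
        case True
        then show ?thesis using t' by (auto simp: pivots_def)
      next
        case False
        then have "\<pi>' \<in> A" using t' by (auto simp: A_def)
        then have lt: "to_nat \<pi>' < to_nat \<pi>"
          using \<pi>max \<pi>'(2) by (metis from_nat_to_nat order_le_less)
        define u where "u = (\<lambda>\<delta>. (- (t' \<gamma> / t \<gamma>)) * t \<delta> + t' \<delta>)"
        have "u \<in> T" unfolding u_def by (rule fun_subspace_comb[OF T t(1) t'(1)])
        moreover have "u \<gamma> = 0" using t by (simp add: u_def)
        moreover have "leads u \<pi>'" using t(2) t'(2) lt by (auto simp: u_def leads_def)
        ultimately show ?thesis by (auto simp: pivots_def)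
      qed
    qed
    then show ?thesis by blast
  qed
qed

lemma card_pivots_vanish:
  fixes T :: "('b::countable \<Rightarrow> real) set"
  assumes T: "fun_subspace T" and fin: "finite (pivots T)" and F: "finite F"
  shows "card (pivots T) \<le> card (pivots {\<xi>\<in>T. \<forall>\<gamma>\<in>F. \<xi> \<gamma> = 0}) + card F"
  using F
proof (induction F rule: finite_induct)
  case empty
  then show ?case by simp
next
  case (insert \<gamma> F)
  let ?T = "{\<xi>\<in>T. \<forall>\<gamma>\<in>F. \<xi> \<gamma> = 0}"
  have f: "finite (pivots ?T)" by (rule finite_subset[OF pivots_mono fin]) auto
  obtain \<pi> where \<pi>: "pivots ?T - {\<pi>} \<subseteq> pivots {\<xi>\<in>?T. \<xi> \<gamma> = 0}"
    using pivots_vanish_coord[OF fun_subspace_vanish[OF T] f] by blast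
  have eq: "{\<xi>\<in>?T. \<xi> \<gamma> = 0} = {\<xi>\<in>T. \<forall>\<gamma>\<in>insert \<gamma> F. \<xi> \<gamma> = 0}" by auto
  have f2: "finite (pivots {\<xi>\<in>?T. \<xi> \<gamma> = 0})" by (rule finite_subset[OF pivots_mono f]) auto
  have "card (pivots ?T) \<le> card (pivots ?T - {\<pi>}) + 1" using diff_card_le_card_Diff[of "{\<pi>}" "pivots ?T"] by simp
  also have "card (pivots ?T - {\<pi>}) \<le> card (pivots {\<xi>\<in>?T. \<xi> \<gamma> = 0})"
    by (rule card_mono[OF f2 \<pi>])
  finally show ?case using insert unfolding eq by simp
qed

lemma exists_vanish:
  fixes T :: "('b::countable \<Rightarrow> real) set"
  assumes T: "fun_subspace T" and fin: "finite (pivots T)" and F: "finite F" and lt: "card F < card (pivots T)"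
  shows "\<exists>v\<in>T. v \<noteq> (\<lambda>_. 0) \<and> (\<forall>\<gamma>\<in>F. v \<gamma> = 0)"
proof -
  have "card (pivots {\<xi>\<in>T. \<forall>\<gamma>\<in>F. \<xi> \<gamma> = 0}) > 0"
    using card_pivots_vanish[OF T fin F] lt by linarith
  then have "pivots {\<xi>\<in>T. \<forall>\<gamma>\<in>F. \<xi> \<gamma> = 0} \<noteq> {}" by auto
  then show ?thesis unfolding pivots_def leads_def by fastforce
qed

section \<open>Compactness, semicontinuity of the fibre dimension and stabilization\<close>

text \<open>Bolzano-Weierstrass, applied to one coordinate after the other with nested
  subsequences.\<close>

lemma bounded_funs_convergent_subseq:
  fixes v :: "nat \<Rightarrow> 'b \<Rightarrow> real"
  assumes M: "finite M" and bd: "\<And>i \<gamma>. \<gamma> \<in> M \<Longrightarrow> \<bar>v i \<gamma>\<bar> \<le> B"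
  shows "\<exists>s w. strict_mono (s :: nat \<Rightarrow> nat) \<and> (\<forall>\<gamma>\<in>M. (\<lambda>i. v (s i) \<gamma>) \<longlonglongrightarrow> w \<gamma>)"
  using M bd
proof (induction M rule: finite_induct)
  case empty
  show ?case using strict_mono_id by blast
next
  case (insert \<gamma> F)
  then obtain s w where s: "strict_mono s" "\<forall>\<gamma>\<in>F. (\<lambda>i. v (s i) \<gamma>) \<longlonglongrightarrow> w \<gamma>"
    by (metis insertCI)
  have "bounded (range (\<lambda>i. v (s i) \<gamma>))"
    using insert.prems unfolding bounded_iff by auto
  then obtain l r where r: "strict_mono (r :: nat \<Rightarrow> nat)" "((\<lambda>i. v (s i) \<gamma>) \<circ> r) \<longlonglongrightarrow> l"
    using bounded_imp_convergent_subsequence by blast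
  have "(\<lambda>i. v ((s \<circ> r) i) \<delta>) \<longlonglongrightarrow> (w(\<gamma> := l)) \<delta>" if \<delta>: "\<delta> \<in> insert \<gamma> F" for \<delta>
  proof (cases "\<delta> = \<gamma>")
    case True
    then show ?thesis using r by (simp add: o_def)
  next
    case False
    then have "(\<lambda>i. v (s i) \<delta>) \<longlonglongrightarrow> w \<delta>" using s \<delta> by auto
    from LIMSEQ_subseq_LIMSEQ[OF this r(1)] show ?thesis using False by (simp add: o_def)
  qed
  moreover have "strict_mono (s \<circ> r)" using s r strict_mono_o by blast
  ultimately show ?case by blast
qed

text \<open>Dividing by the entry of largest modulus gives vectors that are bounded, hence have
  convergent subsequences, and whose limits cannot be zero.\<close>

lemma normalize_vanish:
  fixes T :: "('b::countable \<Rightarrow> real) set"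
  assumes T: "fun_subspace T" and v: "v \<in> T" "v \<noteq> (\<lambda>_. 0)" and M: "finite M"
    and supp: "\<And>\<gamma>. \<gamma> \<notin> M \<Longrightarrow> v \<gamma> = 0"
  shows "\<exists>c. (\<lambda>\<gamma>. c * v \<gamma>) \<in> T \<and> (\<exists>\<mu>\<in>M. c * v \<mu> = 1) \<and> (\<forall>\<gamma>\<in>M. \<bar>c * v \<gamma>\<bar> \<le> 1)"
proof -
  obtain \<gamma>0 where \<gamma>0: "v \<gamma>0 \<noteq> 0" using v by auto
  then have "M \<noteq> {}" using supp by auto
  then have "Max ((\<lambda>\<gamma>. \<bar>v \<gamma>\<bar>) ` M) \<in> (\<lambda>\<gamma>. \<bar>v \<gamma>\<bar>) ` M" using M by simp
  then obtain \<mu> where \<mu>: "\<mu> \<in> M" "Max ((\<lambda>\<gamma>. \<bar>v \<gamma>\<bar>) ` M) = \<bar>v \<mu>\<bar>" by auto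
  have le: "\<bar>v \<gamma>\<bar> \<le> \<bar>v \<mu>\<bar>" if "\<gamma> \<in> M" for \<gamma>
    using that M \<mu>(2)[symmetric] by simp
  have nz: "v \<mu> \<noteq> 0" using le[of \<gamma>0] \<gamma>0 supp by fastforce
  show ?thesis
    using nz le \<mu>(1) fun_subspace_scale[OF T v(1), of "1 / v \<mu>"]
    by (intro exI[of _ "1 / v \<mu>"] conjI bexI[of _ \<mu>] ballI) (simp_all add: abs_mult)
qed

text \<open>Points arbitrarily near \<open>a\<close> with more pivots than \<open>S\<close> would
  carry normalized vectors vanishing at all pivots of \<open>S\<close>. A subsequential limit lies
  in \<open>S\<close> and vanishes at all its pivots, so it is zero, against the
  normalization.\<close>

lemma card_pivots_semicontinuous:
  fixes E :: "'z::metric_space \<Rightarrow> ('b::countable \<Rightarrow> real) set"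
  assumes a: "a \<in> Z" and M: "finite M"
    and E: "\<And>x. x \<in> Z \<Longrightarrow> fun_subspace (E x)"
    and supp: "\<And>x \<xi> \<gamma>. x \<in> Z \<Longrightarrow> \<xi> \<in> E x \<Longrightarrow> \<gamma> \<notin> M \<Longrightarrow> \<xi> \<gamma> = 0"
    and S: "finite (pivots S)"
    and lim: "\<And>x v w. (\<And>i. x i \<in> Z) \<Longrightarrow> x \<longlonglongrightarrow> a \<Longrightarrow> (\<And>i. v i \<in> E (x i))
        \<Longrightarrow> (\<And>\<gamma>. (\<lambda>i. v i \<gamma>) \<longlonglongrightarrow> w \<gamma>) \<Longrightarrow> w \<in> S"
  shows "\<exists>e>0. \<forall>x\<in>Z \<inter> ball a e. card (pivots (E x)) \<le> card (pivots S)"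
proof (rule ccontr)
  assume neg: "\<not> ?thesis"
  have "\<exists>x v. x \<in> Z \<and> dist a x < 1 / real (Suc n) \<and> v \<in> E x \<and> (\<forall>\<gamma>\<in>pivots S. v \<gamma> = 0)
      \<and> (\<exists>\<mu>\<in>M. v \<mu> = 1) \<and> (\<forall>\<gamma>\<in>M. \<bar>v \<gamma>\<bar> \<le> 1)" for n
  proof -
    have pos: "1 / real (Suc n) > 0" by simp
    from neg pos obtain x where "x \<in> Z \<inter> ball a (1 / real (Suc n))" "\<not> card (pivots (E x)) \<le> card (pivots S)"
      by meson
    then have x: "x \<in> Z" "dist a x < 1 / real (Suc n)" "card (pivots S) < card (pivots (E x))"
      by auto
    have "finite (pivots (E x))" by (rule finite_subset[OF pivots_support M]) (use supp x in blast)
    then obtain v where v: "v \<in> E x" "v \<noteq> (\<lambda>_. 0)" "\<forall>\<gamma>\<in>pivots S. v \<gamma> = 0"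
      using exists_vanish[OF E[OF x(1)] _ S x(3)] by blast
    then obtain c where "(\<lambda>\<gamma>. c * v \<gamma>) \<in> E x" "\<exists>\<mu>\<in>M. c * v \<mu> = 1" "\<forall>\<gamma>\<in>M. \<bar>c * v \<gamma>\<bar> \<le> 1"
      using normalize_vanish[OF E[OF x(1)] v(1,2) M] supp x by meson
    then show ?thesis using x v by (intro exI[of _ x] exI[of _ "\<lambda>\<gamma>. c * v \<gamma>"]) auto
  qed
  then obtain x v where x: "\<And>n. x n \<in> Z" "\<And>n. dist a (x n) < 1 / real (Suc n)"
    and v: "\<And>n. v n \<in> E (x n)" "\<And>n \<gamma>. \<gamma> \<in> pivots S \<Longrightarrow> v n \<gamma> = 0"
      "\<And>n. \<exists>\<mu>\<in>M. v n \<mu> = 1" "\<And>n \<gamma>. \<gamma> \<in> M \<Longrightarrow> \<bar>v n \<gamma>\<bar> \<le> 1"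
    by metis
  have xa: "x \<longlonglongrightarrow> a"
  proof (rule metric_tendsto_imp_tendsto[OF LIMSEQ_inverse_real_of_nat])
    have "dist (x n) a \<le> dist (inverse (real (Suc n))) 0" for n
      using x(2)[of n] by (simp add: dist_commute inverse_eq_divide)
    then show "eventually (\<lambda>n. dist (x n) a \<le> dist (inverse (real (Suc n))) 0) sequentially"
      by simp
  qed
  obtain s w where s: "strict_mono s" and w: "\<And>\<gamma>. \<gamma> \<in> M \<Longrightarrow> (\<lambda>i. v (s i) \<gamma>) \<longlonglongrightarrow> w \<gamma>"
    using bounded_funs_convergent_subseq[of M v 1, OF M v(4)] by metis
  define w' where "w' = (\<lambda>\<gamma>. if \<gamma> \<in> M then w \<gamma> else 0)"
  have lim': "(\<lambda>i. v (s i) \<gamma>) \<longlonglongrightarrow> w' \<gamma>" for \<gamma>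
    using w[of \<gamma>] supp[OF x(1) v(1), of \<gamma>] by (cases "\<gamma> \<in> M") (simp_all add: w'_def)
  have "w' \<in> S"
  proof (rule lim)
    show "(x \<circ> s) \<longlonglongrightarrow> a" by (rule LIMSEQ_subseq_LIMSEQ[OF xa s])
    show "(\<lambda>i. (v \<circ> s) i \<gamma>) \<longlonglongrightarrow> w' \<gamma>" for \<gamma> using lim' by simp
  qed (simp_all add: x v)
  moreover have "w' \<gamma> = 0" if "\<gamma> \<in> pivots S" for \<gamma>
  proof -
    have "(\<lambda>i. 0) \<longlonglongrightarrow> w' \<gamma>" using lim'[of \<gamma>] by (simp only: v(2)[OF that])
    then show ?thesis by (simp add: LIMSEQ_const_iff)
  qed
  ultimately have "\<not> leads w' \<gamma>" for \<gamma>
    unfolding pivots_def leads_def by blast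
  then have "w' = (\<lambda>_. 0)" using leads_exists by blast
  then have z: "(\<lambda>i. v (s i) \<gamma>) \<longlonglongrightarrow> 0" for \<gamma> using lim'[of \<gamma>] by simp
  \<comment> \<open>The position of the entry 1 may vary with \<open>i\<close>; the sum over
    \<open>M\<close> sees it wherever it is.\<close>
  have "(\<lambda>i. \<Sum>\<gamma>\<in>M. \<bar>v (s i) \<gamma>\<bar>) \<longlonglongrightarrow> (\<Sum>\<gamma>\<in>M. 0)"
    by (intro tendsto_sum tendsto_rabs_zero z)
  then have "(\<lambda>i. \<Sum>\<gamma>\<in>M. \<bar>v (s i) \<gamma>\<bar>) \<longlonglongrightarrow> 0" by simp
  moreover have "1 \<le> (\<Sum>\<gamma>\<in>M. \<bar>v (s i) \<gamma>\<bar>)" for i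
  proof -
    obtain \<mu> where "\<mu> \<in> M" "v (s i) \<mu> = 1" using v(3) by blast
    then show ?thesis using member_le_sum[of \<mu> M "\<lambda>\<gamma>. \<bar>v (s i) \<gamma>\<bar>"] M by simp
  qed
  ultimately have "(1::real) \<le> 0" by (intro LIMSEQ_le_const[of _ 0]) auto
  then show False by simp
qed

text \<open>The dimension function at level \<open>k + 1\<close> dominates the local upper limit of the one at
  level \<open>k\<close>.  Hence if the fibre over \<open>a\<close> has dimension at most \<open>j\<close> at level \<open>2 j\<close>, the fibres
  near \<open>a\<close> have dimension at most \<open>j\<close> at level \<open>2 j - 1\<close>; by induction they already agree at
  levels \<open>2 j - 2\<close> and \<open>2 j - 1\<close>, and locality propagates the equality.\<close>

lemma fibres_stabilize:
  fixes E :: "nat \<Rightarrow> 'z::metric_space \<Rightarrow> ('b::countable \<Rightarrow> real) set"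
  assumes M: "finite M"
    and sub: "\<And>k x. x \<in> Z \<Longrightarrow> fun_subspace (E k x)"
    and supp: "\<And>k x \<xi> \<gamma>. x \<in> Z \<Longrightarrow> \<xi> \<in> E k x \<Longrightarrow> \<gamma> \<notin> M \<Longrightarrow> \<xi> \<gamma> = 0"
    and mono: "\<And>k x. x \<in> Z \<Longrightarrow> E k x \<subseteq> E (Suc k) x"
    and lim: "\<And>k a x v w. a \<in> Z \<Longrightarrow> (\<And>i. x i \<in> Z) \<Longrightarrow> x \<longlonglongrightarrow> a \<Longrightarrow> (\<And>i. v i \<in> E k (x i))
        \<Longrightarrow> (\<And>\<gamma>. (\<lambda>i. v i \<gamma>) \<longlonglongrightarrow> w \<gamma>) \<Longrightarrow> w \<in> E (Suc k) a"
    and loc: "\<And>k N a. open N \<Longrightarrow> a \<in> N \<inter> Z \<Longrightarrow> (\<And>x. x \<in> N \<inter> Z \<Longrightarrow> E k x = E (Suc k) x)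
        \<Longrightarrow> E (Suc k) a = E (Suc (Suc k)) a"
    and nz: "\<And>x. x \<in> Z \<Longrightarrow> \<exists>v\<in>E 0 x. v \<noteq> (\<lambda>_. 0)"
    and a: "a \<in> Z" and k: "2 * card M \<le> k"
  shows "E k a = E (2 * card M) a"
proof -
  let ?d = "\<lambda>k x. card (pivots (E k x))"
  have fin: "finite (pivots (E k x))" if "x \<in> Z" for k x
    by (rule finite_subset[OF pivots_support M]) (use supp that in blast)
  have dle: "?d k x \<le> card M" if "x \<in> Z" for k x
    by (rule card_mono[OF M pivots_support]) (use supp that in blast)
  have dmono: "?d k x \<le> ?d (Suc k) x" if "x \<in> Z" for k x
    by (rule card_mono[OF fin[OF that] pivots_mono[OF mono[OF that]]])
  have claim: "\<forall>a\<in>Z. ?d (2 * j) a \<le> j \<longrightarrow> (\<forall>k\<ge>2 * j. E k a = E (2 * j) a)" for j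
  proof (induction j)
    case 0
    \<comment> \<open>The fibres at level 0 are nonzero, so the premise of the claim fails for
      \<open>j = 0\<close>.\<close>
    have "?d 0 a \<noteq> 0" if a: "a \<in> Z" for a
    proof -
      obtain v where "v \<in> E 0 a" "v \<noteq> (\<lambda>_. 0)" using nz[OF a] by blast
      then have "pivots (E 0 a) \<noteq> {}" using leads_exists[of v] by (auto simp: pivots_def)
      then show ?thesis using fin[OF a] by simp
    qed
    then show ?case by (metis le_zero_eq mult_0_right)
  next
    case (Suc j)
    show ?case
    proof (intro ballI impI allI)
      fix a k assume a: "a \<in> Z" and d: "?d (2 * Suc j) a \<le> Suc j" and k: "2 * Suc j \<le> k"
      have "\<exists>e>0. \<forall>x\<in>Z \<inter> ball a e. ?d (Suc (2 * j)) x \<le> ?d (Suc (Suc (2 * j))) a"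
        by (rule card_pivots_semicontinuous[where M = M])
          (use a M sub supp fin[OF a] lim[OF a] in blast)+
      then obtain e where e: "e > 0"
        and le: "\<And>x. x \<in> Z \<Longrightarrow> x \<in> ball a e \<Longrightarrow> ?d (Suc (2 * j)) x \<le> ?d (2 * Suc j) a"
        by auto
      have eq: "E (2 * j) x = E (Suc (2 * j)) x" if x: "x \<in> ball a e \<inter> Z" for x
      \<comment> \<open>Either the induction hypothesis applies at \<open>x\<close>, or the
        dimension is squeezed to \<open>Suc j\<close> at both levels, and equal pivots force equal
        fibres.\<close>
      proof (cases "?d (2 * j) x \<le> j")
        case True
        then show ?thesis using Suc.IH x by (metis IntD2 le_SucI order_refl)
      next
        case False
        have "?d (Suc (2 * j)) x \<le> Suc j" using le[of x] x d by simp
        then have "?d (Suc (2 * j)) x \<le> ?d (2 * j) x" using False by simp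
        then have "pivots (E (2 * j) x) = pivots (E (Suc (2 * j)) x)"
          using x by (intro card_seteq fin pivots_mono mono) auto
        then show ?thesis
          using x M by (intro fun_subspace_eqI_pivots[where M = M] sub mono) (use supp in auto)
      qed
      have step: "E (Suc (2 * j + i)) x = E (2 * j + i) x" if "x \<in> ball a e \<inter> Z" for i x
        using that
      proof (induction i arbitrary: x)
        case 0
        then show ?case using eq by simp
      next
        case (Suc i)
        then show ?case using loc[of "ball a e" x "2 * j + i"] by auto
      qed
      have "E (2 * j + i) a = E (2 * j) a" for i
        by (induction i) (use step[of a] a e in auto)
      \<comment> \<open>The fibre over \<open>a\<close> is constant from level \<open>2 * j\<close>
        on; the instance \<open>i = 2\<close> rewrites this for level
        \<open>2 * Suc j\<close>.\<close>
      from this[of "k - 2 * j"] this[of 2] k show "E k a = E (2 * Suc j) a" by simp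
    qed
  qed
  show ?thesis using claim[of "card M"] dle[OF a] a k by blast
qed

section \<open>Functions with continuous partial derivatives up to order \<open>p\<close>\<close>

declare Cp.simps(2) [simp del]

lemma Cp_Suc_partial: "Cp (Suc k) h V \<Longrightarrow> Cp k (partial i h) V"
  by (simp add: Cp.simps(2))

lemma Cp_Suc_differentiable:
  "Cp (Suc k) h V \<Longrightarrow> x \<in> V \<Longrightarrow> (\<lambda>t. h (x + t *\<^sub>R axis i 1)) differentiable (at 0)"
  by (simp add: Cp.simps(2))

lemma Cp_continuous_on: "Cp k h V \<Longrightarrow> continuous_on V h"
  by (cases k) (auto simp: Cp.simps(2))

section \<open>Elementary calculus of \<open>Cp\<close> functions on open sets\<close>

lemma open_line: "open V \<Longrightarrow> open {t::real. x + t *\<^sub>R v \<in> V}" for x v :: "'a::real_normed_vector"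
  using open_vimage[of V "\<lambda>t. x + t *\<^sub>R v"] by (simp add: vimage_def continuous_intros)

lemma eventually_line:
  fixes x v :: "'a::real_normed_vector"
  assumes "open V" "x \<in> V"
  shows "eventually (\<lambda>t. x + t *\<^sub>R v \<in> V) (nhds 0)"
  using open_line[OF assms(1), of x v] assms(2) by (auto simp: eventually_nhds)

lemma partial_eqI: "((\<lambda>t. h (x + t *\<^sub>R axis i 1)) has_real_derivative D) (at 0) \<Longrightarrow> partial i h x = D"
  unfolding partial_def by (rule DERIV_imp_deriv)

lemma partial_cong:
  assumes "open V" "x \<in> V" "\<And>y. y \<in> V \<Longrightarrow> u y = v y"
  shows "partial i u x = partial i v x"
  unfolding partial_def using assms(3)
  by (intro deriv_cong_ev eventually_mono[OF eventually_line[OF assms(1,2)]]) auto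

lemma Cp_cong_imp:
  assumes "open V" "\<And>y. y \<in> V \<Longrightarrow> u y = v y" "Cp k u V"
  shows "Cp k v V"
  using assms(2,3)
proof (induction k arbitrary: u v)
  case 0
  then show ?case using continuous_on_cong[of V V u v] by simp
next
  case (Suc k)
  have "(\<lambda>t. v (x + t *\<^sub>R axis i 1)) differentiable (at 0)" if "x \<in> V" for i x
  proof -
    have "(\<lambda>t. u (x + t *\<^sub>R axis i 1)) differentiable (at 0)"
      by (rule Cp_Suc_differentiable[OF Suc.prems(2) that])
    then obtain D where "((\<lambda>t. u (x + t *\<^sub>R axis i 1)) has_real_derivative D) (at 0)"
      using real_differentiable_def by blast
    then have "((\<lambda>t. v (x + t *\<^sub>R axis i 1)) has_real_derivative D) (at 0)"
      by (rule has_field_derivative_transform_within_open[OF _ open_line[OF assms(1)]])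
        (use Suc.prems that in auto)
    then show ?thesis using real_differentiable_def by blast
  qed
  moreover have "Cp k (partial i v) V" for i
  proof (rule Suc.IH)
    show "partial i u y = partial i v y" if "y \<in> V" for y
      by (rule partial_cong[OF assms(1) that Suc.prems(1)])
    show "Cp k (partial i u) V" by (rule Cp_Suc_partial[OF Suc.prems(2)])
  qed
  moreover have "continuous_on V v"
    using Cp_continuous_on[OF Suc.prems(2)] Suc.prems(1) continuous_on_cong[of V V u v] by simp
  ultimately show ?case unfolding Cp.simps(2) by blast
qed

lemma Cp_SucD: "Cp (Suc k) h V \<Longrightarrow> Cp k h V"
proof (induction k arbitrary: h)
  case (Suc k)
  have "Cp k (partial i h) V" for i by (rule Suc.IH[OF Cp_Suc_partial[OF Suc.prems]])
  then show ?case using Suc.prems unfolding Cp.simps(2)[of k] Cp.simps(2)[of "Suc k"] by blast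
qed (simp add: Cp_continuous_on)

lemma Cp_mono:
  assumes "Cp k h V" "j \<le> k"
  shows "Cp j h V"
  using assms(2,1)
proof (induction rule: dec_induct)
  case (step n)
  then show ?case using Cp_SucD by blast
qed

lemma Cp_has_partial:
  assumes "Cp (Suc k) h V" "y + s *\<^sub>R axis i 1 \<in> V"
  shows "((\<lambda>t. h (y + t *\<^sub>R axis i 1)) has_real_derivative partial i h (y + s *\<^sub>R axis i 1)) (at s)"
proof -
  have "((\<lambda>t. h ((y + s *\<^sub>R axis i 1) + t *\<^sub>R axis i 1)) has_real_derivative partial i h (y + s *\<^sub>R axis i 1)) (at 0)"
    unfolding partial_def DERIV_deriv_iff_real_differentiable
    by (rule Cp_Suc_differentiable[OF assms])
  then have "((\<lambda>t. (\<lambda>t. h (y + t *\<^sub>R axis i 1)) (t + s)) has_real_derivative partial i h (y + s *\<^sub>R axis i 1)) (at 0)"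
    by (simp add: algebra_simps)
  then show ?thesis using DERIV_shift[of "\<lambda>t. h (y + t *\<^sub>R axis i 1)" "partial i h (y + s *\<^sub>R axis i 1)" 0 s] by simp
qed

lemma Cp_has_partial0:
  assumes "Cp (Suc k) h V" "x \<in> V"
  shows "((\<lambda>t. h (x + t *\<^sub>R axis i 1)) has_real_derivative partial i h x) (at 0)"
  using Cp_has_partial[OF assms(1), of x 0 i] assms(2) by simp

text \<open>The candidate derivatives \<open>D\<close> are compared with \<open>partial\<close> on
  \<open>V\<close> alone, so that explicit formulas such as the product rule can be used in
  inductions on the order.\<close>

lemma Cp_SucI:
  assumes "continuous_on V h"
    and "\<And>i x. x \<in> V \<Longrightarrow> ((\<lambda>t. h (x + t *\<^sub>R axis i 1)) has_real_derivative D i x) (at 0)"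
    and "\<And>i. Cp k (D i) V" and "open V"
  shows "Cp (Suc k) h V"
proof -
  have "Cp k (partial i h) V" for i
    by (rule Cp_cong_imp[OF assms(4) _ assms(3)[of i]]) (use partial_eqI[OF assms(2)] in auto)
  then show ?thesis using assms(1,2) unfolding Cp.simps(2) real_differentiable_def by blast
qed

lemma Cp_const: "open V \<Longrightarrow> Cp k (\<lambda>_. c) V"
proof (induction k arbitrary: c)
  case (Suc k)
  show ?case by (rule Cp_SucI[where D = "\<lambda>_ _. 0"]) (use Suc in simp_all)
qed simp

lemma Cp_add: "open V \<Longrightarrow> Cp k u V \<Longrightarrow> Cp k v V \<Longrightarrow> Cp k (\<lambda>x. u x + v x) V"
proof (induction k arbitrary: u v)
  case 0
  then show ?case by (auto intro: continuous_intros)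
next
  case (Suc k)
  show ?case
  proof (rule Cp_SucI[where D = "\<lambda>i x. partial i u x + partial i v x"])
    show "continuous_on V (\<lambda>x. u x + v x)" using Suc.prems by (intro continuous_on_add Cp_continuous_on)
    show "((\<lambda>t. u (x + t *\<^sub>R axis i 1) + v (x + t *\<^sub>R axis i 1)) has_real_derivative
        partial i u x + partial i v x) (at 0)" if "x \<in> V" for i x
      by (intro DERIV_add Cp_has_partial0[OF Suc.prems(2) that] Cp_has_partial0[OF Suc.prems(3) that])
    show "Cp k (\<lambda>x. partial i u x + partial i v x) V" for i
      by (intro Suc.IH Cp_Suc_partial Suc.prems)
  qed (rule Suc.prems(1))
qed

lemma Cp_mult: "open V \<Longrightarrow> Cp k u V \<Longrightarrow> Cp k v V \<Longrightarrow> Cp k (\<lambda>x. u x * v x) V"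
proof (induction k arbitrary: u v)
  case 0
  then show ?case by (auto intro: continuous_intros)
next
  case (Suc k)
  note uv = Cp_SucD[OF Suc.prems(2)] Cp_SucD[OF Suc.prems(3)]
  show ?case
  proof (rule Cp_SucI[where D = "\<lambda>i x. partial i u x * v x + u x * partial i v x"])
    show "continuous_on V (\<lambda>x. u x * v x)" using Suc.prems by (intro continuous_on_mult Cp_continuous_on)
    show "((\<lambda>t. u (x + t *\<^sub>R axis i 1) * v (x + t *\<^sub>R axis i 1)) has_real_derivative
        partial i u x * v x + u x * partial i v x) (at 0)" if "x \<in> V" for i x
      by (rule DERIV_cong[OF DERIV_mult[OF Cp_has_partial0[OF Suc.prems(2) that] Cp_has_partial0[OF Suc.prems(3) that]]])
        simp
    show "Cp k (\<lambda>x. partial i u x * v x + u x * partial i v x) V" for i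
      by (intro Cp_add Suc.IH uv Suc.prems Cp_Suc_partial)
  qed (rule Suc.prems(1))
qed

lemma Cp_prod: "open V \<Longrightarrow> (\<And>j. j \<in> J \<Longrightarrow> Cp k (u j) V) \<Longrightarrow> Cp k (\<lambda>x. \<Prod>j\<in>J. u j x) V"
  by (induction J rule: infinite_finite_induct) (auto intro: Cp_mult Cp_const)

lemma Cp_power: "open V \<Longrightarrow> Cp k u V \<Longrightarrow> Cp k (\<lambda>x. u x ^ n) V"
  by (induction n) (auto intro: Cp_mult Cp_const)

section \<open>Iterated partial derivatives and their symmetry\<close>

lemma partials_snoc: "partials (L @ [i]) h = partials L (partial i h)"
  by (induction L) auto

lemma Cp_partials: "Cp (k + length L) h V \<Longrightarrow> Cp k (partials L h) V"
  by (induction L arbitrary: h rule: rev_induct) (auto simp: partials_snoc dest!: Cp_Suc_partial)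

lemma partials_sum:
  assumes V: "open V" and u: "\<And>j. j \<in> J \<Longrightarrow> Cp (length L) (u j) V" and x: "x \<in> V"
  shows "partials L (\<lambda>x. \<Sum>j\<in>J. c j * u j x) x = (\<Sum>j\<in>J. c j * partials L (u j) x)"
  using u x
proof (induction L arbitrary: x)
  case (Cons i L)
  have Cu: "Cp (Suc 0) (partials L (u j)) V" if "j \<in> J" for j
    using Cp_partials[of "Suc 0" L "u j" V] Cons.prems(1)[OF that] by simp
  have "partials (i # L) (\<lambda>x. \<Sum>j\<in>J. c j * u j x) x
      = partial i (\<lambda>x. \<Sum>j\<in>J. c j * partials L (u j) x) x"
    unfolding partials.simps
    by (rule partial_cong[OF V Cons.prems(2)], rule Cons.IH) (use Cons.prems(1) Cp_SucD in auto)
  also have "\<dots> = (\<Sum>j\<in>J. c j * partial i (partials L (u j)) x)"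
    by (rule partial_eqI) (intro DERIV_sum DERIV_cmult Cp_has_partial0[OF Cu Cons.prems(2)])
  finally show ?case by simp
qed simp

text \<open>Two applications of the mean value theorem: to \<open>g\<close>, the increment in
  direction \<open>j\<close> as a function of the step in direction \<open>i\<close>, and then to
  the partial derivative in direction \<open>i\<close> along direction \<open>j\<close>.\<close>

lemma second_difference_mvt:
  assumes V: "open V" and h: "Cp (Suc (Suc 0)) h V" and e: "0 < e"
    and sub: "\<And>s t. 0 \<le> s \<Longrightarrow> s \<le> e \<Longrightarrow> 0 \<le> t \<Longrightarrow> t \<le> e \<Longrightarrow> x + s *\<^sub>R axis i 1 + t *\<^sub>R axis j 1 \<in> V"
  shows "\<exists>s t. 0 < s \<and> s < e \<and> 0 < t \<and> t < e \<and>
    h (x + e *\<^sub>R axis i 1 + e *\<^sub>R axis j 1) - h (x + e *\<^sub>R axis i 1) - h (x + e *\<^sub>R axis j 1) + h x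
     = e * (e * partial j (partial i h) (x + s *\<^sub>R axis i 1 + t *\<^sub>R axis j 1))"
proof -
  let ?i = "axis i 1 :: real^'a" and ?j = "axis j 1 :: real^'a"
  define g where "g = (\<lambda>s. h ((x + e *\<^sub>R ?j) + s *\<^sub>R ?i) - h (x + s *\<^sub>R ?i))"
  have "(g has_real_derivative (partial i h ((x + e *\<^sub>R ?j) + s *\<^sub>R ?i) - partial i h (x + s *\<^sub>R ?i))) (at s)"
    if "0 \<le> s" "s \<le> e" for s
    unfolding g_def
    by (intro DERIV_diff Cp_has_partial[OF h]) (use sub[of s e] sub[of s 0] that e in \<open>auto simp: algebra_simps\<close>)
  from MVT2[OF e this] obtain s where s: "0 < s" "s < e"
    "g e - g 0 = e * (partial i h ((x + e *\<^sub>R ?j) + s *\<^sub>R ?i) - partial i h (x + s *\<^sub>R ?i))"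
    by auto
  have hi: "Cp (Suc 0) (partial i h) V" by (rule Cp_Suc_partial[OF h])
  have "((\<lambda>t. partial i h (x + s *\<^sub>R ?i + t *\<^sub>R ?j)) has_real_derivative
      partial j (partial i h) (x + s *\<^sub>R ?i + t *\<^sub>R ?j)) (at t)" if "0 \<le> t" "t \<le> e" for t
    by (rule Cp_has_partial[OF hi]) (use sub[of s t] s that in auto)
  from MVT2[OF e this] obtain t where t: "0 < t" "t < e"
    "partial i h (x + s *\<^sub>R ?i + e *\<^sub>R ?j) - partial i h (x + s *\<^sub>R ?i + 0 *\<^sub>R ?j)
      = e * partial j (partial i h) (x + s *\<^sub>R ?i + t *\<^sub>R ?j)"
    by auto
  have "g e - g 0 = e * (e * partial j (partial i h) (x + s *\<^sub>R ?i + t *\<^sub>R ?j))"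
    using s(3) t(3) by (simp add: algebra_simps)
  then show ?thesis using s t by (intro exI[of _ s] exI[of _ t]) (simp add: g_def algebra_simps)
qed

text \<open>Schwarz's theorem. The second difference over a small square is symmetric in the two
  directions and equals the squared side length times either mixed derivative at some point of the
  square; both are continuous at \<open>x\<close>.\<close>

lemma partial_commute:
  assumes V: "open V" and h: "Cp (Suc (Suc 0)) h V" and x: "x \<in> V"
  shows "partial i (partial j h) x = partial j (partial i h) x"
proof (rule ccontr)
  let ?i = "axis i 1 :: real^'a" and ?j = "axis j 1 :: real^'a"
  let ?A = "partial i (partial j h)" and ?B = "partial j (partial i h)"
  assume ne: "?A x \<noteq> ?B x"
  \<comment> \<open>Half the gap: both mixed derivatives staying within \<open>r\<close> of their
    values at \<open>x\<close> makes the gap smaller than itself.\<close>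
  define r where "r = \<bar>?A x - ?B x\<bar> / 2"
  have r: "r > 0" using ne by (simp add: r_def)
  have "continuous_on V ?A" "continuous_on V ?B"
    by (rule Cp_continuous_on[OF Cp_Suc_partial[OF Cp_Suc_partial[OF h]]])+
  then have "isCont ?A x" "isCont ?B x" using V x continuous_on_eq_continuous_at by blast+
  then have "\<exists>d>0. \<forall>y. dist y x < d \<longrightarrow> dist (?A y) (?A x) < r" "\<exists>d>0. \<forall>y. dist y x < d \<longrightarrow> dist (?B y) (?B x) < r"
    using r unfolding continuous_at_eps_delta by blast+
  then obtain d1 d2 where d: "d1 > 0" "d2 > 0" "\<And>y. dist y x < d1 \<Longrightarrow> dist (?A y) (?A x) < r"
      "\<And>y. dist y x < d2 \<Longrightarrow> dist (?B y) (?B x) < r"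
    by blast
  obtain d3 where d3: "d3 > 0" "\<And>y. dist y x < d3 \<Longrightarrow> y \<in> V"
    using V x by (auto simp: open_dist)
  define d where "d = min d1 (min d2 d3)"
  \<comment> \<open>A point of the square is at distance at most \<open>2 * e = d / 2\<close> from
    \<open>x\<close>.\<close>
  define e where "e = d / 4"
  have e: "e > 0" using d d3 by (simp add: e_def d_def)
  have near: "dist (x + s *\<^sub>R axis k 1 + t *\<^sub>R axis l 1) x < d"
    if "0 \<le> s" "s \<le> e" "0 \<le> t" "t \<le> e" for s t and k l :: 'a
  proof -
    have "norm (s *\<^sub>R axis k 1 + t *\<^sub>R axis l 1 :: real^'a) \<le> s + t"
      using norm_triangle_ineq[of "s *\<^sub>R axis k 1 :: real^'a" "t *\<^sub>R axis l 1"] that by simp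
    also have "\<dots> < d" using that e by (simp add: e_def)
    finally show ?thesis by (simp add: dist_norm add.assoc)
  qed
  have inV: "x + s *\<^sub>R axis k 1 + t *\<^sub>R axis l 1 \<in> V"
    if "0 \<le> s" "s \<le> e" "0 \<le> t" "t \<le> e" for s t and k l :: 'a
    using near[OF that, of k l] by (intro d3) (simp add: d_def)
  obtain s t where st: "0 < s" "s < e" "0 < t" "t < e"
    "h (x + e *\<^sub>R ?i + e *\<^sub>R ?j) - h (x + e *\<^sub>R ?i) - h (x + e *\<^sub>R ?j) + h x = e * (e * ?B (x + s *\<^sub>R ?i + t *\<^sub>R ?j))"
    using second_difference_mvt[OF V h e inV, of i j] by blast
  obtain s' t' where st': "0 < s'" "s' < e" "0 < t'" "t' < e"
    "h (x + e *\<^sub>R ?j + e *\<^sub>R ?i) - h (x + e *\<^sub>R ?j) - h (x + e *\<^sub>R ?i) + h x = e * (e * ?A (x + s' *\<^sub>R ?j + t' *\<^sub>R ?i))"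
    using second_difference_mvt[OF V h e inV, of j i] by blast
  have "e * (e * ?B (x + s *\<^sub>R ?i + t *\<^sub>R ?j)) = e * (e * ?A (x + s' *\<^sub>R ?j + t' *\<^sub>R ?i))"
    using st(5) st'(5) by (simp add: algebra_simps)
  then have "?B (x + s *\<^sub>R ?i + t *\<^sub>R ?j) = ?A (x + s' *\<^sub>R ?j + t' *\<^sub>R ?i)" using e by simp
  moreover have "dist (?A (x + s' *\<^sub>R ?j + t' *\<^sub>R ?i)) (?A x) < r"
    using near[of s' t' j i] st' by (intro d) (simp add: d_def)
  moreover have "dist (?B (x + s *\<^sub>R ?i + t *\<^sub>R ?j)) (?B x) < r"
    using near[of s t i j] st by (intro d) (simp add: d_def)
  ultimately have "\<bar>?A x - ?B x\<bar> < 2 * r" by (simp add: dist_real_def)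
  then show False by (simp add: r_def)
qed

lemma partials_move:
  assumes V: "open V" and h: "Cp (Suc (length A + length B)) h V" and x: "x \<in> V"
  shows "partials (A @ i # B) h x = partials (i # A @ B) h x"
  using h x
proof (induction A arbitrary: x)
  case (Cons a A)
  have "partials (A @ i # B) h y = partials (i # A @ B) h y" if "y \<in> V" for y
    by (rule Cons.IH[OF _ that]) (use Cons.prems(1) Cp_SucD in auto)
  then have "partials ((a # A) @ i # B) h x = partial a (partial i (partials (A @ B) h)) x"
    using partial_cong[OF V Cons.prems(2), of "partials (A @ i # B) h" "partials (i # A @ B) h"] by simp
  also have "\<dots> = partial i (partial a (partials (A @ B) h)) x"
    by (rule partial_commute[OF V Cp_partials Cons.prems(2)]) (use Cons.prems(1) in simp)
  finally show ?case by simp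
qed simp

text \<open>\<open>hpartial\<close> selects an arbitrary list of directions for a multi-index; this
  makes the selection irrelevant for sufficiently smooth functions.\<close>

lemma partials_perm:
  assumes V: "open V" and h: "Cp (length L) h V" and x: "x \<in> V" and LL: "mset L = mset L'"
  shows "partials L h x = partials L' h x"
  using h x LL
proof (induction L arbitrary: L' x)
  case (Cons i L)
  from Cons.prems(3) have "i \<in> set L'" by (metis list.set_intros(1) mset_eq_setD)
  then obtain A B where AB: "L' = A @ i # B" by (meson split_list)
  then have ms: "mset L = mset (A @ B)" using Cons.prems(3) by simp
  then have len: "length L = length A + length B" using mset_eq_length by fastforce
  have "partials (i # L) h x = partial i (partials (A @ B) h) x"
    unfolding partials.simps
    by (rule partial_cong[OF V Cons.prems(2)], rule Cons.IH[OF _ _ ms])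
      (use Cons.prems(1) Cp_SucD in auto)
  also have "\<dots> = partials L' h x"
    unfolding AB using partials_move[OF V _ Cons.prems(2), of A B h i] Cons.prems(1) len by simp
  finally show ?case .
qed simp

section \<open>Derivatives indexed by multi-indices\<close>

lemma mi_list_exists: "\<exists>L. \<forall>i. count_list L i = \<beta> i" for \<beta> :: "'m::finite \<Rightarrow> nat"
proof -
  obtain L where "mset L = Abs_multiset \<beta>" using ex_mset by blast
  then have "count_list L i = \<beta> i" for i
    by (metis count_mset count_Abs_multiset finite)
  then show ?thesis by blast
qed

lemma length_eq_mi_deg: "(\<And>i. count_list L i = \<beta> i) \<Longrightarrow> length L = mi_deg \<beta>"
  using sum_count_set[of L UNIV] by (simp add: mi_deg_def)

lemma hpartial_obtain:
  obtains L where "\<And>i. count_list L i = \<beta> i" "length L = mi_deg \<beta>" "hpartial \<beta> = partials L"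
proof -
  let ?L = "SOME L. \<forall>i. count_list L i = \<beta> i"
  have "\<forall>i. count_list ?L i = \<beta> i" by (rule someI_ex[OF mi_list_exists])
  then show ?thesis using that[of ?L] length_eq_mi_deg[of ?L \<beta>] by (auto simp: hpartial_def fun_eq_iff)
qed

lemma hpartial_eq_partials:
  assumes V: "open V" and h: "Cp (mi_deg \<beta>) h V" and x: "x \<in> V" and L: "\<And>i. count_list L i = \<beta> i"
  shows "hpartial \<beta> h x = partials L h x"
proof -
  obtain L0 where L0: "\<And>i. count_list L0 i = \<beta> i" "length L0 = mi_deg \<beta>" "hpartial \<beta> = partials L0"
    using hpartial_obtain[of \<beta>] by blast
  have "mset L0 = mset L" using L L0(1) by (simp add: multiset_eq_iff count_mset)
  then show ?thesis using partials_perm[OF V _ x, of L0 h L] h L0 by simp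
qed

lemma mi_deg_upd: "mi_deg (\<gamma>(i := Suc (\<gamma> i))) = Suc (mi_deg \<gamma>)"
proof -
  have "mi_deg (\<gamma>(i := Suc (\<gamma> i))) = (\<Sum>j\<in>UNIV. \<gamma> j + (if j = i then 1 else 0))"
    unfolding mi_deg_def by (rule sum.cong) auto
  then show ?thesis by (simp add: sum.distrib mi_deg_def)
qed

lemma mi_deg_zero [simp]: "mi_deg (\<lambda>_. 0) = 0"
  by (simp add: mi_deg_def)

lemma mi_deg_eq_0: "mi_deg \<gamma> = 0 \<longleftrightarrow> \<gamma> = (\<lambda>_. 0)"
  by (auto simp: mi_deg_def)

lemma mi_deg_add: "mi_deg (\<lambda>i. \<gamma> i + \<beta> i) = mi_deg \<gamma> + mi_deg \<beta>"
  by (simp add: mi_deg_def sum.distrib)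

lemma hpartial_zero [simp]: "hpartial (\<lambda>_. 0) h = h" for h :: "real^'m::finite \<Rightarrow> real"
proof -
  obtain L where "length L = mi_deg (\<lambda>_::'m. 0)" "hpartial (\<lambda>_::'m. 0) = partials L"
    by (rule hpartial_obtain[of "\<lambda>_::'m. 0"]) blast
  then show ?thesis by simp
qed

lemma Cp_hpartial: "Cp p h V \<Longrightarrow> mi_deg \<gamma> \<le> p \<Longrightarrow> Cp (p - mi_deg \<gamma>) (hpartial \<gamma> h) V"
  by (rule hpartial_obtain[of \<gamma>]) (auto intro: Cp_partials)

lemma partial_hpartial:
  assumes V: "open V" and h: "Cp p h V" and x: "x \<in> V" and \<gamma>: "mi_deg \<gamma> < p"
  shows "partial i (hpartial \<gamma> h) x = hpartial (\<gamma>(i := Suc (\<gamma> i))) h x"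
proof -
  obtain L where L: "\<And>i. count_list L i = \<gamma> i" "length L = mi_deg \<gamma>" "hpartial \<gamma> = partials L"
    using hpartial_obtain[of \<gamma>] by blast
  have "hpartial (\<gamma>(i := Suc (\<gamma> i))) h x = partials (i # L) h x"
    by (rule hpartial_eq_partials[OF V _ x]) (use Cp_mono[OF h, of "Suc (mi_deg \<gamma>)"] \<gamma> L in \<open>auto simp: mi_deg_upd\<close>)
  then show ?thesis by (simp add: L)
qed

lemma hpartial_sum:
  assumes V: "open V" and u: "\<And>j. j \<in> J \<Longrightarrow> Cp (mi_deg \<gamma>) (u j) V" and x: "x \<in> V"
  shows "hpartial \<gamma> (\<lambda>x. \<Sum>j\<in>J. c j * u j x) x = (\<Sum>j\<in>J. c j * hpartial \<gamma> (u j) x)"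
proof -
  obtain L where L: "length L = mi_deg \<gamma>" "hpartial \<gamma> = partials L"
    by (rule hpartial_obtain[of \<gamma>]) blast
  show ?thesis unfolding L(2) by (rule partials_sum[OF V _ x]) (use u L in auto)
qed

section \<open>Taylor remainders\<close>

text \<open>The divided power z^beta / beta!: differentiation lowers an exponent without producing a
  factor, and the binomial theorem becomes a plain convolution.\<close>

definition npow :: "real^'d \<Rightarrow> ('d::finite \<Rightarrow> nat) \<Rightarrow> real" where
  "npow z \<beta> = (\<Prod>i\<in>UNIV. (z $ i) ^ \<beta> i / fact (\<beta> i))"

lemma finite_mi_le: "finite {\<gamma> :: 'd::finite \<Rightarrow> nat. \<forall>i. \<gamma> i \<le> \<beta> i}"
proof -
  have "{\<gamma> :: 'd \<Rightarrow> nat. \<forall>i. \<gamma> i \<le> \<beta> i} = Pi\<^sub>E UNIV (\<lambda>i. {..\<beta> i})" by (auto simp: PiE_def Pi_def extensional_def)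
  then show ?thesis by (simp add: finite_PiE)
qed

lemma mi_le_deg: "\<gamma> i \<le> mi_deg \<gamma>" for \<gamma> :: "'d::finite \<Rightarrow> nat"
  unfolding mi_deg_def by (rule member_le_sum) auto

lemma finite_mons [simp]: "finite (mons p :: ('d::finite \<Rightarrow> nat) set)"
  by (rule finite_subset[OF _ finite_mi_le[of "\<lambda>_. p"]]) (auto simp: mons_def intro: order_trans[OF mi_le_deg])

lemma mi_deg_mono: "(\<And>i. \<gamma> i \<le> \<beta> i) \<Longrightarrow> mi_deg \<gamma> \<le> mi_deg \<beta>"
  unfolding mi_deg_def by (rule sum_mono)

lemma npow_0: "npow 0 \<beta> = (if \<beta> = (\<lambda>_. 0) then 1 else 0)"
  by (auto simp: npow_def power_0_left fun_eq_iff)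

lemma npow_has_partial:
  "((\<lambda>t. npow (z + t *\<^sub>R axis i 1) \<beta>) has_real_derivative
     (if \<beta> i = 0 then 0 else npow z (\<beta>(i := \<beta> i - 1)))) (at 0)"
proof -
  define K where "K = (\<Prod>j\<in>UNIV - {i}. (z $ j) ^ \<beta> j / fact (\<beta> j))"
  have eq: "npow (z + t *\<^sub>R axis i 1) \<beta> = (z $ i + t) ^ \<beta> i / fact (\<beta> i) * K" for t
  proof -
    have "(\<Prod>j\<in>UNIV - {i}. ((z + t *\<^sub>R axis i 1) $ j) ^ \<beta> j / fact (\<beta> j)) = K"
      unfolding K_def by (rule prod.cong) (auto simp: axis_def)
    then show ?thesis unfolding npow_def by (subst prod.remove[of UNIV i]) (auto simp: axis_def)
  qed
  have eq2: "npow z (\<beta>(i := \<beta> i - 1)) = (z $ i) ^ (\<beta> i - 1) / fact (\<beta> i - 1) * K"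
  proof -
    have "(\<Prod>j\<in>UNIV - {i}. (z $ j) ^ (\<beta>(i := \<beta> i - 1)) j / fact ((\<beta>(i := \<beta> i - 1)) j)) = K"
      unfolding K_def by (rule prod.cong) auto
    then show ?thesis unfolding npow_def by (subst prod.remove[of UNIV i]) auto
  qed
  show ?thesis
  proof (cases "\<beta> i")
    case 0
    then show ?thesis by (simp add: eq)
  next
    case (Suc n)
    have "((\<lambda>t. (z $ i + t) ^ Suc n / fact (Suc n) * K) has_real_derivative
        real (Suc n) * (z $ i) ^ n / fact (Suc n) * K) (at 0)"
      by (rule derivative_eq_intros refl | simp)+
    moreover have "real (Suc n) * (z $ i) ^ n / fact (Suc n) * K = npow z (\<beta>(i := \<beta> i - 1))"
      using eq2 Suc by (simp del: of_nat_Suc)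
    ultimately show ?thesis unfolding eq Suc by simp
  qed
qed

text \<open>For a C^p function this is the derivative of multi-index \<open>\<gamma>\<close> of h -
  T^p_b(h), evaluated at \<open>x\<close>.\<close>

definition taylor_rem :: "nat \<Rightarrow> (real^'m::finite \<Rightarrow> real) \<Rightarrow> real^'m \<Rightarrow> ('m \<Rightarrow> nat) \<Rightarrow> real^'m \<Rightarrow> real" where
  "taylor_rem p h b \<gamma> x = hpartial \<gamma> h x
     - (\<Sum>\<beta>\<in>mons (p - mi_deg \<gamma>). hpartial (\<lambda>i. \<gamma> i + \<beta> i) h b * npow (x - b) \<beta>)"

lemma taylor_rem_base: "taylor_rem p h b \<gamma> b = 0" for h :: "real^'m::finite \<Rightarrow> real"
proof -
  have "(\<Sum>\<beta>\<in>mons (p - mi_deg \<gamma>). hpartial (\<lambda>i. \<gamma> i + \<beta> i) h b * npow (b - b) \<beta>)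
      = (\<Sum>\<beta>\<in>mons (p - mi_deg \<gamma>). if \<beta> = (\<lambda>_::'m. 0) then hpartial \<gamma> h b else 0)"
    by (rule sum.cong) (auto simp: npow_0)
  also have "\<dots> = hpartial \<gamma> h b"
  proof -
    have "(\<lambda>_::'m. 0) \<in> mons (p - mi_deg \<gamma>)" by (simp add: mons_def)
    then show ?thesis by simp
  qed
  finally show ?thesis by (simp add: taylor_rem_def)
qed

lemma taylor_rem_top:
  fixes h :: "real^'m::finite \<Rightarrow> real"
  assumes "mi_deg \<gamma> = p"
  shows "taylor_rem p h b \<gamma> x = hpartial \<gamma> h x - hpartial \<gamma> h b"
proof -
  have "mons 0 = {\<lambda>_::'m. 0::nat}" by (auto simp: mons_def mi_deg_eq_0)
  then show ?thesis using assms by (simp add: taylor_rem_def npow_def)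
qed

text \<open>Differentiating in direction \<open>i\<close> kills the terms with
  \<open>\<beta> i = 0\<close> and lowers \<open>\<beta> i\<close> in the others; moving that unit
  to \<open>\<gamma>\<close> leaves the sum of \<open>\<gamma> + \<beta>\<close> unchanged and turns
  the remainder into the next one.\<close>

lemma taylor_rem_has_partial:
  fixes h :: "real^'m::finite \<Rightarrow> real"
  assumes V: "open V" and h: "Cp p h V" and x: "x \<in> V" and \<gamma>: "mi_deg \<gamma> < p"
  shows "((\<lambda>t. taylor_rem p h b \<gamma> (x + t *\<^sub>R axis i 1)) has_real_derivative
     taylor_rem p h b (\<gamma>(i := Suc (\<gamma> i))) x) (at 0)"
proof -
  define n where "n = p - Suc (mi_deg \<gamma>)"
  have n: "p - mi_deg \<gamma> = Suc n" using \<gamma> by (simp add: n_def)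
  have C: "Cp (Suc n) (hpartial \<gamma> h) V" using Cp_hpartial[OF h, of \<gamma>] \<gamma> n by simp
  have "((\<lambda>t. taylor_rem p h b \<gamma> (x + t *\<^sub>R axis i 1)) has_real_derivative
      partial i (hpartial \<gamma> h) x - (\<Sum>\<beta>\<in>mons (Suc n). hpartial (\<lambda>i. \<gamma> i + \<beta> i) h b *
        (if \<beta> i = 0 then 0 else npow (x - b) (\<beta>(i := \<beta> i - 1))))) (at 0)"
    unfolding taylor_rem_def n add_diff_eq[symmetric]
    using npow_has_partial[of "x - b" i]
    by (intro DERIV_diff Cp_has_partial0[OF C x] DERIV_sum DERIV_cmult) (simp add: algebra_simps)
  moreover have "(\<Sum>\<beta>\<in>mons (Suc n). hpartial (\<lambda>i. \<gamma> i + \<beta> i) h b *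
        (if \<beta> i = 0 then 0 else npow (x - b) (\<beta>(i := \<beta> i - 1))))
      = (\<Sum>\<beta>\<in>{\<beta>\<in>mons (Suc n). \<beta> i \<noteq> 0}. hpartial (\<lambda>i. \<gamma> i + \<beta> i) h b * npow (x - b) (\<beta>(i := \<beta> i - 1)))"
    by (rule sum.mono_neutral_cong_right) auto
  moreover have "\<dots> = (\<Sum>\<beta>\<in>mons n. hpartial (\<lambda>j. (\<gamma>(i := Suc (\<gamma> i))) j + \<beta> j) h b * npow (x - b) \<beta>)"
  proof (rule sum.reindex_bij_witness[of _ "\<lambda>\<beta>. \<beta>(i := Suc (\<beta> i))" "\<lambda>\<beta>. \<beta>(i := \<beta> i - 1)"])
    fix \<beta> assume \<beta>: "\<beta> \<in> {\<beta>\<in>mons (Suc n). \<beta> i \<noteq> 0}"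
    let ?\<beta> = "\<beta>(i := \<beta> i - 1)"
    show *: "?\<beta>(i := Suc (?\<beta> i)) = \<beta>" using \<beta> by auto
    show "?\<beta> \<in> mons n" using \<beta> mi_deg_upd[of ?\<beta> i] unfolding * by (auto simp: mons_def)
    have "(\<lambda>j. (\<gamma>(i := Suc (\<gamma> i))) j + ?\<beta> j) = (\<lambda>i. \<gamma> i + \<beta> i)" using \<beta> by auto
    then show "hpartial (\<lambda>j. (\<gamma>(i := Suc (\<gamma> i))) j + ?\<beta> j) h b * npow (x - b) ?\<beta>
      = hpartial (\<lambda>i. \<gamma> i + \<beta> i) h b * npow (x - b) (\<beta>(i := \<beta> i - 1))" by simp
  next
    fix \<beta> :: "'m \<Rightarrow> nat" assume \<beta>: "\<beta> \<in> mons n"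
    then show "\<beta>(i := Suc (\<beta> i)) \<in> {\<beta>\<in>mons (Suc n). \<beta> i \<noteq> 0}" by (simp add: mons_def mi_deg_upd)
  qed simp
  ultimately show ?thesis
    unfolding taylor_rem_def mi_deg_upd n_def[symmetric] partial_hpartial[OF V h x \<gamma>] by simp
qed

text \<open>Moving one coordinate at a time keeps the path inside the ball around \<open>b\<close> and needs partial
  derivatives only.\<close>

lemma coordinate_path_bound:
  fixes u :: "real^'m::finite \<Rightarrow> real"
  assumes D: "\<And>i y. norm (y - b) \<le> norm (x - b) \<Longrightarrow>
      ((\<lambda>t. u (y + t *\<^sub>R axis i 1)) has_real_derivative D i y) (at 0)"
    and B: "\<And>i y. norm (y - b) \<le> norm (x - b) \<Longrightarrow> \<bar>D i y\<bar> \<le> B"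
  shows "\<bar>u x - u b\<bar> \<le> real CARD('m) * (B * norm (x - b))"
proof -
  define y where "y I = (\<chi> j. if j \<in> I then x $ j else b $ j)" for I
  \<comment> \<open>Any coordinate direction serves to see that \<open>B\<close> is
    nonnegative.\<close>
  have "\<bar>D undefined b\<bar> \<le> B" by (rule B) simp
  then have B0: "B \<ge> 0" by linarith
  have main: "\<bar>u (y I) - u b\<bar> \<le> real (card I) * (B * norm (x - b))" if "finite I" for I
    using that
  proof (induction I rule: finite_induct)
    case empty
    have "y {} = b" by (simp add: y_def vec_eq_iff)
    then show ?case by simp
  next
    case (insert i I)
    let ?d = "(x - b) $ i"
    let ?S = "closed_segment 0 ?d"
    have near: "norm (y I + t *\<^sub>R axis i 1 - b) \<le> norm (x - b)" if "t \<in> ?S" for t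
    proof (rule norm_le_componentwise_cart)
      have "\<bar>t\<bar> \<le> \<bar>?d\<bar>" using that by (auto simp: closed_segment_eq_real_ivl split: if_splits)
      then show "norm ((y I + t *\<^sub>R axis i 1 - b) $ j) \<le> norm ((x - b) $ j)" for j
        using insert.hyps by (cases "j = i") (auto simp: y_def axis_def)
    qed
    have der: "((\<lambda>t. u (y I + t *\<^sub>R axis i 1)) has_real_derivative D i (y I + s *\<^sub>R axis i 1)) (at s within ?S)"
      if "s \<in> ?S" for s
    proof -
      have "((\<lambda>t. u ((y I + s *\<^sub>R axis i 1) + t *\<^sub>R axis i 1)) has_real_derivative D i (y I + s *\<^sub>R axis i 1)) (at 0)"
        by (rule D[OF near[OF that]])
      moreover have "(\<lambda>t. u ((y I + s *\<^sub>R axis i 1) + t *\<^sub>R axis i 1)) = (\<lambda>t. u (y I + (t + s) *\<^sub>R axis i 1))"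
        by (simp add: scaleR_add_left add_ac)
      ultimately have "((\<lambda>t. u (y I + t *\<^sub>R axis i 1)) has_real_derivative D i (y I + s *\<^sub>R axis i 1)) (at s)"
        using DERIV_shift[of "\<lambda>t. u (y I + t *\<^sub>R axis i 1)" "D i (y I + s *\<^sub>R axis i 1)" 0 s] by simp
      then show ?thesis by (rule has_field_derivative_at_within)
    qed
    have bd: "norm (D i (y I + s *\<^sub>R axis i 1)) \<le> B" if "s \<in> ?S" for s
      using B[OF near[OF that]] by simp
    have "norm (u (y I + ?d *\<^sub>R axis i 1) - u (y I + 0 *\<^sub>R axis i 1)) \<le> B * norm (?d - 0)"
      by (rule field_differentiable_bound[OF convex_closed_segment der bd]) auto
    moreover have "y I + ?d *\<^sub>R axis i 1 = y (insert i I)"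
      using insert.hyps by (auto simp: y_def vec_eq_iff axis_def)
    moreover have "B * norm ?d \<le> B * norm (x - b)"
      using mult_left_mono[OF component_le_norm_cart[of "x - b" i] B0] by simp
    ultimately have "\<bar>u (y (insert i I)) - u (y I)\<bar> \<le> B * norm (x - b)" by simp
    moreover have "real (card (insert i I)) * (B * norm (x - b)) = real (card I) * (B * norm (x - b)) + B * norm (x - b)"
      using insert.hyps by (simp add: distrib_right)
    ultimately show ?case using insert.IH by linarith
  qed
  have "y UNIV = x" by (simp add: y_def vec_eq_iff)
  then show ?thesis using main[of UNIV] by simp
qed

text \<open>Downward induction on the degree of \<open>\<gamma>\<close>. In top degree the remainder
  is the oscillation of a derivative; each step down follows a coordinate path from
  \<open>b\<close>, where the remainder vanishes, and gains a factor
  \<open>CARD('m) * norm (x - b)\<close>.\<close>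

lemma taylor_rem_bound:
  fixes h :: "real^'m::finite \<Rightarrow> real"
  assumes V: "open V" and h: "Cp p h V" and sub: "ball b r \<subseteq> V"
    and osc: "\<And>\<gamma> y. mi_deg \<gamma> = p \<Longrightarrow> y \<in> ball b r \<Longrightarrow> \<bar>hpartial \<gamma> h y - hpartial \<gamma> h b\<bar> \<le> e"
    and \<gamma>: "mi_deg \<gamma> \<le> p" and x: "x \<in> ball b r"
  shows "\<bar>taylor_rem p h b \<gamma> x\<bar> \<le> real CARD('m) ^ (p - mi_deg \<gamma>) * e * norm (x - b) ^ (p - mi_deg \<gamma>)"
  using \<gamma> x
proof (induction "p - mi_deg \<gamma>" arbitrary: \<gamma> x)
  case 0
  then show ?case using osc[of \<gamma> x] by (simp add: taylor_rem_top)
next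
  case (Suc n)
  have lt: "mi_deg \<gamma> < p" using Suc.hyps(2) by simp
  let ?N = "real CARD('m)"
  \<comment> \<open>A multi-index of degree exactly \<open>p\<close>, concentrated in one
    coordinate, gives access to \<open>osc\<close>.\<close>
  have e0: "0 \<le> e"
  proof -
    obtain i :: 'm where True by simp
    have "mi_deg (\<lambda>j. if j = i then p else 0) = p" by (simp add: mi_deg_def)
    from osc[OF this Suc.prems(2)] show ?thesis by linarith
  qed
  have yin: "y \<in> ball b r" if "norm (y - b) \<le> norm (x - b)" for y
    using that Suc.prems(2) by (simp add: dist_norm norm_minus_commute)
  have "\<bar>taylor_rem p h b \<gamma> x - taylor_rem p h b \<gamma> b\<bar>
      \<le> ?N * (?N ^ n * e * norm (x - b) ^ n * norm (x - b))"
  proof (rule coordinate_path_bound)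
    fix i y assume y: "norm (y - b) \<le> norm (x - b)"
    show "((\<lambda>t. taylor_rem p h b \<gamma> (y + t *\<^sub>R axis i 1)) has_real_derivative
       taylor_rem p h b (\<gamma>(i := Suc (\<gamma> i))) y) (at 0)"
      by (rule taylor_rem_has_partial[OF V h _ lt]) (use yin[OF y] sub in auto)
    have n: "n = p - mi_deg (\<gamma>(i := Suc (\<gamma> i)))" using Suc.hyps(2) by (simp add: mi_deg_upd)
    have "\<bar>taylor_rem p h b (\<gamma>(i := Suc (\<gamma> i))) y\<bar> \<le> ?N ^ n * e * norm (y - b) ^ n"
      using Suc.hyps(1)[OF n _ yin[OF y]] lt unfolding n[symmetric] by (simp add: mi_deg_upd)
    also have "\<dots> \<le> ?N ^ n * e * norm (x - b) ^ n"
      by (intro mult_left_mono power_mono y) (use e0 in auto)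
    finally show "\<bar>taylor_rem p h b (\<gamma>(i := Suc (\<gamma> i))) y\<bar> \<le> ?N ^ n * e * norm (x - b) ^ n" .
  qed
  then show ?case unfolding Suc.hyps(2)[symmetric] by (simp add: taylor_rem_base mult_ac)
qed

lemma Cp_hpartial_continuous: "Cp p h V \<Longrightarrow> mi_deg \<gamma> \<le> p \<Longrightarrow> continuous_on V (hpartial \<gamma> h)"
  using Cp_hpartial Cp_continuous_on by blast

text \<open>The estimate is uniform in both points, since in the limits below base point and
  evaluation point move simultaneously.\<close>

lemma taylor_rem_little_o:
  fixes h :: "real^'m::finite \<Rightarrow> real"
  assumes V: "open V" and h: "Cp p h V" and b0: "b0 \<in> V" and e: "e > 0"
  shows "\<exists>d>0. \<forall>b\<in>ball b0 d. \<forall>c\<in>ball b0 d. \<forall>\<gamma>\<in>mons p.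
    \<bar>taylor_rem p h b \<gamma> c\<bar> \<le> e * norm (b - c) ^ (p - mi_deg \<gamma>)"
proof -
  let ?N = "real CARD('m)"
  \<comment> \<open>This absorbs the power of the dimension in \<open>taylor_rem_bound\<close>.
    Below, \<open>e' / 2\<close> is used because the values at \<open>y\<close> and at
    \<open>b\<close> are compared through \<open>b0\<close>.\<close>
  define e' where "e' = e / ?N ^ p"
  have N: "?N \<ge> 1" by (simp add: Suc_leI)
  have e': "e' > 0" using e N by (simp add: e'_def)
  have "eventually (\<lambda>y. dist (hpartial \<gamma> h y) (hpartial \<gamma> h b0) < e' / 2) (nhds b0)"
    if "\<gamma> \<in> mons p" for \<gamma>
  proof -
    have "isCont (hpartial \<gamma> h) b0"
      using Cp_hpartial_continuous[OF h, of \<gamma>] that V b0 continuous_on_eq_continuous_at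
      by (auto simp: mons_def)
    then have "((hpartial \<gamma> h) \<longlongrightarrow> hpartial \<gamma> h b0) (nhds b0)"
      by (simp add: continuous_within tendsto_at_iff_tendsto_nhds)
    then show ?thesis using tendstoD e' by (metis half_gt_zero)
  qed
  then have "eventually (\<lambda>y. \<forall>\<gamma>\<in>mons p. dist (hpartial \<gamma> h y) (hpartial \<gamma> h b0) < e' / 2) (nhds b0)"
    by (simp add: eventually_ball_finite)
  moreover have "eventually (\<lambda>y. y \<in> V) (nhds b0)" using V b0 by (rule eventually_nhds_in_open)
  ultimately have "eventually (\<lambda>y. y \<in> V \<and> (\<forall>\<gamma>\<in>mons p. dist (hpartial \<gamma> h y) (hpartial \<gamma> h b0) < e' / 2)) (nhds b0)"
    by eventually_elim auto
  then obtain r where r: "r > 0" and rV: "\<And>y. dist y b0 < r \<Longrightarrow> y \<in> V"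
    and close: "\<And>y \<gamma>. dist y b0 < r \<Longrightarrow> \<gamma> \<in> mons p \<Longrightarrow> dist (hpartial \<gamma> h y) (hpartial \<gamma> h b0) < e' / 2"
    unfolding eventually_nhds_metric by blast
  show ?thesis
  \<comment> \<open>With radius \<open>r / 3\<close> the point \<open>c\<close> lies in the ball of
    radius \<open>2 * r / 3\<close> around \<open>b\<close>, and that ball stays within distance
    \<open>r\<close> of \<open>b0\<close>.\<close>
  proof (intro exI[of _ "r / 3"] conjI ballI)
    show "r / 3 > 0" using r by simp
    fix b c and \<gamma> :: "'m \<Rightarrow> nat"
    assume bc: "b \<in> ball b0 (r / 3)" "c \<in> ball b0 (r / 3)" and \<gamma>: "\<gamma> \<in> mons p"
    have near: "dist y b0 < r" if "y \<in> ball b (2 * r / 3)" for y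
      using that bc(1) dist_triangle[of y b0 b] by (simp add: dist_commute)
    have c: "c \<in> ball b (2 * r / 3)"
      using bc dist_triangle[of b c b0] by (simp add: dist_commute)
    have "\<bar>taylor_rem p h b \<gamma> c\<bar> \<le> ?N ^ (p - mi_deg \<gamma>) * e' * norm (c - b) ^ (p - mi_deg \<gamma>)"
    proof (rule taylor_rem_bound[OF V h _ _ _ c])
      show "ball b (2 * r / 3) \<subseteq> V" using near rV by auto
      show "mi_deg \<gamma> \<le> p" using \<gamma> by (simp add: mons_def)
      fix \<delta> :: "'m \<Rightarrow> nat" and y assume \<delta>: "mi_deg \<delta> = p" and y: "y \<in> ball b (2 * r / 3)"
      have "\<delta> \<in> mons p" using \<delta> by (simp add: mons_def)
      moreover have "dist b b0 < r" using bc r by (simp add: dist_commute)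
      ultimately show "\<bar>hpartial \<delta> h y - hpartial \<delta> h b\<bar> \<le> e'"
        using close[OF near[OF y], of \<delta>] close[of b \<delta>] unfolding dist_real_def by linarith
    qed
    also have "\<dots> \<le> ?N ^ p * e' * norm (c - b) ^ (p - mi_deg \<gamma>)"
      by (intro mult_right_mono power_increasing N) (use e' in auto)
    also have "\<dots> = e * norm (b - c) ^ (p - mi_deg \<gamma>)" using N by (simp add: e'_def norm_minus_commute)
    finally show "\<bar>taylor_rem p h b \<gamma> c\<bar> \<le> e * norm (b - c) ^ (p - mi_deg \<gamma>)" .
  qed
qed

section \<open>Change of centre for shifted monomials and Taylor polynomials\<close>

lemma shmon_prod:
  "shmon c \<gamma> \<alpha> = (\<Prod>i\<in>UNIV. if \<alpha> i \<le> \<gamma> i then (- (c $ i)) ^ (\<gamma> i - \<alpha> i) / (fact (\<gamma> i - \<alpha> i) * fact (\<alpha> i)) else 0)"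
proof (cases "\<forall>i. \<alpha> i \<le> \<gamma> i")
  case True
  then have "shmon c \<gamma> \<alpha> = (\<Prod>i\<in>UNIV. real (\<gamma> i choose \<alpha> i) * (- (c $ i)) ^ (\<gamma> i - \<alpha> i) / fact (\<gamma> i))"
    by (simp add: shmon_def mi_fact_def prod_dividef)
  also have "\<dots> = (\<Prod>i\<in>UNIV. if \<alpha> i \<le> \<gamma> i then (- (c $ i)) ^ (\<gamma> i - \<alpha> i) / (fact (\<gamma> i - \<alpha> i) * fact (\<alpha> i)) else 0)"
    using True by (intro prod.cong) (auto simp: binomial_fact)
  finally show ?thesis .
next
  case False
  then show ?thesis by (auto simp: shmon_def)
qed

text \<open>Coefficient of x^k in the expansion of (x - b)^n / n! by powers of x - c, obtained from
  x - b = (c - b) + (x - c).\<close>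

lemma shift_coeff_one_dim:
  fixes b c :: real
  shows "(if k \<le> n then (- b) ^ (n - k) / (fact (n - k) * fact k) else 0)
    = (\<Sum>j\<le>n. (c - b) ^ (n - j) / fact (n - j) * (if k \<le> j then (- c) ^ (j - k) / (fact (j - k) * fact k) else 0))"
proof (cases "k \<le> n")
  case True
  have "(\<Sum>j\<le>n. (c - b) ^ (n - j) / fact (n - j) * (if k \<le> j then (- c) ^ (j - k) / (fact (j - k) * fact k) else 0))
    = (\<Sum>j\<in>{k..n}. (c - b) ^ (n - j) / fact (n - j) * ((- c) ^ (j - k) / (fact (j - k) * fact k)))"
    by (rule sum.mono_neutral_cong_right) auto
  also have "\<dots> = (\<Sum>i\<le>n - k. (c - b) ^ (n - k - i) / fact (n - k - i) * ((- c) ^ i / (fact i * fact k)))"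
    by (rule sum.reindex_bij_witness[of _ "\<lambda>i. i + k" "\<lambda>j. j - k"]) (use True in auto)
  also have "\<dots> = (\<Sum>i\<le>n - k. ((- c) ^ i /\<^sub>R fact i) * ((c - b) ^ (n - k - i) /\<^sub>R fact (n - k - i))) / fact k"
    unfolding sum_divide_distrib by (rule sum.cong) (auto simp: field_simps)
  also have "\<dots> = ((- c + (c - b)) ^ (n - k) /\<^sub>R fact (n - k)) / fact k"
    \<comment> \<open>This is the binomial theorem for divided powers.\<close>
    by (subst exp_series_add_commuting) (auto simp: mult.commute)
  finally show ?thesis using True by (simp add: divide_inverse)
next
  case False
  then show ?thesis by (simp add: sum.neutral)
qed

text \<open>\<open>shmon\<close> factors over the coordinates; expanding the product of the
  one-variable sums gives the sum over all \<open>\<gamma>\<close> below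
  \<open>\<beta>\<close>.\<close>

lemma shmon_shift:
  "shmon b \<beta> \<alpha> = (\<Sum>\<gamma> | \<forall>i. \<gamma> i \<le> \<beta> i. npow (c - b) (\<lambda>i. \<beta> i - \<gamma> i) * shmon c \<gamma> \<alpha>)"
proof -
  let ?s = "\<lambda>(c::real) n k. if k \<le> n then (- c) ^ (n - k) / (fact (n - k) * fact k) else 0"
  let ?A = "\<lambda>i j. (c $ i - b $ i) ^ (\<beta> i - j) / fact (\<beta> i - j) * ?s (c $ i) j (\<alpha> i)"
  have PiE: "Pi\<^sub>E UNIV (\<lambda>i. {..\<beta> i}) = {\<gamma>. \<forall>i. \<gamma> i \<le> \<beta> i}"
    by (auto simp: PiE_def Pi_def extensional_def)
  have "shmon b \<beta> \<alpha> = (\<Prod>i\<in>UNIV. \<Sum>j\<le>\<beta> i. ?A i j)"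
    unfolding shmon_prod by (rule prod.cong[OF refl]) (rule shift_coeff_one_dim)
  also have "\<dots> = (\<Sum>\<gamma>\<in>Pi\<^sub>E UNIV (\<lambda>i. {..\<beta> i}). \<Prod>i\<in>UNIV. ?A i (\<gamma> i))"
    by (rule prod_sum_PiE) auto
  also have "\<dots> = (\<Sum>\<gamma> | \<forall>i. \<gamma> i \<le> \<beta> i. npow (c - b) (\<lambda>i. \<beta> i - \<gamma> i) * shmon c \<gamma> \<alpha>)"
    unfolding PiE npow_def shmon_prod prod.distrib[symmetric] by simp
  finally show ?thesis .
qed

lemma dcomp_shift:
  "dcomp p \<eta> \<beta> b = (\<Sum>\<gamma> | \<forall>i. \<gamma> i \<le> \<beta> i. npow (c - b) (\<lambda>i. \<beta> i - \<gamma> i) * dcomp p \<eta> \<gamma> c)"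
  unfolding dcomp_def dual_apply_def shmon_shift[of b \<beta> _ c] sum_distrib_left
  by (subst sum.swap) (simp add: mult.left_commute)

lemma dual_apply_taylor: "dual_apply p \<eta> (taylor p h b) = (\<Sum>\<beta>\<in>mons p. hpartial \<beta> h b * dcomp p \<eta> \<beta> b)"
  unfolding dcomp_def dual_apply_def taylor_def sum_distrib_left
  by (subst sum.swap) (simp add: mult.left_commute)

text \<open>Re-expand the Taylor polynomial at \<open>b\<close> around \<open>c\<close>. With
  \<open>\<beta> = \<gamma> + \<delta>\<close>, its coefficient at \<open>\<gamma>\<close> is the
  Taylor sum for the derivative of multi-index \<open>\<gamma>\<close>, so the coefficients of the
  difference are exactly the remainders.\<close>

lemma dual_apply_taylor_diff:
  "dual_apply p \<eta> (taylor p h c) - dual_apply p \<eta> (taylor p h b)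
    = (\<Sum>\<gamma>\<in>mons p. taylor_rem p h b \<gamma> c * dcomp p \<eta> \<gamma> c)"
proof -
  let ?f = "\<lambda>\<gamma> \<beta>. hpartial \<beta> h b * (npow (c - b) (\<lambda>i. \<beta> i - \<gamma> i) * dcomp p \<eta> \<gamma> c)"
  let ?g = "\<lambda>\<gamma> \<delta>. hpartial (\<lambda>i. \<gamma> i + \<delta> i) h b * npow (c - b) \<delta> * dcomp p \<eta> \<gamma> c"
  have "dual_apply p \<eta> (taylor p h b) = (\<Sum>\<beta>\<in>mons p. \<Sum>\<gamma> | \<forall>i. \<gamma> i \<le> \<beta> i. ?f \<gamma> \<beta>)"
    unfolding dual_apply_taylor dcomp_shift[of p \<eta> _ b c] sum_distrib_left ..
  also have "\<dots> = (\<Sum>(\<beta>, \<gamma>)\<in>(SIGMA \<beta>:mons p. {\<gamma>. \<forall>i. \<gamma> i \<le> \<beta> i}). ?f \<gamma> \<beta>)"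
    by (rule sum.Sigma) (auto simp: finite_mi_le)
  also have "\<dots> = (\<Sum>(\<gamma>, \<delta>)\<in>(SIGMA \<gamma>:mons p. mons (p - mi_deg \<gamma>)). ?g \<gamma> \<delta>)"
  proof (rule sum.reindex_bij_witness[of _ "\<lambda>(\<gamma>, \<delta>). (\<lambda>i. \<gamma> i + \<delta> i, \<gamma>)" "\<lambda>(\<beta>, \<gamma>). (\<gamma>, \<lambda>i. \<beta> i - \<gamma> i)"])
    fix x assume "x \<in> (SIGMA \<beta>:mons p. {\<gamma>. \<forall>i. \<gamma> i \<le> \<beta> i})"
    then obtain \<beta> \<gamma> where x: "x = (\<beta>, \<gamma>)" "\<beta> \<in> mons p" "\<forall>i. \<gamma> i \<le> \<beta> i" by auto
    have "(\<lambda>i. \<gamma> i + (\<beta> i - \<gamma> i)) = \<beta>" using x by auto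
    with x(2) mi_deg_add[of \<gamma> "\<lambda>i. \<beta> i - \<gamma> i"]
    show "(case x of (\<beta>, \<gamma>) \<Rightarrow> (\<gamma>, \<lambda>i. \<beta> i - \<gamma> i)) \<in> (SIGMA \<gamma>:mons p. mons (p - mi_deg \<gamma>))"
      unfolding x(1) by (auto simp: mons_def)
  qed (auto simp: mons_def mi_deg_add fun_eq_iff mult.assoc)
  also have "\<dots> = (\<Sum>\<gamma>\<in>mons p. \<Sum>\<delta>\<in>mons (p - mi_deg \<gamma>). ?g \<gamma> \<delta>)"
    by (rule sum.Sigma[symmetric]) auto
  finally show ?thesis
    by (simp add: dual_apply_taylor taylor_rem_def left_diff_distrib sum_subtractf sum_distrib_right)
qed

section \<open>The pushforward\<close>

text \<open>All partial derivatives of order below \<open>n\<close> vanish at \<open>x\<close>. The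
  recursion through \<open>partial\<close> matches that of \<open>Cp\<close>, so product rule
  arguments go by induction on \<open>n\<close>.\<close>

fun flat :: "nat \<Rightarrow> (real^'m::finite \<Rightarrow> real) \<Rightarrow> real^'m \<Rightarrow> bool" where
  "flat 0 h x = True"
| "flat (Suc n) h x = (h x = 0 \<and> (\<forall>i. flat n (partial i h) x))"

lemma flat_SucD: "flat (Suc n) h x \<Longrightarrow> flat n h x"
  by (induction n arbitrary: h) auto

lemma flat_mono:
  assumes "flat n h x" "k \<le> n"
  shows "flat k h x"
  using assms(2,1)
proof (induction rule: dec_induct)
  case (step n)
  then show ?case using flat_SucD by blast
qed

lemma flat_cong:
  assumes "open V" "x \<in> V" "\<And>y. y \<in> V \<Longrightarrow> u y = v y" "flat n u x"
  shows "flat n v x"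
  using assms(3,4)
proof (induction n arbitrary: u v)
  case (Suc n)
  have "flat n (partial i v) x" for i
  proof (rule Suc.IH)
    show "partial i u y = partial i v y" if "y \<in> V" for y
      by (rule partial_cong[OF assms(1) that Suc.prems(1)])
    show "flat n (partial i u) x" using Suc.prems(2) by simp
  qed
  then show ?case using Suc.prems assms(2) by simp
qed simp

lemma flat_add:
  assumes V: "open V" and x: "x \<in> V"
    and "Cp n u V" "Cp n v V" "flat n u x" "flat n v x"
  shows "flat n (\<lambda>y. u y + v y) x"
  using assms(3-)
proof (induction n arbitrary: u v)
  case (Suc n)
  have "flat n (partial i (\<lambda>y. u y + v y)) x" for i
  proof (rule flat_cong[OF V x])
    show "flat n (\<lambda>y. partial i u y + partial i v y) x"
      using Suc.prems by (intro Suc.IH Cp_Suc_partial) auto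
    show "partial i u y + partial i v y = partial i (\<lambda>y. u y + v y) y" if "y \<in> V" for y
      by (rule partial_eqI[symmetric])
        (intro DERIV_add Cp_has_partial0[OF Suc.prems(1) that] Cp_has_partial0[OF Suc.prems(2) that])
  qed
  then show ?case using Suc.prems by simp
qed simp

text \<open>Orders of vanishing add: each term of the product rule loses one order in one factor
  only. The inequality for \<open>n\<close> leaves room to cap the order by the available
  smoothness.\<close>

lemma flat_mult:
  assumes V: "open V" and x: "x \<in> V"
    and "Cp n u V" "Cp n v V" "flat j u x" "flat k v x" "n \<le> j + k"
  shows "flat n (\<lambda>y. u y * v y) x"
  using assms(3-)
proof (induction n arbitrary: u v j k)
  case (Suc n)
  have u0: "Cp n u V" and v0: "Cp n v V" using Suc.prems(1,2) Cp_SucD by blast+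
  have u1: "Cp n (partial i u) V" and v1: "Cp n (partial i v) V" for i
    using Suc.prems(1,2) Cp_Suc_partial by blast+
  have "flat n (partial i (\<lambda>y. u y * v y)) x" for i
  proof (rule flat_cong[OF V x])
    have "flat (j - 1) (partial i u) x" using Suc.prems(3) by (cases j) auto
    \<comment> \<open>For \<open>j = 0\<close> the factor \<open>u\<close> has no order to lose, and
      \<open>v\<close> alone supplies the required \<open>n\<close>.\<close>
    moreover have "flat (Suc n) v x" if "j = 0" by (rule flat_mono[OF Suc.prems(4)]) (use Suc.prems(5) that in simp)
    ultimately have 1: "flat n (\<lambda>y. partial i u y * v y) x"
      using Suc.IH[OF u1 v0, where j = "j - 1" and k = "if j = 0 then n else k"] Suc.prems(4,5) flat_SucD
      by (cases "j = 0") auto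
    have "flat (k - 1) (partial i v) x" using Suc.prems(4) by (cases k) auto
    moreover have "flat (Suc n) u x" if "k = 0" by (rule flat_mono[OF Suc.prems(3)]) (use Suc.prems(5) that in simp)
    ultimately have 2: "flat n (\<lambda>y. u y * partial i v y) x"
      using Suc.IH[OF u0 v1, where k = "k - 1" and j = "if k = 0 then n else j"] Suc.prems(3,5) flat_SucD
      by (cases "k = 0") auto
    show "flat n (\<lambda>y. partial i u y * v y + u y * partial i v y) x"
      by (rule flat_add[OF V x Cp_mult[OF V u1 v0] Cp_mult[OF V u0 v1] 1 2])
    show "partial i u y * v y + u y * partial i v y = partial i (\<lambda>y. u y * v y) y" if "y \<in> V" for y
      by (rule partial_eqI[symmetric])
        (rule DERIV_cong[OF DERIV_mult[OF Cp_has_partial0[OF Suc.prems(1) that] Cp_has_partial0[OF Suc.prems(2) that]]], simp)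
  qed
  moreover have "u x * v x = 0"
    using Suc.prems(3-5) by (cases j; cases k) auto
  ultimately show ?case by simp
qed simp

lemma flat_power:
  assumes V: "open V" and x: "x \<in> V" and u: "Cp p u V" "u x = 0" and n: "n \<le> p"
  shows "flat n (\<lambda>y. u y ^ n) x"
  using n
proof (induction n)
  case (Suc n)
  have "flat (Suc n) (\<lambda>y. u y * u y ^ n) x"
    by (rule flat_mult[OF V x, where j = 1 and k = n])
      (use Suc u Cp_mono[OF u(1) Suc.prems] Cp_power[OF V] in auto)
  then show ?case by simp
qed simp

lemma flat_prod:
  assumes V: "open V" and x: "x \<in> V" and J: "finite J"
    and u: "\<And>j. j \<in> J \<Longrightarrow> Cp p (u j) V" "\<And>j. j \<in> J \<Longrightarrow> flat (n j) (u j) x" and n: "(\<Sum>j\<in>J. n j) \<le> p"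
  shows "flat (\<Sum>j\<in>J. n j) (\<lambda>y. \<Prod>j\<in>J. u j y) x"
  using J u n
proof (induction J rule: finite_induct)
  case (insert j J)
  have le: "(\<Sum>j\<in>insert j J. n j) \<le> p" using insert.prems(3) .
  have "flat (\<Sum>j\<in>insert j J. n j) (\<lambda>y. u j y * (\<Prod>j\<in>J. u j y)) x"
  proof (rule flat_mult[OF V x, where j = "n j" and k = "\<Sum>j\<in>J. n j"])
    show "Cp (\<Sum>j\<in>insert j J. n j) (u j) V" using Cp_mono[OF _ le] insert.prems(1) by blast
    show "Cp (\<Sum>j\<in>insert j J. n j) (\<lambda>y. \<Prod>j\<in>J. u j y) V"
      by (rule Cp_mono[OF Cp_prod[OF V] le]) (use insert.prems(1) in blast)
    show "flat (\<Sum>j\<in>J. n j) (\<lambda>y. \<Prod>j\<in>J. u j y) x"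
      using insert by (intro insert.IH) auto
  qed (use insert in auto)
  then show ?case using insert.hyps by simp
qed simp

lemma partials_flat: "flat n h x \<Longrightarrow> length L < n \<Longrightarrow> partials L h x = 0"
proof (induction L arbitrary: h n rule: rev_induct)
  case Nil
  then show ?case by (cases n) auto
next
  case (snoc i L)
  then show ?case by (cases n) (auto simp: partials_snoc)
qed

lemma hpartial_flat: "flat n h x \<Longrightarrow> mi_deg \<alpha> < n \<Longrightarrow> hpartial \<alpha> h x = 0"
  by (rule hpartial_obtain[of \<alpha>]) (simp add: partials_flat)

section \<open>Pushforward on monomials and delta functionals, and its behaviour under
  limits\<close>

abbreviation mpow :: "('d::finite \<Rightarrow> nat) \<Rightarrow> real^'d \<Rightarrow> real" where
  "mpow \<gamma> z \<equiv> (\<Prod>i\<in>UNIV. (z $ i) ^ \<gamma> i)"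

lemma poly_eval_monomial: "\<gamma> \<in> mons p \<Longrightarrow> poly_eval p (monomial_mi \<gamma>) x = mpow \<gamma> x"
  by (simp add: poly_eval_def monomial_mi_def if_distrib[of "\<lambda>c. c * _"] cong: if_cong)

lemma pushfwd_eq:
  "pushfwd p \<phi> b \<eta> \<gamma> = (if \<gamma> \<in> mons p then dual_apply p \<eta> (taylor p (\<lambda>y. mpow \<gamma> (\<phi> y)) b) else 0)"
  by (simp add: pushfwd_def pullback_def poly_eval_monomial)

lemma dual_apply_linear:
  "dual_apply p (\<lambda>\<gamma>. c * \<xi> \<gamma> + \<eta> \<gamma>) P = c * dual_apply p \<xi> P + dual_apply p \<eta> P"
  by (simp add: dual_apply_def sum.distrib sum_distrib_left algebra_simps)

lemma pushfwd_linear: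
  "pushfwd p \<phi> b (\<lambda>\<gamma>. c * \<xi> \<gamma> + \<eta> \<gamma>) = (\<lambda>\<gamma>. c * pushfwd p \<phi> b \<xi> \<gamma> + pushfwd p \<phi> b \<eta> \<gamma>)"
  by (auto simp: pushfwd_def dual_apply_linear)

lemma pushfwd_zero: "pushfwd p \<phi> b (\<lambda>_. 0) = (\<lambda>_. 0)"
  by (auto simp: pushfwd_def dual_apply_def)

lemma pushfwd_scale: "pushfwd p \<phi> b (\<lambda>\<gamma>. c * \<xi> \<gamma>) = (\<lambda>\<gamma>. c * pushfwd p \<phi> b \<xi> \<gamma>)"
  using pushfwd_linear[of p \<phi> b c \<xi> "\<lambda>_. 0"] by (simp add: pushfwd_zero)

lemma Cp_mpow: "open V \<Longrightarrow> Cp_map p \<phi> V \<Longrightarrow> Cp p (\<lambda>y. mpow \<gamma> (\<phi> y)) V"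
  by (intro Cp_prod Cp_power) (auto simp: Cp_map_def)

text \<open>\<open>pushfwd\<close> is prescribed on monomials; linearity of derivatives extends the
  duality to every polynomial, which converts the second assertion of the theorem into the
  third.\<close>

lemma dual_apply_pushfwd:
  assumes V: "open V" and \<phi>: "Cp_map p \<phi> V" and b: "b \<in> V"
  shows "dual_apply p (pushfwd p \<phi> b \<eta>) P = dual_apply p \<eta> (pullback p \<phi> b P)"
proof -
  have "hpartial \<beta> (\<lambda>y. \<Sum>\<gamma>\<in>mons p. P \<gamma> * mpow \<gamma> (\<phi> y)) b = (\<Sum>\<gamma>\<in>mons p. P \<gamma> * hpartial \<beta> (\<lambda>y. mpow \<gamma> (\<phi> y)) b)"
    if "\<beta> \<in> mons p" for \<beta>
    by (rule hpartial_sum[OF V Cp_mono[OF Cp_mpow[OF V \<phi>]] b]) (use that in \<open>auto simp: mons_def\<close>)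
  then have "dual_apply p \<eta> (pullback p \<phi> b P)
    = (\<Sum>\<beta>\<in>mons p. \<Sum>\<gamma>\<in>mons p. P \<gamma> * hpartial \<beta> (\<lambda>y. mpow \<gamma> (\<phi> y)) b * dcomp p \<eta> \<beta> b)"
    unfolding pullback_def dual_apply_taylor poly_eval_def by (simp add: sum_distrib_right)
  also have "\<dots> = (\<Sum>\<gamma>\<in>mons p. pushfwd p \<phi> b \<eta> \<gamma> * P \<gamma>)"
    by (subst sum.swap) (auto simp: pushfwd_eq dual_apply_taylor sum_distrib_left sum_distrib_right mult_ac intro!: sum.cong)
  finally show ?thesis by (simp add: dual_apply_def[of p "pushfwd p \<phi> b \<eta>"])
qed

lemma shmon_0: "shmon 0 \<gamma> \<alpha> = (if \<alpha> = \<gamma> then 1 / mi_fact \<gamma> else 0)"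
proof (cases "\<forall>i. \<alpha> i \<le> \<gamma> i")
  case True
  show ?thesis
  proof (cases "\<alpha> = \<gamma>")
    case False
    then obtain i where "\<alpha> i \<noteq> \<gamma> i" by auto
    then have "\<gamma> i - \<alpha> i \<noteq> 0" using True by (metis diff_is_0_eq le_antisym)
    then have "(\<Prod>i\<in>UNIV. real (\<gamma> i choose \<alpha> i) * (- ((0::real^'a) $ i)) ^ (\<gamma> i - \<alpha> i)) = 0"
      by (intro prod_zero bexI[of _ i]) auto
    then show ?thesis using False by (simp add: shmon_def)
  qed (simp add: shmon_def)
qed (auto simp: shmon_def)

lemma npow_add: "npow (x + y) \<beta> = (\<Sum>\<gamma> | \<forall>i. \<gamma> i \<le> \<beta> i. npow x (\<lambda>i. \<beta> i - \<gamma> i) * npow y \<gamma>)"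
proof -
  have PiE: "Pi\<^sub>E UNIV (\<lambda>i. {..\<beta> i}) = {\<gamma>. \<forall>i. \<gamma> i \<le> \<beta> i}"
    by (auto simp: PiE_def Pi_def extensional_def)
  have one: "(s + t) ^ n / fact n = (\<Sum>j\<le>n. s ^ (n - j) / fact (n - j) * (t ^ j / fact j))" for s t :: real and n
  proof -
    have "(s + t) ^ n / fact n = (t + s) ^ n /\<^sub>R fact n" by (simp add: divide_inverse add.commute)
    also have "\<dots> = (\<Sum>j\<le>n. (t ^ j /\<^sub>R fact j) * (s ^ (n - j) /\<^sub>R fact (n - j)))"
      by (rule exp_series_add_commuting) (rule mult.commute)
    finally show ?thesis by (simp add: divide_inverse mult_ac)
  qed
  have "npow (x + y) \<beta> = (\<Prod>i\<in>UNIV. \<Sum>j\<le>\<beta> i. (x $ i) ^ (\<beta> i - j) / fact (\<beta> i - j) * ((y $ i) ^ j / fact j))"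
    unfolding npow_def vector_add_component one ..
  also have "\<dots> = (\<Sum>\<gamma>\<in>Pi\<^sub>E UNIV (\<lambda>i. {..\<beta> i}). \<Prod>i\<in>UNIV. (x $ i) ^ (\<beta> i - \<gamma> i) / fact (\<beta> i - \<gamma> i) * ((y $ i) ^ \<gamma> i / fact (\<gamma> i)))"
    by (rule prod_sum_PiE) auto
  finally show ?thesis unfolding PiE npow_def prod.distrib .
qed

text \<open>Immediate at centre 0, where shifted monomials are plain ones; the general centre
  follows from the change of centre and the binomial theorem.\<close>

lemma dcomp_delta:
  assumes "\<gamma> \<in> mons p"
  shows "dcomp p (delta p w) \<gamma> z = npow (w - z) \<gamma>"
proof -
  have 0: "dcomp p (delta p w) \<beta> 0 = npow w \<beta>" if "\<beta> \<in> mons p" for \<beta>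
    using that by (simp add: dcomp_def dual_apply_def shmon_0 delta_def npow_def prod_dividef mi_fact_def
        if_distrib[of "\<lambda>c. _ * c"] cong: if_cong)
  have "dcomp p (delta p w) \<gamma> z = (\<Sum>\<beta> | \<forall>i. \<beta> i \<le> \<gamma> i. npow (0 - z) (\<lambda>i. \<gamma> i - \<beta> i) * dcomp p (delta p w) \<beta> 0)"
    by (rule dcomp_shift)
  also have "\<dots> = (\<Sum>\<beta> | \<forall>i. \<beta> i \<le> \<gamma> i. npow (0 - z) (\<lambda>i. \<gamma> i - \<beta> i) * npow w \<beta>)"
    using assms by (intro sum.cong refl arg_cong2[where f = "(*)"] 0)
      (auto simp: mons_def intro: order_trans[OF mi_deg_mono])
  also have "\<dots> = npow (0 - z + w) \<gamma>" by (rule npow_add[symmetric])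
  finally show ?thesis by simp
qed

text \<open>A Taylor polynomial evaluated at its own centre keeps only its constant term. This
  starts the induction over the iterates.\<close>

lemma pushfwd_delta: "pushfwd p \<phi> b (delta p b) = delta p (\<phi> b)" for \<phi> :: "real^'m::finite \<Rightarrow> real^'n::finite"
proof
  fix \<gamma> :: "'n \<Rightarrow> nat"
  have "dual_apply p (delta p b) (taylor p h b) = h b" for h :: "real^'m \<Rightarrow> real"
  proof -
    have "dual_apply p (delta p b) (taylor p h b) = (\<Sum>\<beta>\<in>mons p. if \<beta> = (\<lambda>_::'m. 0) then h b else 0)"
      unfolding dual_apply_taylor by (rule sum.cong) (auto simp: dcomp_delta npow_0)
    moreover have "(\<lambda>_::'m. 0) \<in> mons p" by (simp add: mons_def)
    ultimately show ?thesis by simp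
  qed
  then show "pushfwd p \<phi> b (delta p b) \<gamma> = delta p (\<phi> b) \<gamma>"
    by (simp add: pushfwd_eq delta_def)
qed

lemma tendsto_shmon:
  assumes "(f \<longlongrightarrow> c) F"
  shows "((\<lambda>x. shmon (f x) \<gamma> \<alpha>) \<longlongrightarrow> shmon c \<gamma> \<alpha>) F"
proof (cases "\<forall>i. \<alpha> i \<le> \<gamma> i")
  case True
  then have "shmon x \<gamma> \<alpha> = (\<Prod>i\<in>UNIV. real (\<gamma> i choose \<alpha> i) * (- (x $ i)) ^ (\<gamma> i - \<alpha> i)) / mi_fact \<gamma>" for x
    by (simp add: shmon_def)
  then show ?thesis using assms by (auto intro!: tendsto_intros simp: mi_fact_def)
next
  case False
  then have "shmon x \<gamma> \<alpha> = 0" for x unfolding shmon_def by (simp only: if_False)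
  then show ?thesis by simp
qed

lemma tendsto_hpartial:
  assumes V: "open V" and h: "Cp p h V" and \<gamma>: "\<gamma> \<in> mons p" and b0: "b0 \<in> V" and f: "(f \<longlongrightarrow> b0) F"
  shows "((\<lambda>x. hpartial \<gamma> h (f x)) \<longlongrightarrow> hpartial \<gamma> h b0) F"
proof (rule isCont_tendsto_compose[OF _ f])
  show "isCont (hpartial \<gamma> h) b0"
    using Cp_hpartial_continuous[OF h, of \<gamma>] \<gamma> V b0 continuous_on_eq_continuous_at
    by (auto simp: mons_def)
qed

lemma tendsto_dual_taylor:
  assumes V: "open V" and h: "Cp p h V" and b0: "b0 \<in> V" and f: "(f \<longlongrightarrow> b0) F"
    and \<zeta>: "\<And>\<gamma>. ((\<lambda>x. \<zeta> x \<gamma>) \<longlongrightarrow> \<zeta>0 \<gamma>) F"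
  shows "((\<lambda>x. dual_apply p (\<zeta> x) (taylor p h (f x))) \<longlongrightarrow> dual_apply p \<zeta>0 (taylor p h b0)) F"
  unfolding dual_apply_taylor unfolding dcomp_def dual_apply_def
  by (intro tendsto_sum tendsto_mult tendsto_shmon f \<zeta> tendsto_hpartial[OF V h _ b0 f])

lemma tendsto_pushfwd:
  assumes V: "open V" and \<phi>: "Cp_map p \<phi> V" and b0: "b0 \<in> V" and f: "(f \<longlongrightarrow> b0) F"
    and \<zeta>: "\<And>\<gamma>. ((\<lambda>x. \<zeta> x \<gamma>) \<longlongrightarrow> \<zeta>0 \<gamma>) F"
  shows "((\<lambda>x. pushfwd p \<phi> (f x) (\<zeta> x) \<gamma>) \<longlongrightarrow> pushfwd p \<phi> b0 \<zeta>0 \<gamma>) F"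
  using tendsto_dual_taylor[OF V Cp_mpow[OF V \<phi>] b0 f \<zeta>] by (simp add: pushfwd_eq)

text \<open>The functionals \<open>\<xi> i\<close> and \<open>\<eta> i\<close> may diverge
  separately, so the sum is pushed forward as a whole from \<open>b i\<close> and the error is
  estimated.\<close>

lemma pushfwd_tendsto_sum:
  assumes V: "open V" and \<phi>: "Cp_map p \<phi> V" and b0: "b0 \<in> V" and b: "b \<longlonglongrightarrow> b0" and c: "c \<longlonglongrightarrow> b0"
    and W: "\<And>i. Wcond p (b i) (c i) (\<eta> i)" and \<zeta>: "\<And>\<gamma>. (\<lambda>i. \<xi> i \<gamma> + \<eta> i \<gamma>) \<longlonglongrightarrow> \<zeta> \<gamma>"
  shows "(\<lambda>i. pushfwd p \<phi> (b i) (\<xi> i) \<gamma> + pushfwd p \<phi> (c i) (\<eta> i) \<gamma>) \<longlonglongrightarrow> pushfwd p \<phi> b0 \<zeta> \<gamma>"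
proof (cases "\<gamma> \<in> mons p")
  case True
  let ?h = "\<lambda>y. mpow \<gamma> (\<phi> y)"
  have h: "Cp p ?h V" by (rule Cp_mpow[OF V \<phi>])
  \<comment> \<open>The error from treating \<open>\<eta> i\<close> as if it were based at
    \<open>b i\<close> instead of \<open>c i\<close>.\<close>
  let ?r = "\<lambda>i. dual_apply p (\<eta> i) (taylor p ?h (c i)) - dual_apply p (\<eta> i) (taylor p ?h (b i))"
  have "?r \<longlonglongrightarrow> 0"
  proof (rule tendstoI)
    fix e :: real assume e: "e > 0"
    let ?N = "real (card (mons p :: ('a \<Rightarrow> nat) set))"
    \<comment> \<open>Each of the \<open>?N\<close> summands is at most \<open>e'\<close>; the added
      1 makes the total strictly smaller than \<open>e\<close>.\<close>
    define e' where "e' = e / (?N + 1)"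
    have e': "e' > 0" using e by (simp add: e'_def add_nonneg_pos)
    obtain d where d: "d > 0" "\<And>b c \<gamma>. b \<in> ball b0 d \<Longrightarrow> c \<in> ball b0 d \<Longrightarrow> \<gamma> \<in> mons p \<Longrightarrow>
        \<bar>taylor_rem p ?h b \<gamma> c\<bar> \<le> e' * norm (b - c) ^ (p - mi_deg \<gamma>)"
      using taylor_rem_little_o[OF V h b0 e'] by blast
    have "eventually (\<lambda>i. dist (b i) b0 < d) sequentially" "eventually (\<lambda>i. dist (c i) b0 < d) sequentially"
      using b c d(1) tendstoD by blast+
    then show "eventually (\<lambda>i. dist (?r i) 0 < e) sequentially"
    proof eventually_elim
      case (elim i)
      have "\<bar>?r i\<bar> \<le> (\<Sum>\<alpha>\<in>mons p. \<bar>taylor_rem p ?h (b i) \<alpha> (c i) * dcomp p (\<eta> i) \<alpha> (c i)\<bar>)"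
        unfolding dual_apply_taylor_diff by (rule sum_abs)
      also have "\<dots> \<le> (\<Sum>\<alpha>\<in>(mons p :: ('a \<Rightarrow> nat) set). e')"
      proof (rule sum_mono)
        fix \<alpha> :: "'a \<Rightarrow> nat" assume \<alpha>: "\<alpha> \<in> mons p"
        have "\<bar>taylor_rem p ?h (b i) \<alpha> (c i)\<bar> \<le> e' * norm (b i - c i) ^ (p - mi_deg \<alpha>)"
          using elim by (intro d(2) \<alpha>) (auto simp: dist_commute)
        then have "\<bar>taylor_rem p ?h (b i) \<alpha> (c i) * dcomp p (\<eta> i) \<alpha> (c i)\<bar>
            \<le> e' * norm (b i - c i) ^ (p - mi_deg \<alpha>) * \<bar>dcomp p (\<eta> i) \<alpha> (c i)\<bar>"
          unfolding abs_mult by (rule mult_right_mono) simp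
        also have "\<dots> = e' * (norm (b i - c i) ^ (p - mi_deg \<alpha>) * \<bar>dcomp p (\<eta> i) \<alpha> (c i)\<bar>)" by simp
        also have "\<dots> \<le> e' * 1"
          using W[of i] \<alpha> e' by (intro mult_left_mono) (auto simp: Wcond_def)
        finally show "\<bar>taylor_rem p ?h (b i) \<alpha> (c i) * dcomp p (\<eta> i) \<alpha> (c i)\<bar> \<le> e'" by simp
      qed
      also have "\<dots> = ?N * e / (?N + 1)" by (simp add: e'_def)
      also have "\<dots> < e" using e by (simp add: field_simps add_nonneg_pos)
      finally show ?case by simp
    qed
  qed
  moreover have "(\<lambda>i. dual_apply p (\<lambda>\<gamma>. \<xi> i \<gamma> + \<eta> i \<gamma>) (taylor p ?h (b i))) \<longlonglongrightarrow> dual_apply p \<zeta> (taylor p ?h b0)"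
    by (rule tendsto_dual_taylor[OF V h b0 b \<zeta>])
  ultimately have "(\<lambda>i. dual_apply p (\<lambda>\<gamma>. \<xi> i \<gamma> + \<eta> i \<gamma>) (taylor p ?h (b i)) + ?r i) \<longlonglongrightarrow> dual_apply p \<zeta> (taylor p ?h b0) + 0"
    by (intro tendsto_add)
  moreover have "dual_apply p (\<lambda>\<gamma>. \<xi> i \<gamma> + \<eta> i \<gamma>) P = dual_apply p (\<xi> i) P + dual_apply p (\<eta> i) P" for i P
    using dual_apply_linear[of p 1 "\<xi> i" "\<eta> i" P] by simp
  ultimately show ?thesis using True by (simp add: pushfwd_eq)
qed (simp add: pushfwd_eq)

section \<open>The growth condition under pushforward\<close>

text \<open>The coefficient of (y - c)^alpha / alpha! in the pullback at \<open>c\<close> of the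
  shifted monomial (x - phi(c))^gamma / gamma!. In this form its continuity in \<open>c\<close> is
  visible.\<close>

definition pull_coeff :: "nat \<Rightarrow> (real^'m::finite \<Rightarrow> real^'n::finite) \<Rightarrow> ('n \<Rightarrow> nat) \<Rightarrow> ('m \<Rightarrow> nat) \<Rightarrow> real^'m \<Rightarrow> real" where
  "pull_coeff p \<phi> \<gamma> \<alpha> c = (\<Sum>\<delta>\<in>mons p. shmon (\<phi> c) \<gamma> \<delta> * hpartial \<alpha> (\<lambda>y. mpow \<delta> (\<phi> y)) c)"

lemma dcomp_pushfwd: "dcomp p (pushfwd p \<phi> c \<eta>) \<gamma> (\<phi> c) = (\<Sum>\<alpha>\<in>mons p. pull_coeff p \<phi> \<gamma> \<alpha> c * dcomp p \<eta> \<alpha> c)"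
proof -
  have "dcomp p (pushfwd p \<phi> c \<eta>) \<gamma> (\<phi> c)
      = (\<Sum>\<delta>\<in>mons p. \<Sum>\<alpha>\<in>mons p. shmon (\<phi> c) \<gamma> \<delta> * hpartial \<alpha> (\<lambda>y. mpow \<delta> (\<phi> y)) c * dcomp p \<eta> \<alpha> c)"
    unfolding dcomp_def[of p "pushfwd p \<phi> c \<eta>"] dual_apply_def[of p "pushfwd p \<phi> c \<eta>"]
    by (rule sum.cong) (simp_all add: pushfwd_eq dual_apply_taylor sum_distrib_left mult_ac)
  also have "\<dots> = (\<Sum>\<alpha>\<in>mons p. pull_coeff p \<phi> \<gamma> \<alpha> c * dcomp p \<eta> \<alpha> c)"
    by (subst sum.swap) (simp add: pull_coeff_def sum_distrib_right)
  finally show ?thesis .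
qed

text \<open>The pulled-back monomial is, up to a constant, a product of
  \<open>mi_deg \<gamma>\<close> factors vanishing at \<open>c\<close>, so all its derivatives of
  lower order vanish there.\<close>

lemma pull_coeff_eq_0:
  assumes V: "open V" and \<phi>: "Cp_map p \<phi> V" and c: "c \<in> V" and \<gamma>: "\<gamma> \<in> mons p" and lt: "mi_deg \<alpha> < mi_deg \<gamma>"
  shows "pull_coeff p \<phi> \<gamma> \<alpha> c = 0"
proof -
  have le: "mi_deg \<gamma> \<le> p" using \<gamma> by (simp add: mons_def)
  have "pull_coeff p \<phi> \<gamma> \<alpha> c = hpartial \<alpha> (\<lambda>y. \<Sum>\<delta>\<in>mons p. shmon (\<phi> c) \<gamma> \<delta> * mpow \<delta> (\<phi> y)) c"
    unfolding pull_coeff_def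
    by (rule hpartial_sum[OF V Cp_mono[OF Cp_mpow[OF V \<phi>]] c, symmetric]) (use le lt in simp)
  \<comment> \<open>Evaluating the expanded shifted monomial at \<open>\<phi> y\<close> is applying
    \<open>delta p (\<phi> y)\<close> to it.\<close>
  also have "(\<lambda>y. \<Sum>\<delta>\<in>mons p. shmon (\<phi> c) \<gamma> \<delta> * mpow \<delta> (\<phi> y)) = (\<lambda>y. npow (\<phi> y - \<phi> c) \<gamma>)"
    using dcomp_delta[OF \<gamma>, of _ "\<phi> c"] by (simp add: dcomp_def dual_apply_def delta_def mult.commute)
  also have "hpartial \<alpha> (\<lambda>y. npow (\<phi> y - \<phi> c) \<gamma>) c = 0"
  proof (rule hpartial_flat[OF _ lt])
    have comp: "Cp p (\<lambda>y. \<phi> y $ i - \<phi> c $ i) V" for i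
      using Cp_add[OF V _ Cp_const[OF V], of p "\<lambda>y. \<phi> y $ i" "- (\<phi> c $ i)"] \<phi> by (simp add: Cp_map_def)
    have "flat (\<Sum>i\<in>UNIV. \<gamma> i) (\<lambda>y. \<Prod>i\<in>UNIV. 1 / fact (\<gamma> i) * (\<phi> y $ i - \<phi> c $ i) ^ \<gamma> i) c"
    proof (rule flat_prod[OF V c finite])
      fix i
      have \<gamma>i: "\<gamma> i \<le> p" using mi_le_deg[of \<gamma> i] le by simp
      show "Cp p (\<lambda>y. 1 / fact (\<gamma> i) * (\<phi> y $ i - \<phi> c $ i) ^ \<gamma> i) V"
        by (intro Cp_mult Cp_const Cp_power V comp)
      show "flat (\<gamma> i) (\<lambda>y. 1 / fact (\<gamma> i) * (\<phi> y $ i - \<phi> c $ i) ^ \<gamma> i) c"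
        by (rule flat_mult[OF V c Cp_const[OF V] Cp_power[OF V Cp_mono[OF comp \<gamma>i]], where j = 0 and k = "\<gamma> i"])
          (use flat_power[OF V c comp _ \<gamma>i] in auto)
    qed (use le in \<open>simp add: mi_deg_def\<close>)
    then show "flat (mi_deg \<gamma>) (\<lambda>y. npow (\<phi> y - \<phi> c) \<gamma>) c"
      by (simp add: mi_deg_def npow_def)
  qed
  finally show ?thesis .
qed

lemma pull_coeff_bounded:
  fixes \<phi> :: "real^'m::finite \<Rightarrow> real^'n::finite"
  assumes V: "open V" and \<phi>: "Cp_map p \<phi> V" and b0: "b0 \<in> V"
  shows "\<exists>K\<ge>0. eventually (\<lambda>c. \<forall>\<gamma>\<in>mons p. \<forall>\<alpha>\<in>mons p. \<bar>pull_coeff p \<phi> \<gamma> \<alpha> c\<bar> \<le> K) (nhds b0)"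
proof -
  have "((\<lambda>c. \<phi> c $ j) \<longlongrightarrow> \<phi> b0 $ j) (nhds b0)" for j
  proof -
    have "continuous_on V (\<lambda>c. \<phi> c $ j)" using \<phi> Cp_continuous_on by (auto simp: Cp_map_def)
    then show ?thesis
      using V b0 continuous_on_eq_continuous_at by (metis continuous_at tendsto_at_iff_tendsto_nhds)
  qed
  then have \<phi>0: "(\<phi> \<longlongrightarrow> \<phi> b0) (nhds b0)" by (rule vec_tendstoI)
  let ?k = "\<lambda>\<gamma> \<alpha>. \<bar>pull_coeff p \<phi> \<gamma> \<alpha> b0\<bar> + 1"
  \<comment> \<open>The sum of all local bounds serves as a common one; the 1 in \<open>?k\<close>
    leaves room for points near \<open>b0\<close>.\<close>
  define K where "K = (\<Sum>\<gamma>\<in>mons p. \<Sum>\<alpha>\<in>mons p. ?k \<gamma> \<alpha>)"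
  have kK: "?k \<gamma> \<alpha> \<le> K" if "\<gamma> \<in> mons p" "\<alpha> \<in> mons p" for \<gamma> \<alpha>
  proof -
    have "?k \<gamma> \<alpha> \<le> (\<Sum>\<alpha>\<in>mons p. ?k \<gamma> \<alpha>)" using that by (intro member_le_sum) auto
    also have "\<dots> \<le> K" unfolding K_def using that
      by (intro member_le_sum[of \<gamma> "mons p" "\<lambda>\<gamma>. \<Sum>\<alpha>\<in>mons p. ?k \<gamma> \<alpha>"]) (auto intro: sum_nonneg)
    finally show ?thesis .
  qed
  have "eventually (\<lambda>c. \<bar>pull_coeff p \<phi> \<gamma> \<alpha> c\<bar> \<le> K) (nhds b0)" if "\<gamma> \<in> mons p" "\<alpha> \<in> mons p" for \<gamma> \<alpha>
  proof -
    have "((\<lambda>c. pull_coeff p \<phi> \<gamma> \<alpha> c) \<longlongrightarrow> pull_coeff p \<phi> \<gamma> \<alpha> b0) (nhds b0)"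
      unfolding pull_coeff_def
      by (intro tendsto_sum tendsto_mult tendsto_shmon \<phi>0 tendsto_hpartial[OF V Cp_mpow[OF V \<phi>] that(2) b0]) (rule filterlim_ident)
    then have "eventually (\<lambda>c. dist (pull_coeff p \<phi> \<gamma> \<alpha> c) (pull_coeff p \<phi> \<gamma> \<alpha> b0) < 1) (nhds b0)"
      by (rule tendstoD) simp
    then show ?thesis
    proof eventually_elim
      case (elim c)
      then show ?case using kK[OF that] unfolding dist_real_def by linarith
    qed
  qed
  then have "eventually (\<lambda>c. \<forall>\<gamma>\<in>mons p. \<forall>\<alpha>\<in>mons p. \<bar>pull_coeff p \<phi> \<gamma> \<alpha> c\<bar> \<le> K) (nhds b0)"
    by (simp add: eventually_ball_finite)
  moreover have "K \<ge> 0" unfolding K_def by (intro sum_nonneg) auto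
  ultimately show ?thesis by blast
qed

lemma Cp_map_locally_Lipschitz:
  fixes \<phi> :: "real^'m::finite \<Rightarrow> real^'n::finite"
  assumes V: "open V" and \<phi>: "Cp_map (Suc q) \<phi> V" and b0: "b0 \<in> V"
  shows "\<exists>d>0. \<exists>L\<ge>1. \<forall>b\<in>ball b0 d. \<forall>c\<in>ball b0 d. norm (\<phi> b - \<phi> c) \<le> L * norm (b - c)"
proof -
  have C: "Cp (Suc q) (\<lambda>y. \<phi> y $ j) V" for j using \<phi> by (simp add: Cp_map_def)
  let ?D = "\<lambda>j i. partial i (\<lambda>y. \<phi> y $ j)"
  define M where "M = (\<Sum>j\<in>UNIV. \<Sum>i\<in>UNIV. \<bar>?D j i b0\<bar> + 1)"
  have kM: "\<bar>?D j i b0\<bar> + 1 \<le> M" for i j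
  proof -
    have "\<bar>?D j i b0\<bar> + 1 \<le> (\<Sum>i\<in>UNIV. \<bar>?D j i b0\<bar> + 1)"
      by (intro member_le_sum[of i UNIV "\<lambda>i. \<bar>?D j i b0\<bar> + 1"]) auto
    also have "\<dots> \<le> M" unfolding M_def
      by (intro member_le_sum[of j UNIV "\<lambda>j. \<Sum>i\<in>UNIV. \<bar>?D j i b0\<bar> + 1"]) (auto intro!: sum_nonneg)
    finally show ?thesis .
  qed
  have M1: "M \<ge> 1" using kM[of undefined undefined] by linarith
  have "eventually (\<lambda>y. \<bar>?D j i y\<bar> \<le> M) (nhds b0)" for i j
  proof -
    have "continuous_on V (?D j i)" by (rule Cp_continuous_on[OF Cp_Suc_partial[OF C]])
    then have "(?D j i \<longlongrightarrow> ?D j i b0) (nhds b0)"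
      using V b0 continuous_on_eq_continuous_at by (metis continuous_at tendsto_at_iff_tendsto_nhds)
    then have "eventually (\<lambda>y. dist (?D j i y) (?D j i b0) < 1) (nhds b0)" by (rule tendstoD) simp
    then show ?thesis
    proof eventually_elim
      case (elim y)
      then show ?case using kM[of i j] unfolding dist_real_def by linarith
    qed
  qed
  then have "eventually (\<lambda>y. \<forall>j i. \<bar>?D j i y\<bar> \<le> M) (nhds b0)" by (simp add: eventually_all_finite)
  moreover have "eventually (\<lambda>y. y \<in> V) (nhds b0)" using V b0 by (rule eventually_nhds_in_open)
  ultimately have "eventually (\<lambda>y. y \<in> V \<and> (\<forall>j i. \<bar>?D j i y\<bar> \<le> M)) (nhds b0)" by eventually_elim auto
  then obtain r where r: "r > 0" "\<And>y. dist y b0 < r \<Longrightarrow> y \<in> V" "\<And>y i j. dist y b0 < r \<Longrightarrow> \<bar>?D j i y\<bar> \<le> M"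
    unfolding eventually_nhds_metric by blast
  define L where "L = real CARD('n) * (real CARD('m) * M)"
  have one: "1 \<le> real CARD('n)" "1 \<le> real CARD('m)" by (simp_all add: Suc_leI)
  have "1 * (1 * 1) \<le> L" unfolding L_def using one M1 by (intro mult_mono) auto
  then have L1: "1 \<le> L" by simp
  have "norm (\<phi> b - \<phi> c) \<le> L * norm (b - c)" if "b \<in> ball b0 (r / 3)" "c \<in> ball b0 (r / 3)" for b c
  proof -
    have near: "dist y b0 < r" if y: "norm (y - c) \<le> norm (b - c)" for y
    proof -
      have "dist y b0 \<le> dist y c + dist c b0" by (rule dist_triangle)
      also have "dist y c \<le> dist b c" using y by (simp add: dist_norm)
      also have "dist b c \<le> dist b b0 + dist b0 c" by (rule dist_triangle)
      finally show ?thesis using \<open>b \<in> _\<close> \<open>c \<in> _\<close> by (simp add: dist_commute)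
    qed
    have comp: "\<bar>\<phi> b $ j - \<phi> c $ j\<bar> \<le> real CARD('m) * (M * norm (b - c))" for j
    proof (rule coordinate_path_bound)
      fix i y assume y: "norm (y - c) \<le> norm (b - c)"
      show "((\<lambda>t. \<phi> (y + t *\<^sub>R axis i 1) $ j) has_real_derivative ?D j i y) (at 0)"
        by (rule Cp_has_partial0[OF C r(2)[OF near[OF y]]])
      show "\<bar>?D j i y\<bar> \<le> M" by (rule r(3)[OF near[OF y]])
    qed
    have "norm (\<phi> b - \<phi> c) \<le> (\<Sum>j\<in>UNIV. \<bar>(\<phi> b - \<phi> c) $ j\<bar>)" by (rule norm_le_l1_cart)
    also have "\<dots> \<le> (\<Sum>j\<in>(UNIV :: 'n set). real CARD('m) * (M * norm (b - c)))"
      by (rule sum_mono) (use comp in simp)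
    also have "\<dots> = L * norm (b - c)" by (simp add: L_def)
    finally show ?thesis .
  qed
  then show ?thesis using L1 r(1) by (intro exI[of _ "r / 3"] conjI exI[of _ L]) auto
qed

text \<open>For \<open>p = 0\<close> the map is merely continuous, but then \<open>k = 0\<close> and
  both powers are 1. Otherwise \<open>L ^ p\<close> serves all exponents because the Lipschitz
  constant is at least 1.\<close>

lemma Cp_map_Lipschitz_power:
  fixes \<phi> :: "real^'m::finite \<Rightarrow> real^'n::finite"
  assumes V: "open V" and \<phi>: "Cp_map p \<phi> V" and b0: "b0 \<in> V"
  shows "\<exists>d>0. \<exists>L>0. \<forall>b\<in>ball b0 d. \<forall>c\<in>ball b0 d. \<forall>k\<le>p. norm (\<phi> b - \<phi> c) ^ k \<le> L * norm (b - c) ^ k"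
proof (cases p)
  case 0
  then show ?thesis by (intro exI[of _ "1::real"] conjI) auto
next
  case (Suc q)
  then obtain d L where d: "d > 0" and L: "L \<ge> 1"
    and lip: "\<And>b c. b \<in> ball b0 d \<Longrightarrow> c \<in> ball b0 d \<Longrightarrow> norm (\<phi> b - \<phi> c) \<le> L * norm (b - c)"
    using Cp_map_locally_Lipschitz[OF V _ b0, of q \<phi>] \<phi> by blast
  have "norm (\<phi> b - \<phi> c) ^ k \<le> L ^ p * norm (b - c) ^ k" if "b \<in> ball b0 d" "c \<in> ball b0 d" "k \<le> p" for b c k
  proof -
    have "norm (\<phi> b - \<phi> c) ^ k \<le> (L * norm (b - c)) ^ k" by (intro power_mono lip that) simp
    also have "\<dots> = L ^ k * norm (b - c) ^ k" by (rule power_mult_distrib)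
    also have "\<dots> \<le> L ^ p * norm (b - c) ^ k"
      by (intro mult_right_mono power_increasing L that) simp
    finally show ?thesis .
  qed
  then show ?thesis using d L by (intro exI[of _ d] conjI exI[of _ "L ^ p"]) auto
qed

text \<open>A component of the pushforward of degree \<open>mi_deg \<gamma>\<close> involves only
  components of \<open>\<eta>\<close> of at least that degree, and their growth bounds are strong
  enough when \<open>norm (b - c)\<close> is at most 1.\<close>

lemma Wcond_pushfwd:
  fixes \<phi> :: "real^'m::finite \<Rightarrow> real^'n::finite"
  assumes V: "open V" and \<phi>: "Cp_map p \<phi> V" and b0: "b0 \<in> V"
  shows "\<exists>d>0. \<exists>C>0. \<forall>b\<in>ball b0 d. \<forall>c\<in>ball b0 d. \<forall>\<eta>. Wcond p b c \<eta> \<longrightarrow>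
    Wcond p (\<phi> b) (\<phi> c) (\<lambda>\<gamma>. C * pushfwd p \<phi> c \<eta> \<gamma>)"
proof -
  obtain d1 L where d1: "d1 > 0" and L: "L > 0"
    and lip: "\<And>b c k. b \<in> ball b0 d1 \<Longrightarrow> c \<in> ball b0 d1 \<Longrightarrow> k \<le> p \<Longrightarrow> norm (\<phi> b - \<phi> c) ^ k \<le> L * norm (b - c) ^ k"
    using Cp_map_Lipschitz_power[OF V \<phi> b0] by blast
  obtain K where K0: "K \<ge> 0"
    and K: "eventually (\<lambda>c. \<forall>\<gamma>\<in>mons p. \<forall>\<alpha>\<in>mons p. \<bar>pull_coeff p \<phi> \<gamma> \<alpha> c\<bar> \<le> K) (nhds b0)"
    using pull_coeff_bounded[OF V \<phi> b0] by blast
  have "eventually (\<lambda>c. c \<in> V) (nhds b0)" using V b0 by (rule eventually_nhds_in_open)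
  with K have "eventually (\<lambda>c. c \<in> V \<and> (\<forall>\<gamma>\<in>mons p. \<forall>\<alpha>\<in>mons p. \<bar>pull_coeff p \<phi> \<gamma> \<alpha> c\<bar> \<le> K)) (nhds b0)"
    by eventually_elim auto
  then obtain d2 where d2: "d2 > 0" "\<And>c. dist c b0 < d2 \<Longrightarrow> c \<in> V"
    "\<And>c \<gamma> \<alpha>. dist c b0 < d2 \<Longrightarrow> \<gamma> \<in> mons p \<Longrightarrow> \<alpha> \<in> mons p \<Longrightarrow> \<bar>pull_coeff p \<phi> \<gamma> \<alpha> c\<bar> \<le> K"
    unfolding eventually_nhds_metric by blast
  \<comment> \<open>The bound \<open>1 / 2\<close> ensures \<open>norm (b - c) \<le> 1\<close>, so
    that passing from exponent \<open>p - mi_deg \<gamma>\<close> to the smaller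
    \<open>p - mi_deg \<alpha>\<close> increases the power.\<close>
  define d where "d = min (1 / 2) (min d1 d2)"
  let ?N = "real (card (mons p :: ('m \<Rightarrow> nat) set))"
  \<comment> \<open>Each of the \<open>?N\<close> summands below is at most \<open>L * K\<close>;
    the added 1 keeps the denominator positive.\<close>
  define C where "C = 1 / (?N * (L * K) + 1)"
  have NLK: "0 \<le> ?N * (L * K)" using L K0 by simp
  then have C: "C > 0" unfolding C_def by (intro divide_pos_pos) linarith+
  have "Wcond p (\<phi> b) (\<phi> c) (\<lambda>\<gamma>. C * pushfwd p \<phi> c \<eta> \<gamma>)"
    if b: "b \<in> ball b0 d" and c: "c \<in> ball b0 d" and W: "Wcond p b c \<eta>" for b c \<eta>
    unfolding Wcond_def
  proof
    fix \<gamma> :: "'n \<Rightarrow> nat" assume \<gamma>: "\<gamma> \<in> mons p"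
    have cV: "c \<in> V" using c by (intro d2) (simp add: d_def dist_commute)
    have bc1: "norm (b - c) \<le> 1"
    proof -
      have "dist b c \<le> dist b b0 + dist b0 c" by (rule dist_triangle)
      then show ?thesis using b c by (simp add: d_def dist_commute dist_norm)
    qed
    have lip': "norm (\<phi> b - \<phi> c) ^ (p - mi_deg \<gamma>) \<le> L * norm (b - c) ^ (p - mi_deg \<gamma>)"
      by (rule lip) (use b c in \<open>auto simp: d_def\<close>)
    let ?n = "norm (\<phi> b - \<phi> c) ^ (p - mi_deg \<gamma>)"
    have summand: "?n * \<bar>pull_coeff p \<phi> \<gamma> \<alpha> c * dcomp p \<eta> \<alpha> c\<bar> \<le> L * K" if \<alpha>: "\<alpha> \<in> mons p" for \<alpha>
    proof (cases "mi_deg \<alpha> < mi_deg \<gamma>")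
      case True
      then show ?thesis using pull_coeff_eq_0[OF V \<phi> cV \<gamma>] L K0 by simp
    next
      case False
      have h: "\<bar>pull_coeff p \<phi> \<gamma> \<alpha> c\<bar> \<le> K" using c by (intro d2 \<gamma> \<alpha>) (simp add: d_def dist_commute)
      have "?n \<le> L * norm (b - c) ^ (p - mi_deg \<alpha>)"
        using False L bc1 by (intro order_trans[OF lip'] mult_left_mono power_decreasing) auto
      then have "?n * \<bar>pull_coeff p \<phi> \<gamma> \<alpha> c * dcomp p \<eta> \<alpha> c\<bar>
          \<le> (L * norm (b - c) ^ (p - mi_deg \<alpha>)) * (K * \<bar>dcomp p \<eta> \<alpha> c\<bar>)"
        unfolding abs_mult using h L K0 by (intro mult_mono) auto
      also have "\<dots> = L * K * (norm (b - c) ^ (p - mi_deg \<alpha>) * \<bar>dcomp p \<eta> \<alpha> c\<bar>)" by simp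
      also have "\<dots> \<le> L * K * 1"
        using W \<alpha> L K0 by (intro mult_left_mono) (auto simp: Wcond_def)
      finally show ?thesis by simp
    qed
    have "?n * \<bar>dcomp p (pushfwd p \<phi> c \<eta>) \<gamma> (\<phi> c)\<bar> \<le> ?n * (\<Sum>\<alpha>\<in>mons p. \<bar>pull_coeff p \<phi> \<gamma> \<alpha> c * dcomp p \<eta> \<alpha> c\<bar>)"
      unfolding dcomp_pushfwd by (intro mult_left_mono sum_abs) simp
    also have "\<dots> \<le> (\<Sum>\<alpha>\<in>(mons p :: ('m \<Rightarrow> nat) set). L * K)"
      unfolding sum_distrib_left by (intro sum_mono summand)
    also have "\<dots> \<le> 1 / C" by (simp add: C_def)
    finally have *: "?n * \<bar>dcomp p (pushfwd p \<phi> c \<eta>) \<gamma> (\<phi> c)\<bar> \<le> 1 / C" .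
    have "dcomp p (\<lambda>\<gamma>. C * pushfwd p \<phi> c \<eta> \<gamma>) \<gamma> (\<phi> c) = C * dcomp p (pushfwd p \<phi> c \<eta>) \<gamma> (\<phi> c)"
      by (simp add: dcomp_def dual_apply_def sum_distrib_left mult.assoc)
    then show "?n * \<bar>dcomp p (\<lambda>\<gamma>. C * pushfwd p \<phi> c \<eta> \<gamma>) \<gamma> (\<phi> c)\<bar> \<le> 1"
      using * C by (simp add: abs_mult field_simps)
  qed
  moreover have "d > 0" using d1 d2 by (simp add: d_def)
  ultimately show ?thesis using C by blast
qed

section \<open>The bundles \<open>\<rho>\<^sup>k(\<Phi>\<^sub>0)\<close>\<close>

lemma tendsto_fun_iff: "(f \<longlongrightarrow> l) F \<longleftrightarrow> (\<forall>\<gamma>. ((\<lambda>x. f x \<gamma>) \<longlongrightarrow> l \<gamma>) F)"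
  for f :: "'a \<Rightarrow> 'b \<Rightarrow> 'c::topological_space"
  using limitin_componentwise[of "\<lambda>_. euclidean" UNIV f l F]
  by (simp add: euclidean_product_topology)

text \<open>Convergence of \<open>s i + t i\<close> is kept separate, since it is exactly what must
  be established when elements of \<open>tau\<close> are lifted.\<close>

definition approximates :: "nat \<Rightarrow> ((real^'d) \<times> (('d::finite \<Rightarrow> nat) \<Rightarrow> real) \<times> real) set \<Rightarrow> real^'d
    \<Rightarrow> (nat \<Rightarrow> real^'d) \<Rightarrow> (nat \<Rightarrow> ('d \<Rightarrow> nat) \<Rightarrow> real) \<Rightarrow> (nat \<Rightarrow> real)
    \<Rightarrow> (nat \<Rightarrow> real^'d) \<Rightarrow> (nat \<Rightarrow> ('d \<Rightarrow> nat) \<Rightarrow> real) \<Rightarrow> (nat \<Rightarrow> real) \<Rightarrow> (('d \<Rightarrow> nat) \<Rightarrow> real) \<Rightarrow> bool" where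
  "approximates p \<Phi> a b \<xi> s c \<eta> t \<zeta> \<longleftrightarrow>
     (\<forall>i. (b i, \<xi> i, s i) \<in> \<Phi>) \<and> (\<forall>i. (c i, \<eta> i, t i) \<in> \<Phi>) \<and> (\<forall>i. Wcond p (b i) (c i) (\<eta> i)) \<and>
     b \<longlonglongrightarrow> a \<and> c \<longlonglongrightarrow> a \<and> (\<forall>\<gamma>. (\<lambda>i. \<xi> i \<gamma> + \<eta> i \<gamma>) \<longlonglongrightarrow> \<zeta> \<gamma>)"

lemma approximatesD:
  assumes "approximates p \<Phi> a b \<xi> s c \<eta> t \<zeta>"
  shows "(b i, \<xi> i, s i) \<in> \<Phi>" "(c i, \<eta> i, t i) \<in> \<Phi>" "Wcond p (b i) (c i) (\<eta> i)"
    "b \<longlonglongrightarrow> a" "c \<longlonglongrightarrow> a" "(\<lambda>i. \<xi> i \<gamma> + \<eta> i \<gamma>) \<longlonglongrightarrow> \<zeta> \<gamma>"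
  using assms by (simp_all add: approximates_def)

text \<open>Sequences describe the closure because the fibre space, a countable product of lines, is
  first countable.\<close>

lemma primePhiE:
  assumes "(a, \<zeta>, l) \<in> primePhi p \<Phi>"
  obtains b \<xi> s c \<eta> t where "approximates p \<Phi> a b \<xi> s c \<eta> t \<zeta>" "(\<lambda>i. s i + t i) \<longlonglongrightarrow> l"
proof -
  have "(a, a, \<zeta>, l) \<in> closure (DeltaPhi p \<Phi>)" using assms by (simp add: primePhi_def)
  then obtain x where x: "\<And>i. x i \<in> DeltaPhi p \<Phi>" "x \<longlonglongrightarrow> (a, a, \<zeta>, l)"
    unfolding closure_sequential by blast
  define P where "P z b c \<xi> \<eta> s t \<longleftrightarrow> z = (b, c, (\<lambda>\<gamma>. \<xi> \<gamma> + \<eta> \<gamma>), s + t) \<and>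
      (b, \<xi>, s) \<in> \<Phi> \<and> (c, \<eta>, t) \<in> \<Phi> \<and> Wcond p b c \<eta>" for z b c \<xi> \<eta> s t
  have "\<exists>b c \<xi> \<eta> s t. P (x i) b c \<xi> \<eta> s t" for i
    using x(1)[of i] unfolding DeltaPhi_def mem_Collect_eq P_def by (elim exE) (intro exI, assumption)
  then obtain b c \<xi> \<eta> s t where "\<And>i. P (x i) (b i) (c i) (\<xi> i) (\<eta> i) (s i) (t i)"
    by metis
  then have q: "x i = (b i, c i, (\<lambda>\<gamma>. \<xi> i \<gamma> + \<eta> i \<gamma>), s i + t i)"
      "(b i, \<xi> i, s i) \<in> \<Phi>" "(c i, \<eta> i, t i) \<in> \<Phi>" "Wcond p (b i) (c i) (\<eta> i)" for i
    unfolding P_def by blast+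
  have "x = (\<lambda>i. (b i, c i, (\<lambda>\<gamma>. \<xi> i \<gamma> + \<eta> i \<gamma>), s i + t i))" using q(1) by (rule ext)
  then have lim: "(\<lambda>i. (b i, c i, (\<lambda>\<gamma>. \<xi> i \<gamma> + \<eta> i \<gamma>), s i + t i)) \<longlonglongrightarrow> (a, a, \<zeta>, l)"
    using x(2) by simp
  have "b \<longlonglongrightarrow> a" using tendsto_fst[OF lim] by simp
  moreover have "c \<longlonglongrightarrow> a" using tendsto_fst[OF tendsto_snd[OF lim]] by simp
  moreover have "(\<lambda>i. \<xi> i \<gamma> + \<eta> i \<gamma>) \<longlonglongrightarrow> \<zeta> \<gamma>" for \<gamma>
    using tendsto_fst[OF tendsto_snd[OF tendsto_snd[OF lim]]] by (simp add: tendsto_fun_iff)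
  moreover have "(\<lambda>i. s i + t i) \<longlonglongrightarrow> l" using tendsto_snd[OF tendsto_snd[OF tendsto_snd[OF lim]]] by simp
  ultimately show ?thesis using q(2-4) by (intro that[of b \<xi> s c \<eta> t]) (simp_all add: approximates_def)
qed

lemma primePhiI:
  assumes "approximates p \<Phi> a b \<xi> s c \<eta> t \<zeta>" "(\<lambda>i. s i + t i) \<longlonglongrightarrow> l"
  shows "(a, \<zeta>, l) \<in> primePhi p \<Phi>"
proof -
  note m = approximatesD[OF assms(1)]
  have "(\<lambda>i. (\<lambda>\<gamma>. \<xi> i \<gamma> + \<eta> i \<gamma>)) \<longlonglongrightarrow> \<zeta>" using m(6) by (simp add: tendsto_fun_iff)
  then have lim: "(\<lambda>i. (b i, c i, (\<lambda>\<gamma>. \<xi> i \<gamma> + \<eta> i \<gamma>), s i + t i)) \<longlonglongrightarrow> (a, a, \<zeta>, l)"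
    by (intro tendsto_Pair m(4,5) assms(2))
  have "(b i, c i, (\<lambda>\<gamma>. \<xi> i \<gamma> + \<eta> i \<gamma>), s i + t i) \<in> DeltaPhi p \<Phi>" for i
    unfolding DeltaPhi_def mem_Collect_eq using m(1-3)[of i] by (intro exI conjI) (rule refl)
  with lim show ?thesis
    unfolding primePhi_def closure_sequential mem_Collect_eq case_prod_conv by (intro exI conjI allI)
qed

lemma primePhiI_eventually:
  assumes mem: "eventually (\<lambda>i. (b i, \<xi> i, s i) \<in> \<Phi> \<and> (c i, \<eta> i, t i) \<in> \<Phi> \<and> Wcond p (b i) (c i) (\<eta> i)) sequentially"
    and lim: "b \<longlonglongrightarrow> a" "c \<longlonglongrightarrow> a" "\<And>\<gamma>. (\<lambda>i. \<xi> i \<gamma> + \<eta> i \<gamma>) \<longlonglongrightarrow> \<zeta> \<gamma>" "(\<lambda>i. s i + t i) \<longlonglongrightarrow> l"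
  shows "(a, \<zeta>, l) \<in> primePhi p \<Phi>"
proof -
  obtain N where N: "\<And>i. i \<ge> N \<Longrightarrow> (b i, \<xi> i, s i) \<in> \<Phi> \<and> (c i, \<eta> i, t i) \<in> \<Phi> \<and> Wcond p (b i) (c i) (\<eta> i)"
    using mem unfolding eventually_sequentially by blast
  have "approximates p \<Phi> a (\<lambda>i. b (i + N)) (\<lambda>i. \<xi> (i + N)) (\<lambda>i. s (i + N)) (\<lambda>i. c (i + N)) (\<lambda>i. \<eta> (i + N)) (\<lambda>i. t (i + N)) \<zeta>"
    unfolding approximates_def
    using N LIMSEQ_ignore_initial_segment[OF lim(1), of N] LIMSEQ_ignore_initial_segment[OF lim(2), of N]
      LIMSEQ_ignore_initial_segment[OF lim(3), of N] by simp
  then show ?thesis by (rule primePhiI) (rule LIMSEQ_ignore_initial_segment[OF lim(4), of N])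
qed

section \<open>Spans, linear bundles and basic properties of \<open>rhoPhi\<close>\<close>

lemma fspan2_induct:
  assumes "(\<xi>, l) \<in> fspan2 S" and zero: "P (\<lambda>_. 0) 0"
    and step: "\<And>c \<xi> l \<eta> m. (\<xi>, l) \<in> S \<Longrightarrow> P \<eta> m \<Longrightarrow> P (\<lambda>\<gamma>. c * \<xi> \<gamma> + \<eta> \<gamma>) (c * l + m)"
  shows "P \<xi> l"
proof -
  obtain F c where F: "finite F" "F \<subseteq> S"
    and eq: "\<xi> = (\<lambda>\<gamma>. \<Sum>v\<in>F. c v * fst v \<gamma>)" "l = (\<Sum>v\<in>F. c v * snd v)"
    using assms(1) by (auto simp: fspan2_def)
  have "P (\<lambda>\<gamma>. \<Sum>v\<in>F. c v * fst v \<gamma>) (\<Sum>v\<in>F. c v * snd v)"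
    using F
  proof (induction F rule: finite_induct)
    case (insert v F)
    have "(fst v, snd v) \<in> S" using insert.prems by simp
    from step[OF this insert.IH, of "c v"] show ?case using insert.hyps insert.prems by simp
  qed (simp add: zero)
  then show ?thesis using eq by simp
qed

lemma fspan2_base: "(\<xi>, l) \<in> S \<Longrightarrow> (\<xi>, l) \<in> fspan2 S"
  unfolding fspan2_def mem_Collect_eq case_prod_conv
  by (rule exI[of _ "{(\<xi>, l)}"], rule exI[of _ "\<lambda>_. 1"]) simp

lemma fspan2_zero: "(\<lambda>_. 0, 0) \<in> fspan2 S"
  unfolding fspan2_def mem_Collect_eq case_prod_conv by (rule exI[of _ "{}"]) simp

lemma fspan2_comb:
  assumes "(\<xi>, l) \<in> fspan2 S" "(\<eta>, m) \<in> fspan2 S"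
  shows "(\<lambda>\<gamma>. c * \<xi> \<gamma> + \<eta> \<gamma>, c * l + m) \<in> fspan2 S"
proof -
  obtain F d where F: "finite F" "F \<subseteq> S" "\<xi> = (\<lambda>\<gamma>. \<Sum>v\<in>F. d v * fst v \<gamma>)" "l = (\<Sum>v\<in>F. d v * snd v)"
    using assms(1) by (auto simp: fspan2_def)
  obtain G e where G: "finite G" "G \<subseteq> S" "\<eta> = (\<lambda>\<gamma>. \<Sum>v\<in>G. e v * fst v \<gamma>)" "m = (\<Sum>v\<in>G. e v * snd v)"
    using assms(2) by (auto simp: fspan2_def)
  define k where "k = (\<lambda>v. c * (if v \<in> F then d v else 0) + (if v \<in> G then e v else 0))"
  have sum: "(\<Sum>v\<in>F \<union> G. k v * u v) = c * (\<Sum>v\<in>F. d v * u v) + (\<Sum>v\<in>G. e v * u v)" for u :: "_ \<Rightarrow> real"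
  proof -
    have "(\<Sum>v\<in>F \<union> G. k v * u v) = (\<Sum>v\<in>F \<union> G. c * ((if v \<in> F then d v else 0) * u v)) + (\<Sum>v\<in>F \<union> G. (if v \<in> G then e v else 0) * u v)"
      unfolding sum.distrib[symmetric] by (rule sum.cong) (auto simp: k_def algebra_simps)
    also have "(\<Sum>v\<in>F \<union> G. c * ((if v \<in> F then d v else 0) * u v)) = (\<Sum>v\<in>F. c * (d v * u v))"
      by (rule sum.mono_neutral_cong_right) (use F G in auto)
    also have "(\<Sum>v\<in>F \<union> G. (if v \<in> G then e v else 0) * u v) = (\<Sum>v\<in>G. e v * u v)"
      by (rule sum.mono_neutral_cong_right) (use F G in auto)
    finally show ?thesis by (simp add: sum_distrib_left)
  qed
  have "(\<lambda>\<gamma>. c * \<xi> \<gamma> + \<eta> \<gamma>) = (\<lambda>\<gamma>. \<Sum>v\<in>F \<union> G. k v * fst v \<gamma>)" "c * l + m = (\<Sum>v\<in>F \<union> G. k v * snd v)"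
    unfolding F(3,4) G(3,4) sum by (rule refl)+
  moreover have "finite (F \<union> G)" "F \<union> G \<subseteq> S" using F G by auto
  ultimately show ?thesis unfolding fspan2_def by blast
qed

definition lin_bundle :: "nat \<Rightarrow> (real^'d) set \<Rightarrow> ((real^'d) \<times> (('d::finite \<Rightarrow> nat) \<Rightarrow> real) \<times> real) set \<Rightarrow> bool" where
  "lin_bundle p Z \<Phi> \<longleftrightarrow> (\<forall>a \<xi> l. (a, \<xi>, l) \<in> \<Phi> \<longrightarrow> a \<in> Z \<and> \<xi> \<in> Pp p) \<and> (\<forall>a\<in>Z. (a, (\<lambda>_. 0), 0) \<in> \<Phi>) \<and>
    (\<forall>a \<xi> l \<eta> m c. (a, \<xi>, l) \<in> \<Phi> \<longrightarrow> (a, \<eta>, m) \<in> \<Phi> \<longrightarrow> (a, (\<lambda>\<gamma>. c * \<xi> \<gamma> + \<eta> \<gamma>), c * l + m) \<in> \<Phi>)"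

lemma bundle_baseD: "lin_bundle p Z \<Phi> \<Longrightarrow> (a, \<xi>, l) \<in> \<Phi> \<Longrightarrow> a \<in> Z"
  by (auto simp: lin_bundle_def)

lemma bundle_PpD: "lin_bundle p Z \<Phi> \<Longrightarrow> (a, \<xi>, l) \<in> \<Phi> \<Longrightarrow> \<xi> \<in> Pp p"
  by (auto simp: lin_bundle_def)

lemma bundle_zero: "lin_bundle p Z \<Phi> \<Longrightarrow> a \<in> Z \<Longrightarrow> (a, (\<lambda>_. 0), 0) \<in> \<Phi>"
  by (auto simp: lin_bundle_def)

lemma bundle_comb: "lin_bundle p Z \<Phi> \<Longrightarrow> (a, \<xi>, l) \<in> \<Phi> \<Longrightarrow> (a, \<eta>, m) \<in> \<Phi> \<Longrightarrow> (a, (\<lambda>\<gamma>. c * \<xi> \<gamma> + \<eta> \<gamma>), c * l + m) \<in> \<Phi>"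
  by (auto simp: lin_bundle_def)

lemma bundle_scale: "lin_bundle p Z \<Phi> \<Longrightarrow> (a, \<xi>, l) \<in> \<Phi> \<Longrightarrow> (a, (\<lambda>\<gamma>. c * \<xi> \<gamma>), c * l) \<in> \<Phi>"
  using bundle_comb[of p Z \<Phi> a \<xi> l "\<lambda>_. 0" 0 c] bundle_zero[of p Z \<Phi> a] bundle_baseD[of p Z \<Phi> a \<xi> l] by simp

lemma rhoPhi_prime: "a \<in> Z \<Longrightarrow> (a, \<xi>, l) \<in> primePhi p \<Phi> \<Longrightarrow> (a, \<xi>, l) \<in> rhoPhi p Z \<Phi>"
  unfolding rhoPhi_def by (auto intro: fspan2_base)

lemma rhoPhi_baseD: "(a, \<xi>, l) \<in> rhoPhi p Z \<Phi> \<Longrightarrow> a \<in> Z"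
  by (simp add: rhoPhi_def)

lemma rhoPhi_zero: "a \<in> Z \<Longrightarrow> (a, (\<lambda>_. 0), 0) \<in> rhoPhi p Z \<Phi>"
  by (simp add: rhoPhi_def fspan2_zero)

lemma rhoPhi_comb:
  "(a, \<xi>, l) \<in> rhoPhi p Z \<Phi> \<Longrightarrow> (a, \<eta>, m) \<in> rhoPhi p Z \<Phi> \<Longrightarrow> (a, (\<lambda>\<gamma>. c * \<xi> \<gamma> + \<eta> \<gamma>), c * l + m) \<in> rhoPhi p Z \<Phi>"
  by (simp add: rhoPhi_def fspan2_comb)

lemma rhoPhi_induct:
  assumes "(a, \<xi>, l) \<in> rhoPhi p Z \<Phi>" and "P (\<lambda>_. 0) 0"
    and "\<And>c \<xi> l \<eta> m. (a, \<xi>, l) \<in> primePhi p \<Phi> \<Longrightarrow> P \<eta> m \<Longrightarrow> P (\<lambda>\<gamma>. c * \<xi> \<gamma> + \<eta> \<gamma>) (c * l + m)"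
  shows "P \<xi> l"
proof -
  have "(\<xi>, l) \<in> fspan2 {v. (a, v) \<in> primePhi p \<Phi>}" using assms(1) by (simp add: rhoPhi_def)
  then show ?thesis by (rule fspan2_induct) (use assms(2,3) in auto)
qed

lemma bundle_rhoPhi:
  assumes "lin_bundle p Z \<Phi>"
  shows "lin_bundle p Z (rhoPhi p Z \<Phi>)"
proof -
  have prime: "\<xi> \<in> Pp p" if pr: "(a, \<xi>, l) \<in> primePhi p \<Phi>" for a \<xi> l
  proof -
    obtain b \<zeta> s c \<eta> t where ap: "approximates p \<Phi> a b \<zeta> s c \<eta> t \<xi>" and "(\<lambda>i. s i + t i) \<longlonglongrightarrow> l"
      using pr by (rule primePhiE)
    note mem = approximatesD(1,2)[OF ap] and lim = approximatesD(6)[OF ap]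
    have "\<xi> \<gamma> = 0" if "\<gamma> \<notin> mons p" for \<gamma>
    proof -
      have "\<zeta> i \<gamma> = 0" "\<eta> i \<gamma> = 0" for i
        using bundle_PpD[OF assms mem(1)[of i]] bundle_PpD[OF assms mem(2)[of i]] that by (auto simp: Pp_def)
      then show ?thesis using lim[of \<gamma>] by (simp add: LIMSEQ_const_iff)
    qed
    then show ?thesis by (simp add: Pp_def)
  qed
  have "\<xi> \<in> Pp p" if "(a, \<xi>, l) \<in> rhoPhi p Z \<Phi>" for a \<xi> l
    using that
  proof (rule rhoPhi_induct)
    show "(\<lambda>_. 0) \<in> Pp p" by (simp add: Pp_def)
    show "(\<lambda>\<gamma>. c * \<xi> \<gamma> + \<eta> \<gamma>) \<in> Pp p" if "(a, \<xi>, l) \<in> primePhi p \<Phi>" "\<eta> \<in> Pp p" for c \<xi> l \<eta>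
      using prime[OF that(1)] that(2) by (simp add: Pp_def)
  qed
  then show ?thesis unfolding lin_bundle_def
    by (intro conjI allI impI ballI rhoPhi_zero rhoPhi_comb) (auto dest: rhoPhi_baseD)
qed

lemma Wcond_zero: "Wcond p a b (\<lambda>_. 0)"
  by (simp add: Wcond_def dcomp_def dual_apply_def)

lemma Wcond_scale:
  assumes "Wcond p a b \<eta>" "\<bar>c\<bar> \<le> 1"
  shows "Wcond p a b (\<lambda>\<gamma>. c * \<eta> \<gamma>)"
  unfolding Wcond_def
proof
  fix \<gamma> :: "'a \<Rightarrow> nat" assume \<gamma>: "\<gamma> \<in> mons p"
  have eq: "dcomp p (\<lambda>\<gamma>. c * \<eta> \<gamma>) \<gamma> b = c * dcomp p \<eta> \<gamma> b"
    by (simp add: dcomp_def dual_apply_def sum_distrib_left mult.assoc)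
  have "norm (a - b) ^ (p - mi_deg \<gamma>) * \<bar>dcomp p (\<lambda>\<gamma>. c * \<eta> \<gamma>) \<gamma> b\<bar>
      = \<bar>c\<bar> * (norm (a - b) ^ (p - mi_deg \<gamma>) * \<bar>dcomp p \<eta> \<gamma> b\<bar>)"
    unfolding eq by (simp add: abs_mult)
  also have "\<dots> \<le> 1 * 1"
    using assms \<gamma> by (intro mult_mono) (auto simp: Wcond_def)
  finally show "norm (a - b) ^ (p - mi_deg \<gamma>) * \<bar>dcomp p (\<lambda>\<gamma>. c * \<eta> \<gamma>) \<gamma> b\<bar> \<le> 1" by simp
qed

text \<open>Take the second summand to be zero, so the growth condition is trivial. This yields the
  limit hypothesis of \<open>fibres_stabilize\<close> and, for constant sequences, monotonicity of
  \<open>rhoPhi\<close>.\<close>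

lemma rhoPhi_limit:
  assumes \<Phi>: "lin_bundle p Z \<Phi>" and a: "a \<in> Z" and x: "\<And>i. (x i, v i, s i) \<in> \<Phi>"
    and lim: "x \<longlonglongrightarrow> a" "\<And>\<gamma>. (\<lambda>i. v i \<gamma>) \<longlonglongrightarrow> w \<gamma>" "s \<longlonglongrightarrow> l"
  shows "(a, w, l) \<in> rhoPhi p Z \<Phi>"
proof (rule rhoPhi_prime[OF a])
  have zero: "(x i, (\<lambda>_. 0), 0) \<in> \<Phi>" for i by (rule bundle_zero[OF \<Phi> bundle_baseD[OF \<Phi> x]])
  show "(a, w, l) \<in> primePhi p \<Phi>"
    by (rule primePhiI_eventually[where b = x and \<xi> = v and s = s and c = x and \<eta> = "\<lambda>_ _. 0" and t = "\<lambda>_. 0"])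
      (use x zero lim in \<open>auto simp: Wcond_zero\<close>)
qed

lemma rhoPhi_mono: "lin_bundle p Z \<Phi> \<Longrightarrow> \<Phi> \<subseteq> rhoPhi p Z \<Phi>"
proof
  fix x assume \<Phi>: "lin_bundle p Z \<Phi>" and x: "x \<in> \<Phi>"
  obtain a \<xi> l where [simp]: "x = (a, \<xi>, l)" by (cases x)
  show "x \<in> rhoPhi p Z \<Phi>"
    using rhoPhi_limit[OF \<Phi>, of a "\<lambda>_. a" "\<lambda>_. \<xi>" "\<lambda>_. l" \<xi> l] bundle_baseD[OF \<Phi>] x by simp
qed

text \<open>Both base points of an approximating sequence converge to \<open>a\<close>, so they
  eventually lie in \<open>N\<close>. This yields the locality hypothesis of
  \<open>fibres_stabilize\<close>.\<close>

lemma rhoPhi_local: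
  assumes \<Phi>: "lin_bundle p Z \<Phi>" and N: "open N" "a \<in> N"
    and sub: "\<And>x \<xi> l. x \<in> N \<inter> Z \<Longrightarrow> (x, \<xi>, l) \<in> \<Phi> \<Longrightarrow> (x, \<xi>, l) \<in> \<Psi>"
    and mem: "(a, \<xi>, l) \<in> rhoPhi p Z \<Phi>"
  shows "(a, \<xi>, l) \<in> rhoPhi p Z \<Psi>"
proof -
  have a: "a \<in> Z" using mem by (rule rhoPhi_baseD)
  have prime: "(a, \<xi>, l) \<in> rhoPhi p Z \<Psi>" if "(a, \<xi>, l) \<in> primePhi p \<Phi>" for \<xi> l
  proof -
    obtain b \<zeta> s c \<eta> t where ap: "approximates p \<Phi> a b \<zeta> s c \<eta> t \<xi>" and l: "(\<lambda>i. s i + t i) \<longlonglongrightarrow> l"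
      using \<open>(a, \<xi>, l) \<in> primePhi p \<Phi>\<close> by (rule primePhiE)
    note m = approximatesD(1-3)[OF ap] and lim = approximatesD(4-6)[OF ap] l
    have "eventually (\<lambda>i. b i \<in> N) sequentially" "eventually (\<lambda>i. c i \<in> N) sequentially"
      using lim N topological_tendstoD by blast+
    then have "eventually (\<lambda>i. (b i, \<zeta> i, s i) \<in> \<Psi> \<and> (c i, \<eta> i, t i) \<in> \<Psi> \<and> Wcond p (b i) (c i) (\<eta> i)) sequentially"
    proof eventually_elim
      case (elim i)
      then show ?case using m[of i] sub bundle_baseD[OF \<Phi>] by blast
    qed
    then show ?thesis by (intro rhoPhi_prime[OF a] primePhiI_eventually[OF _ lim])
  qed
  show ?thesis
    using mem by (rule rhoPhi_induct) (simp_all add: rhoPhi_zero[OF a] rhoPhi_comb prime)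
qed

section \<open>The iterates and their stabilization\<close>

definition nabla_iter :: "nat \<Rightarrow> (real^'d) set \<Rightarrow> (real^'d \<Rightarrow> real) \<Rightarrow> nat
      \<Rightarrow> ((real^'d) \<times> (('d::finite \<Rightarrow> nat) \<Rightarrow> real) \<times> real) set" where
  "nabla_iter p Z h k = (rhoPhi p Z ^^ k) (Phi0 p Z h)"

lemma nabla_iter_0: "nabla_iter p Z h 0 = Phi0 p Z h" and nabla_iter_Suc: "nabla_iter p Z h (Suc k) = rhoPhi p Z (nabla_iter p Z h k)"
  by (simp_all add: nabla_iter_def)

lemma bundle_Phi0: "lin_bundle p Z (Phi0 p Z h)"
  unfolding lin_bundle_def
proof (intro conjI allI impI ballI)
  fix a \<xi> l \<eta> m c assume "(a, \<xi>, l) \<in> Phi0 p Z h" "(a, \<eta>, m) \<in> Phi0 p Z h"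
  then obtain s t where "a \<in> Z" "\<xi> = (\<lambda>\<gamma>. s * delta p a \<gamma>)" "l = s * h a" "\<eta> = (\<lambda>\<gamma>. t * delta p a \<gamma>)" "m = t * h a"
    by (auto simp: Phi0_def)
  then show "(a, (\<lambda>\<gamma>. c * \<xi> \<gamma> + \<eta> \<gamma>), c * l + m) \<in> Phi0 p Z h"
    unfolding Phi0_def by (auto simp: algebra_simps intro!: exI[of _ "c * s + t"])
next
  fix a assume "a \<in> Z"
  then show "(a, (\<lambda>_. 0), 0) \<in> Phi0 p Z h" by (auto simp: Phi0_def intro!: exI[of _ 0])
qed (auto simp: Phi0_def Pp_def delta_def)

lemma bundle_nabla_iter: "lin_bundle p Z (nabla_iter p Z h k)"
  by (induction k) (auto simp: nabla_iter_0 nabla_iter_Suc bundle_Phi0 bundle_rhoPhi)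

lemma nabla_iter_mono: "k \<le> k' \<Longrightarrow> nabla_iter p Z h k \<subseteq> nabla_iter p Z h k'"
  by (rule lift_Suc_mono_le[of "nabla_iter p Z h"]) (simp_all add: nabla_iter_Suc rhoPhi_mono bundle_nabla_iter)

text \<open>A pair \<open>(\<xi>, l)\<close> is read as the vector with components \<open>\<xi> \<gamma>\<close> at \<open>Some \<gamma>\<close> and \<open>l\<close> at \<open>None\<close>.\<close>

definition fibre_vecs :: "('z \<times> ('b \<Rightarrow> real) \<times> real) set \<Rightarrow> 'z \<Rightarrow> ('b option \<Rightarrow> real) set" where
  "fibre_vecs \<Phi> a = {v. (a, (\<lambda>\<gamma>. v (Some \<gamma>)), v None) \<in> \<Phi>}"

text \<open>The coordinate set \<open>M\<close> is a parameter so that the same argument covers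
  \<open>nabla\<close>, with dimension r + 1, and the case of the zero function, with dimension
  r.\<close>

lemma nabla_iter_stabilizes:
  fixes Z :: "(real^'d::finite) set"
  assumes M: "finite M"
    and supp: "\<And>k x \<xi> \<gamma>. x \<in> Z \<Longrightarrow> \<xi> \<in> fibre_vecs (nabla_iter p Z h k) x \<Longrightarrow> \<gamma> \<notin> M \<Longrightarrow> \<xi> \<gamma> = 0"
    and k: "2 * card M \<le> k"
  shows "nabla_iter p Z h k = nabla_iter p Z h (2 * card M)"
proof -
  note B = bundle_nabla_iter[of p Z h]
  have fibeq: "fibre_vecs (nabla_iter p Z h k) a = fibre_vecs (nabla_iter p Z h (2 * card M)) a" if "a \<in> Z" for a
  proof (rule fibres_stabilize[where M = M and Z = Z and E = "\<lambda>k. fibre_vecs (nabla_iter p Z h k)"])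
    show "fun_subspace (fibre_vecs (nabla_iter p Z h k) x)" if "x \<in> Z" for k x
      using bundle_zero[OF B that] bundle_comb[OF B] by (simp add: fun_subspace_def fibre_vecs_def)
    show "fibre_vecs (nabla_iter p Z h k) x \<subseteq> fibre_vecs (nabla_iter p Z h (Suc k)) x" for k x
      using nabla_iter_mono[of k "Suc k" p Z h] by (auto simp: fibre_vecs_def)
    show "w \<in> fibre_vecs (nabla_iter p Z h (Suc k)) a"
      if "a \<in> Z" "\<And>i. x i \<in> Z" "x \<longlonglongrightarrow> a" "\<And>i. v i \<in> fibre_vecs (nabla_iter p Z h k) (x i)" "\<And>\<gamma>. (\<lambda>i. v i \<gamma>) \<longlonglongrightarrow> w \<gamma>"
      for k a x v w
      using rhoPhi_limit[OF B[of k] that(1), of x "\<lambda>i \<gamma>. v i (Some \<gamma>)" "\<lambda>i. v i None" "\<lambda>\<gamma>. w (Some \<gamma>)" "w None"] that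
      by (simp add: fibre_vecs_def nabla_iter_Suc)
    show "fibre_vecs (nabla_iter p Z h (Suc k)) a = fibre_vecs (nabla_iter p Z h (Suc (Suc k))) a"
      if N: "open N" "a \<in> N \<inter> Z" "\<And>x. x \<in> N \<inter> Z \<Longrightarrow> fibre_vecs (nabla_iter p Z h k) x = fibre_vecs (nabla_iter p Z h (Suc k)) x" for k N a
    proof -
      have eq: "(x, \<xi>, l) \<in> nabla_iter p Z h k \<longleftrightarrow> (x, \<xi>, l) \<in> nabla_iter p Z h (Suc k)" if "x \<in> N \<inter> Z" for x \<xi> l
      proof -
        have "case_option l \<xi> \<in> fibre_vecs (nabla_iter p Z h k) x \<longleftrightarrow> case_option l \<xi> \<in> fibre_vecs (nabla_iter p Z h (Suc k)) x"
          using N(3)[OF that] by simp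
        then show ?thesis by (simp add: fibre_vecs_def)
      qed
      show ?thesis
        using rhoPhi_local[OF B[of k] N(1), of a "nabla_iter p Z h (Suc k)"]
          rhoPhi_local[OF B[of "Suc k"] N(1), of a "nabla_iter p Z h k"] N(2) eq
        by (auto simp: fibre_vecs_def nabla_iter_Suc[of p Z h "Suc k"] nabla_iter_Suc[of p Z h k])
    qed
    show "\<exists>v\<in>fibre_vecs (nabla_iter p Z h 0) x. v \<noteq> (\<lambda>_. 0)" if "x \<in> Z" for x
    proof -
      let ?v = "case_option (h x) (delta p x)"
      have "?v \<in> fibre_vecs (nabla_iter p Z h 0) x"
        using that by (auto simp: fibre_vecs_def nabla_iter_0 Phi0_def intro!: exI[of _ 1])
      moreover have "?v (Some (\<lambda>_. 0)) = 1" by (simp add: delta_def mons_def)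
      ultimately show ?thesis by (metis zero_neq_one)
    qed
  qed (use M supp k that in auto)
  have "(a, \<xi>, l) \<in> nabla_iter p Z h k \<longleftrightarrow> (a, \<xi>, l) \<in> nabla_iter p Z h (2 * card M)" for a \<xi> l
  proof (cases "a \<in> Z")
    case True
    have "case_option l \<xi> \<in> fibre_vecs (nabla_iter p Z h k) a \<longleftrightarrow> case_option l \<xi> \<in> fibre_vecs (nabla_iter p Z h (2 * card M)) a"
      using fibeq[OF True] by simp
    then show ?thesis by (simp add: fibre_vecs_def)
  next
    case False
    then show ?thesis using bundle_baseD[OF B] by blast
  qed
  then show ?thesis by auto
qed

lemma nabla_iter_nabla: "2 * (dimP p TYPE('d::finite) + 1) \<le> k \<Longrightarrow> nabla_iter p Z h k = nabla p Z h"
  for Z :: "(real^'d) set"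
proof -
  assume k: "2 * (dimP p TYPE('d) + 1) \<le> k"
  let ?M = "insert None (Some ` (mons p :: ('d \<Rightarrow> nat) set))"
  have card: "card ?M = dimP p TYPE('d) + 1" by (simp add: dimP_def card_image)
  have "nabla_iter p Z h k = nabla_iter p Z h (2 * card ?M)"
  proof (rule nabla_iter_stabilizes)
    show "\<xi> \<gamma> = 0" if "\<xi> \<in> fibre_vecs (nabla_iter p Z h k) x" "\<gamma> \<notin> ?M" for k x \<xi> \<gamma>
      using that bundle_PpD[OF bundle_nabla_iter] by (cases \<gamma>) (fastforce simp: fibre_vecs_def Pp_def)+
  qed (use k card in auto)
  then show ?thesis unfolding card by (simp add: nabla_iter_def nabla_def)
qed

lemma nabla_iter_subset_nabla: "nabla_iter p Z h k \<subseteq> nabla p Z h" for Z :: "(real^'d::finite) set"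
  using nabla_iter_mono[of k "max k (2 * (dimP p TYPE('d) + 1))" p Z h] nabla_iter_nabla[of p "max k (2 * (dimP p TYPE('d) + 1))" Z h]
  by simp

lemma rhoPhi_nabla: "rhoPhi p Z (nabla p Z h) = nabla p Z h" for Z :: "(real^'d::finite) set"
  using nabla_iter_nabla[of p "Suc (2 * (dimP p TYPE('d) + 1))" Z h] nabla_iter_nabla[of p "2 * (dimP p TYPE('d) + 1)" Z h]
  by (simp add: nabla_iter_Suc)

lemma bundle_nabla: "lin_bundle p Z (nabla p Z h)" for Z :: "(real^'d::finite) set"
  using bundle_nabla_iter[of p Z h "2 * (dimP p TYPE('d) + 1)"] by (simp add: nabla_iter_nabla)

section \<open>The paratangent bundle as the case of the zero function\<close>

lemma nabla_iter_zero_snd: "(a, \<xi>, l) \<in> nabla_iter p Z (\<lambda>_. 0) k \<Longrightarrow> l = 0"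
proof (induction k arbitrary: a \<xi> l)
  case 0
  then show ?case by (auto simp: nabla_iter_0 Phi0_def)
next
  case (Suc k)
  have prime: "l = 0" if "(a, \<xi>, l) \<in> primePhi p (nabla_iter p Z (\<lambda>_. 0) k)" for \<xi> l
  proof -
    obtain b \<zeta> s c \<eta> t where ap: "approximates p (nabla_iter p Z (\<lambda>_. 0) k) a b \<zeta> s c \<eta> t \<xi>"
      and l: "(\<lambda>i. s i + t i) \<longlonglongrightarrow> l" using \<open>(a, \<xi>, l) \<in> primePhi _ _\<close> by (rule primePhiE)
    have "s i = 0" "t i = 0" for i using Suc.IH[OF approximatesD(1)[OF ap]] Suc.IH[OF approximatesD(2)[OF ap]] by auto
    then show ?thesis using l by (simp add: LIMSEQ_const_iff)
  qed
  show ?case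
    using Suc.prems unfolding nabla_iter_Suc by (rule rhoPhi_induct) (use prime in auto)
qed

lemma nabla_iter_zero_stable: "2 * dimP p TYPE('d::finite) \<le> k \<Longrightarrow>
    nabla_iter p Z (\<lambda>_. 0) k = nabla_iter p Z (\<lambda>_. 0) (2 * dimP p TYPE('d))"
  for Z :: "(real^'d) set"
proof -
  assume k: "2 * dimP p TYPE('d) \<le> k"
  let ?M = "Some ` (mons p :: ('d \<Rightarrow> nat) set)"
  have card: "card ?M = dimP p TYPE('d)" by (simp add: dimP_def card_image)
  have "nabla_iter p Z (\<lambda>_. 0) k = nabla_iter p Z (\<lambda>_. 0) (2 * card ?M)"
  proof (rule nabla_iter_stabilizes)
    show "\<xi> \<gamma> = 0" if "\<xi> \<in> fibre_vecs (nabla_iter p Z (\<lambda>_. 0) k) x" "\<gamma> \<notin> ?M" for k x \<xi> \<gamma>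
      using that bundle_PpD[OF bundle_nabla_iter] nabla_iter_zero_snd by (cases \<gamma>) (fastforce simp: fibre_vecs_def Pp_def)+
  qed (use k card in auto)
  then show ?thesis unfolding card .
qed

lemma fspan2_snd_zero: "fspan2 {(\<xi>, 0::real) | \<xi>. \<xi> \<in> S} = {(\<xi>, 0) | \<xi>. \<xi> \<in> fspan S}"
proof (intro set_eqI iffI)
  fix x assume "x \<in> fspan2 {(\<xi>, 0::real) | \<xi>. \<xi> \<in> S}"
  then obtain F c where F: "finite F" "F \<subseteq> {(\<xi>, 0::real) | \<xi>. \<xi> \<in> S}"
    and x: "x = (\<lambda>\<gamma>. \<Sum>v\<in>F. c v * fst v \<gamma>, \<Sum>v\<in>F. c v * snd v)"
    unfolding fspan2_def by auto
  have "(\<Sum>v\<in>F. c v * snd v) = 0" by (rule sum.neutral) (use F in auto)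
  moreover have inj: "inj_on fst F" using F by (auto simp: inj_on_def)
  have "(\<Sum>v\<in>F. c v * fst v \<gamma>) = (\<Sum>u\<in>fst ` F. c (u, 0) * u \<gamma>)" for \<gamma>
    unfolding sum.reindex[OF inj] by (rule sum.cong) (use F in auto)
  moreover have "finite (fst ` F)" "fst ` F \<subseteq> S" using F by auto
  ultimately show "x \<in> {(\<xi>, 0) | \<xi>. \<xi> \<in> fspan S}"
    unfolding x fspan_def by (auto intro!: exI[of _ "fst ` F"] exI[of _ "\<lambda>u. c (u, 0)"])
next
  fix x :: "('a \<Rightarrow> real) \<times> real" assume "x \<in> {(\<xi>, 0) | \<xi>. \<xi> \<in> fspan S}"
  then obtain F c where F: "finite F" "F \<subseteq> S" and x: "x = (\<lambda>\<gamma>. \<Sum>v\<in>F. c v * v \<gamma>, 0)"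
    unfolding fspan_def by auto
  let ?F = "(\<lambda>u. (u, 0::real)) ` F"
  have inj: "inj_on (\<lambda>u. (u, 0::real)) F" by (auto simp: inj_on_def)
  have "(\<Sum>v\<in>?F. c (fst v) * fst v \<gamma>) = (\<Sum>v\<in>F. c v * v \<gamma>)" for \<gamma>
    unfolding sum.reindex[OF inj] by simp
  moreover have "(\<Sum>v\<in>?F. c (fst v) * snd v) = 0" by (rule sum.neutral) auto
  moreover have "finite ?F" "?F \<subseteq> {(\<xi>, 0::real) | \<xi>. \<xi> \<in> S}" using F by auto
  ultimately show "x \<in> fspan2 {(\<xi>, 0::real) | \<xi>. \<xi> \<in> S}"
    unfolding x fspan2_def by (auto intro!: exI[of _ ?F] exI[of _ "\<lambda>v. c (fst v)"])
qed

text \<open>Appending and dropping a zero coordinate are continuous, so they carry closures into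
  closures; the last coordinate stays 0 in the closure because \<open>{0}\<close> is closed.\<close>

lemma primePhi_snd_zero:
  "(a, \<xi>, l) \<in> primePhi p {(x, \<zeta>, 0) | x \<zeta>. (x, \<zeta>) \<in> E} \<longleftrightarrow> l = 0 \<and> (a, \<xi>) \<in> primeE p E"
proof -
  let ?g = "\<lambda>(x, y, \<zeta>). (x, y, \<zeta>, 0::real)" and ?f = "\<lambda>(x, y, \<zeta>, m :: real). (x, y, \<zeta>)"
  let ?D = "DeltaPhi p {(x, \<zeta>, 0) | x \<zeta>. (x, \<zeta>) \<in> E}"
  have D: "?D = ?g ` DeltaE p E"
  proof (intro set_eqI iffI)
    fix z assume "z \<in> ?D"
    then obtain a b \<xi> \<eta> where "z = (a, b, (\<lambda>\<gamma>. \<xi> \<gamma> + \<eta> \<gamma>), 0)" "(a, \<xi>) \<in> E" "(b, \<eta>) \<in> E" "Wcond p a b \<eta>"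
      unfolding DeltaPhi_def by auto
    moreover from this have "(a, b, (\<lambda>\<gamma>. \<xi> \<gamma> + \<eta> \<gamma>)) \<in> DeltaE p E" unfolding DeltaE_def by blast
    ultimately show "z \<in> ?g ` DeltaE p E" by force
  next
    fix z assume "z \<in> ?g ` DeltaE p E"
    then obtain a b \<xi> \<eta> where z: "z = (a, b, (\<lambda>\<gamma>. \<xi> \<gamma> + \<eta> \<gamma>), 0)" "(a, \<xi>) \<in> E" "(b, \<eta>) \<in> E" "Wcond p a b \<eta>"
      unfolding DeltaE_def by auto
    have "z = (a, b, (\<lambda>\<gamma>. \<xi> \<gamma> + \<eta> \<gamma>), 0 + 0) \<and> (a, \<xi>, 0) \<in> {(x, \<zeta>, 0) | x \<zeta>. (x, \<zeta>) \<in> E}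
        \<and> (b, \<eta>, 0) \<in> {(x, \<zeta>, 0) | x \<zeta>. (x, \<zeta>) \<in> E} \<and> Wcond p a b \<eta>" using z by simp
    then show "z \<in> ?D" unfolding DeltaPhi_def mem_Collect_eq by (intro exI)
  qed
  have g: "continuous_on UNIV ?g" and f: "continuous_on UNIV ?f"
    unfolding split_def by (intro continuous_intros)+
  have "?g ` closure (DeltaE p E) \<subseteq> closure ?D" unfolding D
    by (rule image_closure_subset[OF continuous_on_subset[OF g]]) (auto simp: closure_subset)
  moreover have "?f ` closure ?D \<subseteq> closure (DeltaE p E)" unfolding D
    by (rule image_closure_subset[OF continuous_on_subset[OF f]])
      (use closure_subset[of "DeltaE p E"] in \<open>auto simp: image_image split_def\<close>)
  moreover have "(\<lambda>(x, y, \<zeta>, m). m) ` closure ?D \<subseteq> {0}" unfolding D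
    by (rule image_closure_subset) (auto simp: split_def intro!: continuous_intros)
  ultimately show ?thesis unfolding primePhi_def primeE_def by force
qed

lemma nabla_iter_zero_eq: "nabla_iter p Z (\<lambda>_. 0) k = {(a, \<xi>, 0) | a \<xi>. (a, \<xi>) \<in> (rhoE p Z ^^ k) (E0 p Z)}"
proof (induction k)
  case 0
  show ?case by (auto simp: nabla_iter_0 Phi0_def E0_def)
next
  case (Suc k)
  let ?E = "(rhoE p Z ^^ k) (E0 p Z)"
  have "{v. (a, v) \<in> primePhi p (nabla_iter p Z (\<lambda>_. 0) k)} = {(\<xi>, 0) | \<xi>. \<xi> \<in> {\<xi>. (a, \<xi>) \<in> primeE p ?E}}" for a
    unfolding Suc by (auto simp: primePhi_snd_zero)
  then have eq: "fspan2 {v. (a, v) \<in> primePhi p (nabla_iter p Z (\<lambda>_. 0) k)}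
      = {(\<xi>, 0) | \<xi>. \<xi> \<in> fspan {\<xi>. (a, \<xi>) \<in> primeE p ?E}}" for a
    by (simp only: fspan2_snd_zero)
  show ?case unfolding nabla_iter_Suc rhoPhi_def eq by (auto simp: rhoE_def[of p Z ?E])
qed

lemma tau_iff: "(a, \<xi>) \<in> tau p Z \<longleftrightarrow> (a, \<xi>, 0) \<in> nabla_iter p Z (\<lambda>_. 0) (2 * dimP p TYPE('d::finite))"
  for Z :: "(real^'d) set"
  by (simp add: nabla_iter_zero_eq tau_def)

lemma nabla_iter_zero_tau: "(a, \<xi>, l) \<in> nabla_iter p Z (\<lambda>_. 0) k \<Longrightarrow> (a, \<xi>) \<in> tau p Z"
  for Z :: "(real^'d::finite) set"
  using nabla_iter_mono[of k "max k (2 * dimP p TYPE('d))" p Z "\<lambda>_. 0"] nabla_iter_zero_snd[of a \<xi> l p Z k]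
    nabla_iter_zero_stable[of p "max k (2 * dimP p TYPE('d))" Z]
  by (auto simp: tau_iff)

section \<open>The pushforward as a bundle morphism\<close>

lemma Cp_map_tendsto:
  assumes V: "open V" and \<phi>: "Cp_map p \<phi> V" and b0: "b0 \<in> V" and f: "(f \<longlongrightarrow> b0) F"
  shows "((\<lambda>x. \<phi> (f x)) \<longlongrightarrow> \<phi> b0) F"
proof (rule vec_tendstoI)
  fix j
  have "continuous_on V (\<lambda>y. \<phi> y $ j)" using \<phi> Cp_continuous_on by (auto simp: Cp_map_def)
  then have "isCont (\<lambda>y. \<phi> y $ j) b0" using V b0 continuous_on_eq_continuous_at by blast
  then show "((\<lambda>x. \<phi> (f x) $ j) \<longlongrightarrow> \<phi> b0 $ j) F" using f by (rule isCont_tendsto_compose)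
qed

text \<open>The scalars \<open>e i\<close> are \<open>1\<close> for the morphism property and \<open>1 / (s i + t i)\<close> for the rescaling that
  excludes unbounded real components.\<close>

lemma approximates_pushfwd:
  fixes \<phi> :: "real^'m::finite \<Rightarrow> real^'n::finite"
  assumes V: "open V" and \<phi>: "Cp_map p \<phi> V" and b0: "b0 \<in> V"
    and ap: "approximates p \<Phi> b0 b \<xi> s c \<eta> t \<zeta>"
    and push: "\<And>b \<eta> l. (b, \<eta>, l) \<in> \<Phi> \<Longrightarrow> (\<phi> b, pushfwd p \<phi> b \<eta>, l) \<in> \<Psi>"
    and \<Psi>: "lin_bundle p X \<Psi>"
    and e: "eventually (\<lambda>i. \<bar>e i\<bar> \<le> 1) sequentially" "e \<longlonglongrightarrow> e0" "(\<lambda>i. e i * (s i + t i)) \<longlonglongrightarrow> l"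
    and X: "\<phi> b0 \<in> X"
  shows "\<exists>C>0. (\<phi> b0, (\<lambda>\<gamma>. C * (e0 * pushfwd p \<phi> b0 \<zeta> \<gamma>)), C * l) \<in> rhoPhi p X \<Psi>"
proof -
  obtain d C where d: "d > 0" and C: "C > 0"
    and W: "\<And>b c \<eta>. b \<in> ball b0 d \<Longrightarrow> c \<in> ball b0 d \<Longrightarrow> Wcond p b c \<eta> \<Longrightarrow>
      Wcond p (\<phi> b) (\<phi> c) (\<lambda>\<gamma>. C * pushfwd p \<phi> c \<eta> \<gamma>)"
    using Wcond_pushfwd[OF V \<phi> b0] by blast
  note m = approximatesD[OF ap]
  have "(\<phi> b0, (\<lambda>\<gamma>. C * (e0 * pushfwd p \<phi> b0 \<zeta> \<gamma>)), C * l) \<in> primePhi p \<Psi>"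
  proof (rule primePhiI_eventually[where b = "\<lambda>i. \<phi> (b i)" and c = "\<lambda>i. \<phi> (c i)"
        and \<xi> = "\<lambda>i \<gamma>. C * (e i * pushfwd p \<phi> (b i) (\<xi> i) \<gamma>)" and \<eta> = "\<lambda>i \<gamma>. C * (e i * pushfwd p \<phi> (c i) (\<eta> i) \<gamma>)"
        and s = "\<lambda>i. C * (e i * s i)" and t = "\<lambda>i. C * (e i * t i)"])
    have "eventually (\<lambda>i. dist (b i) b0 < d) sequentially" "eventually (\<lambda>i. dist (c i) b0 < d) sequentially"
      using m(4,5) d tendstoD by blast+
    then show "eventually (\<lambda>i. (\<phi> (b i), (\<lambda>\<gamma>. C * (e i * pushfwd p \<phi> (b i) (\<xi> i) \<gamma>)), C * (e i * s i)) \<in> \<Psi> \<and>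
        (\<phi> (c i), (\<lambda>\<gamma>. C * (e i * pushfwd p \<phi> (c i) (\<eta> i) \<gamma>)), C * (e i * t i)) \<in> \<Psi> \<and>
        Wcond p (\<phi> (b i)) (\<phi> (c i)) (\<lambda>\<gamma>. C * (e i * pushfwd p \<phi> (c i) (\<eta> i) \<gamma>))) sequentially"
      using e(1)
    proof eventually_elim
      case (elim i)
      have "Wcond p (\<phi> (b i)) (\<phi> (c i)) (\<lambda>\<gamma>. C * pushfwd p \<phi> (c i) (\<eta> i) \<gamma>)"
        by (rule W) (use elim m(3) in \<open>auto simp: dist_commute\<close>)
      from Wcond_scale[OF this elim(3)]
      have "Wcond p (\<phi> (b i)) (\<phi> (c i)) (\<lambda>\<gamma>. C * (e i * pushfwd p \<phi> (c i) (\<eta> i) \<gamma>))"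
        by (simp add: mult.left_commute)
      then show ?case
        using bundle_scale[OF \<Psi> bundle_scale[OF \<Psi> push[OF m(1)]]] bundle_scale[OF \<Psi> bundle_scale[OF \<Psi> push[OF m(2)]]]
        by blast
    qed
    show "(\<lambda>i. \<phi> (b i)) \<longlonglongrightarrow> \<phi> b0" "(\<lambda>i. \<phi> (c i)) \<longlonglongrightarrow> \<phi> b0"
      by (rule Cp_map_tendsto[OF V \<phi> b0 m(4)], rule Cp_map_tendsto[OF V \<phi> b0 m(5)])
    have "(\<lambda>i. pushfwd p \<phi> (b i) (\<xi> i) \<gamma> + pushfwd p \<phi> (c i) (\<eta> i) \<gamma>) \<longlonglongrightarrow> pushfwd p \<phi> b0 \<zeta> \<gamma>" for \<gamma>
      by (rule pushfwd_tendsto_sum[OF V \<phi> b0 m(4,5,3,6)])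
    then show "(\<lambda>i. C * (e i * pushfwd p \<phi> (b i) (\<xi> i) \<gamma>) + C * (e i * pushfwd p \<phi> (c i) (\<eta> i) \<gamma>))
        \<longlonglongrightarrow> C * (e0 * pushfwd p \<phi> b0 \<zeta> \<gamma>)" for \<gamma>
      unfolding distrib_left[symmetric] by (intro tendsto_mult_left tendsto_mult e(2))
    show "(\<lambda>i. C * (e i * s i) + C * (e i * t i)) \<longlonglongrightarrow> C * l"
      using tendsto_mult_left[OF e(3), of C] by (simp add: algebra_simps)
  qed
  then show ?thesis using C rhoPhi_prime[OF X] by blast
qed

text \<open>The constant \<open>C\<close> that repairs the growth condition is divided out again in
  the linear fibre; linearity of the pushforward then passes from the derived bundle to its
  span.\<close>

lemma rhoPhi_pushfwd:
  fixes \<phi> :: "real^'m::finite \<Rightarrow> real^'n::finite"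
  assumes V: "open V" and \<phi>: "Cp_map p \<phi> V" and Y: "Y \<subseteq> V" and YX: "\<phi> ` Y \<subseteq> X"
    and push: "\<And>b \<eta> l. (b, \<eta>, l) \<in> \<Phi> \<Longrightarrow> (\<phi> b, pushfwd p \<phi> b \<eta>, l) \<in> \<Psi>"
    and \<Psi>: "lin_bundle p X \<Psi>" and mem: "(b0, \<zeta>, l) \<in> rhoPhi p Y \<Phi>"
  shows "(\<phi> b0, pushfwd p \<phi> b0 \<zeta>, l) \<in> rhoPhi p X \<Psi>"
proof -
  have b0: "b0 \<in> Y" using mem by (rule rhoPhi_baseD)
  then have b0V: "b0 \<in> V" and X: "\<phi> b0 \<in> X" using Y YX by auto
  have prime: "(\<phi> b0, pushfwd p \<phi> b0 \<zeta>, l) \<in> rhoPhi p X \<Psi>" if pr: "(b0, \<zeta>, l) \<in> primePhi p \<Phi>" for \<zeta> l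
  proof -
    obtain b \<xi> s c \<eta> t where ap: "approximates p \<Phi> b0 b \<xi> s c \<eta> t \<zeta>" and l: "(\<lambda>i. s i + t i) \<longlonglongrightarrow> l"
      using pr by (rule primePhiE)
    obtain C where C: "C > 0" "(\<phi> b0, (\<lambda>\<gamma>. C * (1 * pushfwd p \<phi> b0 \<zeta> \<gamma>)), C * l) \<in> rhoPhi p X \<Psi>"
      using approximates_pushfwd[OF V \<phi> b0V ap push \<Psi> _ _ _ X, of "\<lambda>_. 1" 1 l] l by auto
    show ?thesis
      using bundle_scale[OF bundle_rhoPhi[OF \<Psi>] C(2), of "1 / C"] C(1) by simp
  qed
  show ?thesis
    using mem
  proof (rule rhoPhi_induct)
    show "(\<phi> b0, pushfwd p \<phi> b0 (\<lambda>_. 0), 0) \<in> rhoPhi p X \<Psi>"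
      unfolding pushfwd_zero by (rule rhoPhi_zero[OF X])
    show "(\<phi> b0, pushfwd p \<phi> b0 (\<lambda>\<gamma>. c * \<xi> \<gamma> + \<eta> \<gamma>), c * l + m) \<in> rhoPhi p X \<Psi>"
      if "(b0, \<xi>, l) \<in> primePhi p \<Phi>" "(\<phi> b0, pushfwd p \<phi> b0 \<eta>, m) \<in> rhoPhi p X \<Psi>" for c \<xi> l \<eta> m
      unfolding pushfwd_linear by (rule rhoPhi_comb[OF prime[OF that(1)] that(2)])
  qed
qed

text \<open>The level \<open>k\<close> is the same on both sides; the different iteration counts for
  \<open>X\<close> and \<open>Y\<close> are reconciled afterwards by stabilization.\<close>

lemma nabla_iter_pushfwd:
  fixes \<phi> :: "real^'m::finite \<Rightarrow> real^'n::finite"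
  assumes V: "open V" and \<phi>: "Cp_map p \<phi> V" and Y: "Y \<subseteq> V" and YX: "\<phi> ` Y \<subseteq> X"
  shows "(b, \<eta>, l) \<in> nabla_iter p Y (f \<circ> \<phi>) k \<Longrightarrow> (\<phi> b, pushfwd p \<phi> b \<eta>, l) \<in> nabla_iter p X f k"
proof (induction k arbitrary: b \<eta> l)
  case 0
  then obtain s where s: "b \<in> Y" "\<eta> = (\<lambda>\<gamma>. s * delta p b \<gamma>)" "l = s * f (\<phi> b)"
    by (auto simp: nabla_iter_0 Phi0_def)
  have "pushfwd p \<phi> b \<eta> = (\<lambda>\<gamma>. s * delta p (\<phi> b) \<gamma>)"
    unfolding s(2) pushfwd_scale pushfwd_delta ..
  then show ?case using s YX by (auto simp: nabla_iter_0 Phi0_def)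
next
  case (Suc k)
  show ?case unfolding nabla_iter_Suc
    by (rule rhoPhi_pushfwd[OF V \<phi> Y YX Suc.IH bundle_nabla_iter]) (use Suc.prems in \<open>simp_all add: nabla_iter_Suc\<close>)
qed

section \<open>Lifting elements of \<open>tau\<close> to the bundle of the composed function\<close>

text \<open>If some bound held for infinitely many indices, Bolzano-Weierstrass would give a
  convergent subsequence.\<close>

lemma abs_at_top_or_convergent_subseq:
  fixes u :: "nat \<Rightarrow> real"
  shows "filterlim (\<lambda>i. \<bar>u i\<bar>) at_top sequentially \<or> (\<exists>r l. strict_mono (r :: nat \<Rightarrow> nat) \<and> (u \<circ> r) \<longlonglongrightarrow> l)"
proof (rule disjCI)
  assume no: "\<not> (\<exists>r l. strict_mono (r :: nat \<Rightarrow> nat) \<and> (u \<circ> r) \<longlonglongrightarrow> l)"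
  have fin: "finite {i. \<bar>u i\<bar> \<le> B}" for B
  proof (rule ccontr)
    assume "infinite {i. \<bar>u i\<bar> \<le> B}"
    then obtain r :: "nat \<Rightarrow> nat" where r: "strict_mono r" "\<And>n. r n \<in> {i. \<bar>u i\<bar> \<le> B}"
      using infinite_enumerate by blast
    then have "bounded (range (u \<circ> r))" unfolding bounded_iff by auto
    then obtain l r' where "strict_mono (r' :: nat \<Rightarrow> nat)" "((u \<circ> r) \<circ> r') \<longlonglongrightarrow> l"
      using bounded_imp_convergent_subsequence by blast
    then show False using no strict_mono_o[OF r(1)] by (metis comp_assoc)
  qed
  have "eventually (\<lambda>i. B \<le> \<bar>u i\<bar>) sequentially" for B
  proof -
    have "eventually (\<lambda>i. i \<notin> {i. \<bar>u i\<bar> \<le> B}) cofinite" unfolding eventually_cofinite using fin[of B] by simp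
    then show ?thesis unfolding cofinite_eq_sequentially by eventually_elim auto
  qed
  then show "filterlim (\<lambda>i. \<bar>u i\<bar>) at_top sequentially" by (simp add: filterlim_at_top)
qed

lemma approximates_subseq:
  assumes "approximates p \<Phi> a b \<xi> s c \<eta> t \<zeta>" "strict_mono r"
  shows "approximates p \<Phi> a (b \<circ> r) (\<xi> \<circ> r) (s \<circ> r) (c \<circ> r) (\<eta> \<circ> r) (t \<circ> r) \<zeta>"
proof -
  note m = approximatesD[OF assms(1)]
  have "(\<lambda>i. \<xi> (r i) \<gamma> + \<eta> (r i) \<gamma>) \<longlonglongrightarrow> \<zeta> \<gamma>" for \<gamma>
    using LIMSEQ_subseq_LIMSEQ[OF m(6) assms(2)] by (simp add: o_def)
  then show ?thesis
    using m(1-3) LIMSEQ_subseq_LIMSEQ[OF m(4) assms(2)] LIMSEQ_subseq_LIMSEQ[OF m(5) assms(2)]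
    by (simp add: approximates_def)
qed

lemma nabla_fun_unique:
  assumes "nabla_is_fun p Z h" "(a, \<xi>) \<in> tau p Z" "(a, \<xi>, l) \<in> nabla p Z h" "(a, \<xi>, m) \<in> nabla p Z h"
  shows "l = m"
  using assms unfolding nabla_is_fun_def by blast

lemma zero_in_tau: "a \<in> Z \<Longrightarrow> (a, (\<lambda>_. 0)) \<in> tau p Z"
  using bundle_zero[OF bundle_nabla_iter] nabla_iter_zero_tau by blast

lemma tau_lift:
  fixes \<phi> :: "real^'m::finite \<Rightarrow> real^'n::finite"
  assumes V: "open V" and \<phi>: "Cp_map p \<phi> V" and Y: "Y \<subseteq> V" and YX: "\<phi> ` Y \<subseteq> X"
    and fn: "nabla_is_fun p X f"
  shows "(b0, \<zeta>, u) \<in> nabla_iter p Y (\<lambda>_. 0) k \<Longrightarrow> \<exists>l. (b0, \<zeta>, l) \<in> nabla_iter p Y (f \<circ> \<phi>) k"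
proof (induction k arbitrary: b0 \<zeta> u)
  case 0
  then show ?case by (auto simp: nabla_iter_0 Phi0_def)
next
  case (Suc k)
  let ?G = "nabla_iter p Y (f \<circ> \<phi>) k"
  have mem: "(b0, \<zeta>, u) \<in> rhoPhi p Y (nabla_iter p Y (\<lambda>_. 0) k)" using Suc.prems by (simp add: nabla_iter_Suc)
  then have b0: "b0 \<in> Y" by (rule rhoPhi_baseD)
  then have b0V: "b0 \<in> V" and X: "\<phi> b0 \<in> X" using Y YX by auto
  have prime: "\<exists>l. (b0, \<zeta>, l) \<in> rhoPhi p Y ?G" if pr: "(b0, \<zeta>, u) \<in> primePhi p (nabla_iter p Y (\<lambda>_. 0) k)" for \<zeta> u
  proof -
    obtain b \<xi> s0 c \<eta> t0 where ap0: "approximates p (nabla_iter p Y (\<lambda>_. 0) k) b0 b \<xi> s0 c \<eta> t0 \<zeta>" and "(\<lambda>i. s0 i + t0 i) \<longlonglongrightarrow> u"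
      using pr by (rule primePhiE)
    note m = approximatesD[OF ap0]
    \<comment> \<open>The lifts are chosen separately for each \<open>i\<close>, so nothing is known
      yet about the size of \<open>s i + t i\<close>.\<close>
    have "\<forall>i. \<exists>l. (b i, \<xi> i, l) \<in> ?G" "\<forall>i. \<exists>l. (c i, \<eta> i, l) \<in> ?G" using Suc.IH m(1,2) by blast+
    then obtain s t where st: "\<And>i. (b i, \<xi> i, s i) \<in> ?G" "\<And>i. (c i, \<eta> i, t i) \<in> ?G" by metis
    have ap: "approximates p ?G b0 b \<xi> s c \<eta> t \<zeta>" using st m(3-6) by (simp add: approximates_def)
    \<comment> \<open>Landing in the stable bundle \<open>nabla p X f\<close> rather than at level
      \<open>k\<close> keeps the limit taken below in that bundle, by
      \<open>rhoPhi_nabla\<close>.\<close>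
    have push: "(\<phi> b, pushfwd p \<phi> b \<eta>, l) \<in> nabla p X f" if "(b, \<eta>, l) \<in> ?G" for b \<eta> l
      using nabla_iter_pushfwd[OF V \<phi> Y YX that] nabla_iter_subset_nabla by blast
    have "\<not> filterlim (\<lambda>i. \<bar>s i + t i\<bar>) at_top sequentially"
    proof
      assume inf: "filterlim (\<lambda>i. \<bar>s i + t i\<bar>) at_top sequentially"
      have ev: "eventually (\<lambda>i. 1 \<le> \<bar>s i + t i\<bar>) sequentially"
        using inf by (simp add: filterlim_at_top)
      have "(\<lambda>i. inverse \<bar>s i + t i\<bar>) \<longlonglongrightarrow> 0" by (rule tendsto_inverse_0_at_top[OF inf])
      then have e0: "(\<lambda>i. inverse (s i + t i)) \<longlonglongrightarrow> 0"
        unfolding tendsto_rabs_zero_iff[of "\<lambda>i. inverse (s i + t i)", symmetric] by simp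
      have "eventually (\<lambda>i. 1 = inverse (s i + t i) * (s i + t i)) sequentially"
        using ev by eventually_elim auto
      then have e1: "(\<lambda>i. inverse (s i + t i) * (s i + t i)) \<longlonglongrightarrow> 1"
        by (rule Lim_transform_eventually[OF tendsto_const])
      have e2: "eventually (\<lambda>i. \<bar>inverse (s i + t i)\<bar> \<le> 1) sequentially"
        using ev by eventually_elim (simp add: inverse_le_1_iff)
      \<comment> \<open>After division by \<open>s i + t i\<close> the functionals tend to 0 while
        the real components have limit 1, leaving a nonzero value over the zero functional.\<close>
      obtain C where C: "C > 0" "(\<phi> b0, (\<lambda>\<gamma>. C * (0 * pushfwd p \<phi> b0 \<zeta> \<gamma>)), C * 1) \<in> rhoPhi p X (nabla p X f)"
        using approximates_pushfwd[OF V \<phi> b0V ap push bundle_nabla e2 e0 e1 X] by auto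
      then have "(\<phi> b0, (\<lambda>_. 0), C) \<in> nabla p X f" by (simp add: rhoPhi_nabla)
      then have "C = 0"
        by (rule nabla_fun_unique[OF fn zero_in_tau[OF X] _ bundle_zero[OF bundle_nabla X]])
      then show False using C(1) by simp
    qed
    then obtain r l where r: "strict_mono r" and l: "((\<lambda>i. s i + t i) \<circ> r) \<longlonglongrightarrow> l"
      using abs_at_top_or_convergent_subseq[of "\<lambda>i. s i + t i"] by blast
    have "(b0, \<zeta>, l) \<in> primePhi p ?G"
      by (rule primePhiI[OF approximates_subseq[OF ap r]]) (use l in \<open>simp add: o_def\<close>)
    then show ?thesis using rhoPhi_prime[OF b0] by blast
  qed
  have "\<exists>l. (b0, \<zeta>, l) \<in> rhoPhi p Y ?G"
    using mem
  proof (rule rhoPhi_induct)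
    show "\<exists>l. (b0, (\<lambda>_. 0), l) \<in> rhoPhi p Y ?G" using rhoPhi_zero[OF b0] by blast
    show "\<exists>l. (b0, (\<lambda>\<gamma>. c * \<xi> \<gamma> + \<eta> \<gamma>), l) \<in> rhoPhi p Y ?G"
      if pr: "(b0, \<xi>, u) \<in> primePhi p (nabla_iter p Y (\<lambda>_. 0) k)" and "\<exists>l. (b0, \<eta>, l) \<in> rhoPhi p Y ?G" for c \<xi> u \<eta>
    proof -
      obtain l m where "(b0, \<xi>, l) \<in> rhoPhi p Y ?G" "(b0, \<eta>, m) \<in> rhoPhi p Y ?G"
        using prime[OF pr] \<open>\<exists>l. (b0, \<eta>, l) \<in> _\<close> by blast
      then show ?thesis by (intro exI) (rule rhoPhi_comb)
    qed
  qed
  then show ?case unfolding nabla_iter_Suc .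
qed

section \<open>The morphism property, the transfer of \<open>nabla\<close> and the formula by a
  polynomial\<close>

theorem theorem5p2:
  fixes p :: nat
    and U :: "(real^'n::finite) set" and V :: "(real^'m::finite) set"
    and X :: "(real^'n) set" and Y :: "(real^'m) set"
    and \<phi> :: "real^'m \<Rightarrow> real^'n"
  assumes U: "open U" and V: "open V"
    and X: "closedin (top_of_set U) X" and Y: "closedin (top_of_set V) Y"
    and phi_Cp: "Cp_map p \<phi> V" and phi_V: "\<phi> ` V \<subseteq> U"
    and phi_Y: "\<phi> ` Y \<subseteq> X"
  shows
    "(\<forall>b\<in>Y. \<forall>\<eta>. (b, \<eta>) \<in> tau p Y \<longrightarrow> (\<phi> b, pushfwd p \<phi> b \<eta>) \<in> tau p X)
     \<and> continuous_on (tau p Y) (\<lambda>(b, \<eta>). (\<phi> b, pushfwd p \<phi> b \<eta>))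
     \<and> (\<forall>b\<in>Y. \<forall>\<eta>1 \<eta>2 c. (b, \<eta>1) \<in> tau p Y \<longrightarrow> (b, \<eta>2) \<in> tau p Y \<longrightarrow>
          pushfwd p \<phi> b (\<lambda>\<gamma>. c * \<eta>1 \<gamma> + \<eta>2 \<gamma>)
            = (\<lambda>\<gamma>. c * pushfwd p \<phi> b \<eta>1 \<gamma> + pushfwd p \<phi> b \<eta>2 \<gamma>))
     \<and> (\<forall>f :: real^'n \<Rightarrow> real. nabla_is_fun p X f \<longrightarrow>
          nabla_is_fun p Y (f \<circ> \<phi>)
          \<and> (\<forall>b\<in>Y. \<forall>\<eta>. (b, \<eta>) \<in> tau p Y \<longrightarrow>
               nabla_val p Y (f \<circ> \<phi>) b \<eta> = nabla_val p X f (\<phi> b) (pushfwd p \<phi> b \<eta>))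
          \<and> (\<forall>b\<in>Y. \<forall>P\<in>Pp p.
               (\<forall>\<xi>. (\<phi> b, \<xi>) \<in> tau p X \<longrightarrow> dual_apply p \<xi> P = nabla_val p X f (\<phi> b) \<xi>) \<longrightarrow>
               (\<forall>\<eta>. (b, \<eta>) \<in> tau p Y \<longrightarrow>
                  nabla_val p Y (f \<circ> \<phi>) b \<eta> = dual_apply p \<eta> (pullback p \<phi> b P))))"
proof -
  have YV: "Y \<subseteq> V" using closedin_subset[OF Y] by simp
  have base: "b \<in> Y" if "(b, \<eta>) \<in> tau p Y" for b \<eta>
    using that bundle_baseD[OF bundle_nabla_iter] unfolding tau_iff by blast
  \<comment> \<open>The zero function composed with \<open>\<phi>\<close> is again zero, so
    \<open>nabla_iter_pushfwd\<close> applies at the iteration count of \<open>Y\<close>;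
    \<open>nabla_iter_zero_tau\<close> returns to that of \<open>X\<close>.\<close>
  have tau_push: "(\<phi> b, pushfwd p \<phi> b \<eta>) \<in> tau p X" if "(b, \<eta>) \<in> tau p Y" for b \<eta>
    using nabla_iter_pushfwd[OF V phi_Cp YV phi_Y, of b \<eta> 0 "\<lambda>_. 0"] that nabla_iter_zero_tau
    by (fastforce simp: tau_iff o_def)
  have cont: "continuous_on (tau p Y) (\<lambda>(b, \<eta>). (\<phi> b, pushfwd p \<phi> b \<eta>))"
    unfolding continuous_on_def
  proof
    fix x assume x: "x \<in> tau p Y"
    obtain b0 \<eta>0 where x_eq: "x = (b0, \<eta>0)" by (cases x)
    have b0: "b0 \<in> V" using base x YV unfolding x_eq by blast
    have id: "((\<lambda>z. z) \<longlongrightarrow> (b0, \<eta>0)) (at x within tau p Y)" unfolding x_eq by (rule tendsto_ident_at)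
    have 1: "(fst \<longlongrightarrow> b0) (at x within tau p Y)" using tendsto_fst[OF id] by simp
    have 2: "((\<lambda>z. snd z \<gamma>) \<longlongrightarrow> \<eta>0 \<gamma>) (at x within tau p Y)" for \<gamma>
      using tendsto_snd[OF id] unfolding tendsto_fun_iff by simp
    have "((\<lambda>z. pushfwd p \<phi> (fst z) (snd z)) \<longlongrightarrow> pushfwd p \<phi> b0 \<eta>0) (at x within tau p Y)"
      unfolding tendsto_fun_iff by (intro allI tendsto_pushfwd[OF V phi_Cp b0 1 2])
    from tendsto_Pair[OF Cp_map_tendsto[OF V phi_Cp b0 1] this]
    show "((\<lambda>(b, \<eta>). (\<phi> b, pushfwd p \<phi> b \<eta>)) \<longlongrightarrow> (case x of (b, \<eta>) \<Rightarrow> (\<phi> b, pushfwd p \<phi> b \<eta>))) (at x within tau p Y)"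
      by (simp add: split_def x_eq)
  qed
  have main: "nabla_is_fun p Y (f \<circ> \<phi>) \<and> (\<forall>b \<eta>. (b, \<eta>) \<in> tau p Y \<longrightarrow>
      nabla_val p Y (f \<circ> \<phi>) b \<eta> = nabla_val p X f (\<phi> b) (pushfwd p \<phi> b \<eta>))" if fn: "nabla_is_fun p X f" for f
  proof -
    have ex: "\<exists>l. (b, \<eta>, l) \<in> nabla p Y (f \<circ> \<phi>)" if t: "(b, \<eta>) \<in> tau p Y" for b \<eta>
      using tau_lift[OF V phi_Cp YV phi_Y fn] nabla_iter_subset_nabla t unfolding tau_iff by blast
    have push: "(\<phi> b, pushfwd p \<phi> b \<eta>, l) \<in> nabla p X f" if "(b, \<eta>, l) \<in> nabla p Y (f \<circ> \<phi>)" for b \<eta> l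
      using nabla_iter_pushfwd[OF V phi_Cp YV phi_Y] that nabla_iter_subset_nabla nabla_iter_nabla[OF order_refl] by blast
    \<comment> \<open>With \<open>m\<close> on the side of \<open>X\<close> this serves twice:
      pushing a second lift forward gives uniqueness over \<open>Y\<close>, and directly it
      identifies the two values.\<close>
    have uniq: "l = m" if "(b, \<eta>) \<in> tau p Y" "(b, \<eta>, l) \<in> nabla p Y (f \<circ> \<phi>)"
      "(\<phi> b, pushfwd p \<phi> b \<eta>, m) \<in> nabla p X f" for b \<eta> l m
      using nabla_fun_unique[OF fn tau_push[OF that(1)] push[OF that(2)] that(3)] .
    have isfun: "nabla_is_fun p Y (f \<circ> \<phi>)"
      unfolding nabla_is_fun_def using ex uniq push by blast
    have "nabla_val p Y (f \<circ> \<phi>) b \<eta> = nabla_val p X f (\<phi> b) (pushfwd p \<phi> b \<eta>)" if t: "(b, \<eta>) \<in> tau p Y" for b \<eta>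
    proof -
      obtain l where l: "(b, \<eta>, l) \<in> nabla p Y (f \<circ> \<phi>)" using ex[OF t] by blast
      have "nabla_val p Y (f \<circ> \<phi>) b \<eta> = l"
        unfolding nabla_val_def by (rule the_equality) (use l uniq[OF t _ push[OF l]] in blast)+
      moreover have "nabla_val p X f (\<phi> b) (pushfwd p \<phi> b \<eta>) = l"
        unfolding nabla_val_def by (rule the_equality) (use push[OF l] uniq[OF t l] in blast)+
      ultimately show ?thesis by simp
    qed
    with isfun show ?thesis by blast
  qed
  have part3: "nabla_val p Y (f \<circ> \<phi>) b \<eta> = dual_apply p \<eta> (pullback p \<phi> b P)"
    if "nabla_is_fun p X f" "b \<in> Y" "\<forall>\<xi>. (\<phi> b, \<xi>) \<in> tau p X \<longrightarrow> dual_apply p \<xi> P = nabla_val p X f (\<phi> b) \<xi>"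
      "(b, \<eta>) \<in> tau p Y" for f b P \<eta>
  proof -
    have "nabla_val p Y (f \<circ> \<phi>) b \<eta> = nabla_val p X f (\<phi> b) (pushfwd p \<phi> b \<eta>)"
      using main[OF that(1)] that(4) by blast
    also have "\<dots> = dual_apply p (pushfwd p \<phi> b \<eta>) P" using that(3) tau_push[OF that(4)] by simp
    also have "\<dots> = dual_apply p \<eta> (pullback p \<phi> b P)"
      by (rule dual_apply_pushfwd[OF V phi_Cp]) (use that(2) YV in blast)
    finally show ?thesis .
  qed
  show ?thesis
  proof (intro conjI)
    show "\<forall>b\<in>Y. \<forall>\<eta>. (b, \<eta>) \<in> tau p Y \<longrightarrow> (\<phi> b, pushfwd p \<phi> b \<eta>) \<in> tau p X"
      using tau_push by blast
    show "\<forall>f. nabla_is_fun p X f \<longrightarrow> nabla_is_fun p Y (f \<circ> \<phi>)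
          \<and> (\<forall>b\<in>Y. \<forall>\<eta>. (b, \<eta>) \<in> tau p Y \<longrightarrow>
               nabla_val p Y (f \<circ> \<phi>) b \<eta> = nabla_val p X f (\<phi> b) (pushfwd p \<phi> b \<eta>))
          \<and> (\<forall>b\<in>Y. \<forall>P\<in>Pp p.
               (\<forall>\<xi>. (\<phi> b, \<xi>) \<in> tau p X \<longrightarrow> dual_apply p \<xi> P = nabla_val p X f (\<phi> b) \<xi>) \<longrightarrow>
               (\<forall>\<eta>. (b, \<eta>) \<in> tau p Y \<longrightarrow>
                  nabla_val p Y (f \<circ> \<phi>) b \<eta> = dual_apply p \<eta> (pullback p \<phi> b P)))"
      by (intro allI impI conjI ballI part3) (use main in blast)+
  qed (use cont pushfwd_linear in blast)+
qed

end
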